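(* Assume that each of $r_1,\dots,r_k$ is Lipschitz on $[0,1]$, that $\lim_{N\to\infty}(N\varepsilon_N)^{-1}(\log N)^{\xi}=0$ for some fixed $\xi>8$, and that $\lim_{N\to\infty}\varepsilon_N=\varepsilon_\infty$ for some $\varepsilon_\infty\ge 0$. Then for all $i\in\mathcal I$, $$\mathrm{E}\left[\lambda_i(A_N)\right]=\lambda_i(B)+O\left(\sqrt{\varepsilon_N}+(N\varepsilon_N)^{-1}\right),$$ where $B$ is the $k\times k$ symmetric deterministic matrix, depending on $N$ (and on $i$), defined by $$B(j,l)=\sqrt{\theta_j\theta_l}\,N\varepsilon_N\, e_j^\prime e_l+\theta_i^{-2}\sqrt{\theta_j\theta_l}\,(N\varepsilon_N)^{-1}\,\mathrm{E}\left(e_j^\prime W_N^2 e_l\right),\qquad 1\le j,l\le k.$$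
   Context: Setting. Let $k\ge 1$, let $\theta_1\ge\dots\ge\theta_k>0$, and let $r_1,\dots,r_k:[0,1]\to\mathbb{R}$ be an orthonormal set in $L^2[0,1]$ such that $f(x,y):=\sum_{i=1}^k\theta_i r_i(x)r_i(y)\ge 0$ for all $(x,y)\in[0,1]^2$. Let $(\varepsilon_N)_{N\ge1}$ be a real sequence with $0<\varepsilon_N\le\left[\sup_{0\le x,y\le 1}f(x,y)\right]^{-1}$. For each $N\ge 1$, $A_N$ is the $N\times N$ random symmetric matrix whose entries $\{A_N(i,j):1\le i\le j\le N\}$ are independent with $A_N(i,j)\sim\mathrm{Bernoulli}(\varepsilon_N f(i/N,j/N))$ (self-loops allowed). $W_N:=A_N-\mathrm{E}(A_N)$, with entrywise expectation. For a real symmetric matrix $M$, $\lambda_1(M)\ge\lambda_2(M)\ge\cdots$ denote its eigenvalues. With $\theta_0=\infty$ and $\theta_{k+1}=-\infty$, $\mathcal I:=\{1\le i\le k:\theta_{i-1}>\theta_i>\theta_{i+1}\}$. For $1\le i\le k$, $e_i$ (depending on $N$) is the $N\times1$ vector with entries $e_i(m)=N^{-1/2}r_i(m/N)$, $1\le m\le N$; a prime denotes transpose. *)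

theory Defs
  imports
    "HOL-Probability.Probability"
    "HOL-Library.Landau_Symbols"
    "Jordan_Normal_Form.Char_Poly"
begin

text \<open>
  The indices \<open>1, \<dots>, k\<close> of \<open>\<theta>\<close>, \<open>r\<close> and the eigenvalues are 1-based as in the mathematics, whereas
  rows and columns of matrices and entries of vectors are 0-based: position \<open>m\<close> of a vector of
  length \<open>N\<close> belongs to the grid point \<open>(m + 1) / N\<close>, and position \<open>(a, b)\<close> of a \<open>k \<times> k\<close> matrix to
  the pair of indices \<open>(a + 1, b + 1)\<close>.
\<close>

definition orthonormal_L2 :: "nat \<Rightarrow> (nat \<Rightarrow> real \<Rightarrow> real) \<Rightarrow> bool" where
  "orthonormal_L2 k r \<longleftrightarrow>
     (\<forall>i\<in>{1..k}. r i \<in> borel_measurable (lebesgue_on {0..1})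
        \<and> integrable (lebesgue_on {0..1}) (\<lambda>x. (r i x)\<^sup>2)) \<and>
     (\<forall>i\<in>{1..k}. \<forall>j\<in>{1..k}.
        (\<integral>x. r i x * r j x \<partial>(lebesgue_on {0..1})) = (if i = j then 1 else 0))"

definition edge_kernel :: "nat \<Rightarrow> (nat \<Rightarrow> real) \<Rightarrow> (nat \<Rightarrow> real \<Rightarrow> real) \<Rightarrow> real \<Rightarrow> real \<Rightarrow> real" where
  "edge_kernel k \<theta> r x y = (\<Sum>i=1..k. \<theta> i * r i x * r i y)"

definition grid :: "nat \<Rightarrow> nat \<Rightarrow> real" where
  "grid N m = real (m + 1) / real N"

text \<open>
  \<open>A\<close> is a random symmetric \<open>N \<times> N\<close> matrix on the probability space \<open>M\<close> whose entries on and above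
  the diagonal are independent, the law of entry \<open>(i, j)\<close> being Bernoulli with parameter \<open>p i j\<close>,
  viewed as a measure on the real line.
\<close>

definition symmetric_bernoulli_matrix ::
  "'w measure \<Rightarrow> nat \<Rightarrow> (nat \<Rightarrow> nat \<Rightarrow> real) \<Rightarrow> ('w \<Rightarrow> real mat) \<Rightarrow> bool" where
  "symmetric_bernoulli_matrix M N p A \<longleftrightarrow>
     prob_space M \<and>
     (\<forall>\<omega>\<in>space M. A \<omega> \<in> carrier_mat N N \<and> transpose_mat (A \<omega>) = A \<omega>) \<and>
     prob_space.indep_vars M (\<lambda>_. borel) (\<lambda>(i, j) \<omega>. A \<omega> $$ (i, j)) {(i, j). i \<le> j \<and> j < N} \<and>
     (\<forall>i j. i \<le> j \<and> j < N \<longrightarrow>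
        distr M borel (\<lambda>\<omega>. A \<omega> $$ (i, j)) =
        distr (measure_pmf (bernoulli_pmf (p i j))) borel of_bool)"

definition expected_mat :: "'w measure \<Rightarrow> nat \<Rightarrow> ('w \<Rightarrow> real mat) \<Rightarrow> real mat" where
  "expected_mat M N A = Matrix.mat N N (\<lambda>(i, j). \<integral>\<omega>. A \<omega> $$ (i, j) \<partial>M)"

definition centred :: "'w measure \<Rightarrow> nat \<Rightarrow> ('w \<Rightarrow> real mat) \<Rightarrow> 'w \<Rightarrow> real mat" where
  "centred M N A \<omega> = A \<omega> - expected_mat M N A"

text \<open>
  The \<open>i\<close>-th largest eigenvalue, with eigenvalues repeated according to their multiplicity as
  roots of the characteristic polynomial. It is meant for real symmetric \<open>n \<times> n\<close> matrices, for
  which there are exactly \<open>n\<close> such roots, and \<open>1 \<le> i \<le> n\<close>; otherwise the value is unspecified.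
\<close>

definition eigval_desc :: "nat \<Rightarrow> real mat \<Rightarrow> real" where
  "eigval_desc i S = rev (sorted_list_of_multiset (proots (char_poly S))) ! (i - 1)"

definition theta_ext :: "nat \<Rightarrow> (nat \<Rightarrow> real) \<Rightarrow> nat \<Rightarrow> ereal" where
  "theta_ext k \<theta> i = (if i = 0 then \<infinity> else if i \<le> k then ereal (\<theta> i) else -\<infinity>)"

definition simple_indices :: "nat \<Rightarrow> (nat \<Rightarrow> real) \<Rightarrow> nat set" where
  "simple_indices k \<theta> =
     {i \<in> {1..k}. theta_ext k \<theta> (i - 1) > theta_ext k \<theta> i \<and> theta_ext k \<theta> i > theta_ext k \<theta> (i + 1)}"

definition evec :: "(nat \<Rightarrow> real \<Rightarrow> real) \<Rightarrow> nat \<Rightarrow> nat \<Rightarrow> real vec" where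
  "evec r N i = Matrix.vec N (\<lambda>m. r i (grid N m) / sqrt (real N))"

text \<open>The matrix \<open>B\<close> belonging to the index \<open>i\<close> and the size \<open>N\<close>; \<open>\<epsilon>\<close> is the value of
  \<open>\<epsilon>\<^sub>N\<close>, and \<open>A\<close> the random \<open>N \<times> N\<close> matrix.\<close>

definition Bmat ::
  "nat \<Rightarrow> (nat \<Rightarrow> real) \<Rightarrow> (nat \<Rightarrow> real \<Rightarrow> real) \<Rightarrow> 'w measure \<Rightarrow> nat \<Rightarrow> real \<Rightarrow> ('w \<Rightarrow> real mat)
    \<Rightarrow> nat \<Rightarrow> real mat" where
  "Bmat k \<theta> r M N \<epsilon> A i = Matrix.mat k k (\<lambda>(a, b). let j = a + 1; l = b + 1 in
     sqrt (\<theta> j * \<theta> l) * (real N * \<epsilon>) * scalar_prod (evec r N j) (evec r N l)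
     + sqrt (\<theta> j * \<theta> l) / ((\<theta> i)\<^sup>2 * (real N * \<epsilon>)) *
       (\<integral>\<omega>. scalar_prod (evec r N j)
              ((centred M N A \<omega> * centred M N A \<omega>) *\<^sub>v evec r N l) \<partial>M))"

end

theory Submission
  imports Defs "HOL-Real_Asymp.Real_Asymp"
begin

text \<open>
  Write \<open>q = N \<epsilon>\<^sub>N\<close>, \<open>P = E A\<close>, so that \<open>P = q \<Sum>\<^sub>l \<theta>\<^sub>l e\<^sub>l e\<^sub>l'\<close>, and let \<open>\<mu>\<close> be the \<open>i\<close>-th eigenvalue of \<open>B\<close>, with
  unit eigenvector \<open>x\<close>. For \<open>w = \<Sum>\<^sub>l x\<^sub>l \<surd>\<theta>\<^sub>l e\<^sub>l\<close> the equation \<open>B x = \<mu> x\<close> says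
  \<open>P w + P (E W\<^sup>2) w / (\<theta>\<^sub>i\<^sup>2 q\<^sup>2) = \<mu> w\<close>. The vector \<open>u = w + W w / \<mu>\<close> is then an approximate eigenvector of
  \<open>A\<close> whose residual \<open>A u - \<mu> u\<close> has bounded second moment, while the gap of \<open>A\<close> around \<open>\<mu>\<close> is of order
  \<open>q\<close>. As the error of a Rayleigh quotient is quadratic in the residual, \<open>\<lambda>\<^sub>i(A) - \<mu>\<close> equals
  \<open>u'(A - \<mu>)u / w'w\<close> up to \<open>O(1/q)\<close> in mean, and the expectation of this quadratic form is \<open>O(1/q)\<close>, because
  its terms linear in \<open>W\<close> are centred and those quadratic in \<open>W\<close> cancel to first order by the choice of
  \<open>B\<close>. All moments of \<open>W\<close>, including a trace of order \<open>log N\<close> that yields the gap outside an event of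
  probability below every power of \<open>N\<close>, come from one estimate for sums over walks.
\<close>

section \<open>Spectral theorem for real symmetric matrices\<close>

text \<open>The correction \<open>W w / \<mu>\<close> decides the accuracy: the residual of
  \<open>w\<close> alone contains \<open>W w\<close>, of squared norm of order \<open>q\<close>, and
  the quadratic error over the gap would be of order 1. With the correction only
  \<open>W^2 w / \<mu>\<close> and finite-rank terms remain, all bounded in mean square.

  Two obstacles shape the estimates. The weight \<open>1 / \<theta>_i^2\<close> in \<open>B\<close>
  is not \<open>q^2 / \<mu>^2\<close>, for which the second-order terms would match; as
  \<open>\<mu> = q \<theta>_i + O(1)\<close>, the mismatch is a factor \<open>O(1/q^2)\<close> on
  \<open>E (w' W^2 w) = O(q)\<close>. Moreover \<open>u'u\<close> is random and correlated with the
  eigenvalue, so it is replaced by \<open>w'w\<close> before expectations are taken, the difference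
  being split by an AM-GM inequality weighted with \<open>q\<close>.

  Off the good event only bounds polynomial in \<open>N\<close> are at hand. A trace of order
  \<open>log N\<close> beats them, but counting its walks costs a factorial, which is paid for by
  powers of \<open>log N\<close> contained in \<open>q\<close>. Since \<open>w\<close> and
  \<open>\<mu>\<close> change with \<open>N\<close>, all constants are kept as explicit terms free
  of \<open>N\<close>.\<close>

lemma real_symmetric_complex_root_real:
  fixes A :: "real mat"
  assumes A: "A \<in> carrier_mat n n" and sym: "transpose_mat A = A"
    and root: "poly (char_poly (map_mat complex_of_real A)) z = 0"
  shows "z \<in> \<real>"
proof -
  let ?C = "map_mat complex_of_real A"
  have C: "?C \<in> carrier_mat n n" using A by auto
  from root have "eigenvalue ?C z" using eigenvalue_root_char_poly[OF C] by simp
  then obtain v where v: "v \<in> carrier_vec n" "v \<noteq> 0\<^sub>v n" "?C *\<^sub>v v = z \<cdot>\<^sub>v v"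
    using C unfolding eigenvalue_def eigenvector_def by auto
  have ev: "(\<Sum>b<n. complex_of_real (A $$ (a,b)) * v $ b) = z * v $ a" if "a < n" for a
  proof -
    have "(?C *\<^sub>v v) $ a = (z \<cdot>\<^sub>v v) $ a" using v(3) by simp
    then show ?thesis using that A v(1) 
      by (simp add: scalar_prod_def atLeast0LessThan)
  qed
  have symA: "A $$ (a,b) = A $$ (b,a)" if "a < n" "b < n" for a b
    using arg_cong[OF sym, of "\<lambda>M. M $$ (b,a)"] A that by auto
  define s where "s = (\<Sum>a<n. cnj (v $ a) * v $ a)"
  have s: "s = complex_of_real (\<Sum>a<n. (cmod (v $ a))\<^sup>2)"
    unfolding s_def of_real_sum
    by (intro sum.cong refl) (simp add: complex_norm_square[symmetric] mult.commute del: of_real_power)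
  have "s \<noteq> 0"
  proof
    assume "s = 0"
    then have "(\<Sum>a<n. (cmod (v $ a))\<^sup>2) = 0" using s by (simp only: of_real_eq_0_iff)
    then have "\<forall>a\<in>{..<n}. (cmod (v $ a))\<^sup>2 = 0" by (subst (asm) sum_nonneg_eq_0_iff) auto
    then have "v = 0\<^sub>v n" using v(1) by (intro eq_vecI) auto
    then show False using v(2) by simp
  qed
  \<comment> \<open>The Hermitian form of the eigenvector: it equals \<open>z * s\<close>, with
    \<open>s\<close> the squared norm, and symmetry makes it its own conjugate.\<close>
  define q where "q = (\<Sum>a<n. \<Sum>b<n. cnj (v $ a) * (complex_of_real (A $$ (a,b)) * v $ b))"
  have q: "q = z * s"
  proof -
    have "q = (\<Sum>a<n. cnj (v $ a) * (z * v $ a))"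
      unfolding q_def by (intro sum.cong refl) (simp add: sum_distrib_left[symmetric] ev)
    then show ?thesis unfolding s_def by (simp add: sum_distrib_left algebra_simps)
  qed
  have "cnj q = (\<Sum>a<n. \<Sum>b<n. v $ a * (complex_of_real (A $$ (a,b)) * cnj (v $ b)))"
    unfolding q_def by (simp add: cnj_sum)
  also have "\<dots> = (\<Sum>b<n. \<Sum>a<n. v $ a * (complex_of_real (A $$ (a,b)) * cnj (v $ b)))"
    by (rule sum.swap)
  also have "\<dots> = q" unfolding q_def
    by (intro sum.cong refl) (simp add: symA mult.commute mult.left_commute)
  finally have "cnj z * cnj s = z * s" using q by simp
  moreover have "cnj s = s" using s by simp
  ultimately have "cnj z = z" using \<open>s \<noteq> 0\<close> by simp
  then show ?thesis by (simp add: Reals_cnj_iff)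
qed

text \<open>Over the complex numbers the polynomial splits, all roots are real, and injectivity of
  the embedding of polynomials brings the factorisation back to the reals.\<close>

lemma real_symmetric_char_poly_splits:
  fixes A :: "real mat"
  assumes A: "A \<in> carrier_mat n n" and sym: "transpose_mat A = A"
  shows "\<exists>es. char_poly A = (\<Prod>e\<leftarrow>es. [:- e, 1:]) \<and> length es = n"
proof -
  interpret h: map_poly_inj_comm_ring_hom complex_of_real ..
  let ?C = "map_mat complex_of_real A"
  have C: "?C \<in> carrier_mat n n" using A by auto
  obtain as where as: "char_poly ?C = (\<Prod>a\<leftarrow>as. [:- a, 1:])" "length as = n"
    using char_poly_factorized[OF C] by blast
  have "a \<in> \<real>" if "a \<in> set as" for a
  proof (rule real_symmetric_complex_root_real[OF A sym])
    show "poly (char_poly ?C) a = 0" unfolding as(1) poly_prod_list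
      using that by (auto simp: prod_list_zero_iff image_iff)
  qed
  then have "map complex_of_real (map Re as) = as"
    by (induct as) (auto simp: complex_is_Real_iff complex_eq_iff)
  then have "map_poly complex_of_real (char_poly A) = (\<Prod>a\<leftarrow>map complex_of_real (map Re as). [:- a, 1:])"
    using as(1) unfolding of_real_hom.char_poly_hom[OF A] by simp
  also have "\<dots> = map_poly complex_of_real (\<Prod>e\<leftarrow>map Re as. [:- e, 1:])"
    by (induct as) (simp_all add: h.hom_mult map_poly_pCons del: mult_pCons_left mult_pCons_right)
  finally have "char_poly A = (\<Prod>e\<leftarrow>map Re as. [:- e, 1:])"
    by (simp add: h.eq_iff)
  then show ?thesis using as(2) by (intro exI[of _ "map Re as"]) auto
qed

text \<open>The reflection that exchanges the first basis vector with \<open>v\<close>. For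
  \<open>u = v - e_0\<close> the norm condition gives \<open>|u|^2 = -2 u_0\<close>, hence
  \<open>c * u 0 = -1\<close>, and the first column \<open>e_0 - c u_0 u\<close> is
  \<open>v\<close>. If \<open>v = e_0\<close> there is nothing to reflect and the identity
  serves.\<close>

lemma householder_exists:
  fixes v :: "nat \<Rightarrow> real"
  assumes "n > 0" and v: "(\<Sum>a<n. (v a)\<^sup>2) = 1"
  shows "\<exists>H\<in>carrier_mat n n. transpose_mat H = H \<and> H * H = 1\<^sub>m n \<and> (\<forall>a<n. H $$ (a,0) = v a)"
proof (cases "\<forall>a<n. v a = (if a = 0 then 1 else 0)")
  case True
  then show ?thesis by (intro bexI[of _ "1\<^sub>m n"]) (auto simp: assms)
next
  case False
  define u where "u a = v a - (if a = 0 then 1 else 0)" for a :: nat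
  define U where "U = (\<Sum>a<n. u a * u a)"
  have "U = (\<Sum>a<n. (v a)\<^sup>2 - (if a = 0 then 2 * v 0 - 1 else 0))"
    unfolding U_def u_def by (intro sum.cong refl) (auto simp: power2_eq_square algebra_simps)
  also have "\<dots> = - 2 * u 0" using \<open>n > 0\<close>
    by (simp add: sum_subtractf v u_def)
  finally have U: "U = - 2 * u 0" .
  have "U \<noteq> 0"
  proof
    assume "U = 0"
    then have "\<forall>a\<in>{..<n}. u a * u a = 0" unfolding U_def by (subst (asm) sum_nonneg_eq_0_iff) auto
    then show False using False by (auto simp: u_def)
  qed
  define c where "c = 2 / U"
  have cU: "c * U = 2" and cu: "c * u 0 = -1" using \<open>U \<noteq> 0\<close> U by (auto simp: c_def)
  define H where "H = mat n n (\<lambda>(a,b). (if a = b then 1 else 0) - c * u a * u b)"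
  have H: "H \<in> carrier_mat n n" by (simp add: H_def)
  have "H * H = 1\<^sub>m n"
  proof (rule eq_matI)
    fix a b assume "a < dim_row (1\<^sub>m n)" "b < dim_col (1\<^sub>m n)"
    then have ab: "a < n" "b < n" by auto
    have "(H * H) $$ (a,b) = (\<Sum>l<n. ((if a = l then 1 else 0) - c * u a * u l) * ((if l = b then 1 else 0) - c * u l * u b))"
      using ab by (simp add: H_def scalar_prod_def atLeast0LessThan)
    also have "\<dots> = (\<Sum>l<n. (if l = a then (if a = b then 1 else 0) - c * u a * u b else 0)
         - (if l = b then c * u a * u b else 0) + c * u a * u b * c * (u l * u l))"
      by (intro sum.cong refl) (auto simp: algebra_simps)
    also have "\<dots> = (if a = b then 1 else 0) - 2 * (c * u a * u b) + c * u a * u b * (c * U)"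
      using ab by (simp add: sum.distrib sum_subtractf sum_distrib_left[symmetric] U_def)
    also have "\<dots> = (if a = b then 1 else 0)" by (simp add: cU)
    finally show "(H * H) $$ (a,b) = 1\<^sub>m n $$ (a,b)" using ab by simp
  qed (auto simp: H_def)
  moreover have "transpose_mat H = H" by (rule eq_matI) (auto simp: H_def)
  moreover have "H $$ (a,0) = v a" if "a < n" for a
  proof -
    have "c * u a * u 0 = - u a" using cu by (metis mult.assoc mult.commute mult_minus1)
    then show ?thesis using that \<open>n > 0\<close> by (auto simp: H_def u_def)
  qed
  ultimately show ?thesis using H by blast
qed

text \<open>Deflation: a reflection \<open>H\<close> whose first column is a unit eigenvector for
  \<open>e\<close> makes the first column of \<open>H A H\<close> equal to \<open>e\<close> times a
  basis vector, symmetry clears the first row as well, and the remaining block has the remaining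
  roots. The order of \<open>es\<close> is kept on the diagonal.\<close>

lemma symmetric_orthogonal_diagonalization:
  fixes A :: "real mat"
  assumes "A \<in> carrier_mat n n" "transpose_mat A = A" "char_poly A = (\<Prod>e\<leftarrow>es. [:- e, 1:])"
    and "length es = n"
  shows "\<exists>Q\<in>carrier_mat n n. transpose_mat Q * Q = 1\<^sub>m n
     \<and> A * Q = Q * mat n n (\<lambda>(i,j). if i = j then es ! i else 0)"
  using assms
proof (induct es arbitrary: n A)
  case Nil
  then show ?case by (intro bexI[of _ "1\<^sub>m 0"]) auto
next
  case (Cons e es n A)
  define m where "m = length es"
  have n: "n = Suc m" using Cons by (simp add: m_def)
  note A = Cons(2)
  have "poly (char_poly A) e = 0" using Cons(4) by simp
  then obtain x where x: "x \<in> carrier_vec n" "x \<noteq> 0\<^sub>v n" "A *\<^sub>v x = e \<cdot>\<^sub>v x"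
    using A eigenvalue_root_char_poly[OF A] unfolding eigenvalue_def eigenvector_def by auto
  define X where "X = (\<Sum>a<n. (x $ a)\<^sup>2)"
  have "X > 0"
  proof -
    obtain a where "a < n" "x $ a \<noteq> 0" using x(1,2) by (metis carrier_vecD eq_vecI index_zero_vec)
    then show ?thesis unfolding X_def by (intro sum_pos2[of _ a]) auto
  qed
  define v where "v a = x $ a / sqrt X" for a
  have "(\<Sum>a<n. (v a)\<^sup>2) = 1"
    using \<open>X > 0\<close> by (simp add: v_def power_divide sum_divide_distrib[symmetric] X_def[symmetric])
  then obtain H where H: "H \<in> carrier_mat n n" "transpose_mat H = H" "H * H = 1\<^sub>m n" "\<And>a. a < n \<Longrightarrow> H $$ (a,0) = v a"
    using householder_exists[of n v] n by auto
  define B where "B = H * A * H"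
  have B: "B \<in> carrier_mat n n" using A H by (auto simp: B_def)
  have HB: "H * B = A * H"
  proof -
    have "H * B = (H * H) * (A * H)" unfolding B_def using A H(1) by (simp add: assoc_mult_mat[of _ n n _ n _ n])
    then show ?thesis using H A by simp
  qed
  have Bsym: "transpose_mat B = B"
    unfolding B_def using A H Cons(3) by (simp add: transpose_mult[of _ n n _ n] assoc_mult_mat[of _ n n _ n _ n])
  have colAH: "(A * H) $$ (a,0) = e * v a" if "a < n" for a
  proof -
    have "(A *\<^sub>v x) $ a = e * x $ a" using x(1,3) that by auto
    then have "(\<Sum>b<n. A $$ (a,b) * x $ b) = e * x $ a"
      using A x(1) that by (simp add: scalar_prod_def atLeast0LessThan)
    then have "(\<Sum>b<n. A $$ (a,b) * v b) = e * v a"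
      by (simp add: v_def sum_divide_distrib[symmetric])
    then show ?thesis using A H that n by (simp add: scalar_prod_def atLeast0LessThan)
  qed
  have B0: "B $$ (a,0) = (if a = 0 then e else 0)" if "a < n" for a
  proof -
    have "B = H * (A * H)" unfolding B_def using A H(1) by (simp add: assoc_mult_mat[of _ n n _ n _ n])
    then have "B $$ (a,0) = (\<Sum>b<n. H $$ (a,b) * (A * H) $$ (b,0))"
      using A H(1) that n by (simp add: scalar_prod_def atLeast0LessThan)
    also have "\<dots> = e * (\<Sum>b<n. H $$ (a,b) * H $$ (b,0))"
      by (simp add: colAH H(4) sum_distrib_left mult_ac cong: sum.cong_simp)
    also have "(\<Sum>b<n. H $$ (a,b) * H $$ (b,0)) = (H * H) $$ (a,0)"
      using H(1) that n by (simp add: scalar_prod_def atLeast0LessThan)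
    finally show ?thesis using H(3) that n by simp
  qed
  have B0': "B $$ (0,a) = (if a = 0 then e else 0)" if "a < n" for a
    using arg_cong[OF Bsym, of "\<lambda>M. M $$ (0,a)"] B B0[OF that] that n by auto
  define A3 where "A3 = mat m m (\<lambda>(i,j). B $$ (Suc i, Suc j))"
  have A3: "A3 \<in> carrier_mat m m" by (simp add: A3_def)
  let ?E = "mat 1 1 (\<lambda>_. e)"
  have Bblock: "B = four_block_mat ?E (0\<^sub>m 1 m) (0\<^sub>m m 1) A3"
    by (rule eq_matI) (use B n in \<open>auto simp: A3_def B0 B0'\<close>)
  have A3sym: "transpose_mat A3 = A3"
    by (rule eq_matI) (use Bsym B n in \<open>auto simp: A3_def dest!: arg_cong[of _ _ "\<lambda>M. M $$ (_, _)"]\<close>,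
       metis B Bsym Suc_less_eq carrier_matD index_transpose_mat(1))
  have "similar_mat A B"
  proof (rule similar_matI)
    show "A = H * B * H" using HB A H by (simp add: assoc_mult_mat[of _ n n _ n _ n])
  qed (use A B H in auto)
  then have "char_poly A = char_poly B" by (rule char_poly_similar)
  also have "\<dots> = char_poly ?E * char_poly A3"
    unfolding Bblock by (rule char_poly_four_block_zeros_col) (auto simp: A3)
  also have "char_poly ?E = [:- e, 1:]"
    by (simp add: char_poly_def char_poly_matrix_def det_single)
  finally have "[:- e, 1:] * char_poly A3 = [:- e, 1:] * (\<Prod>e\<leftarrow>es. [:- e, 1:])"
    unfolding Cons(4) by (simp only: list.map prod_list.Cons)
  then have "char_poly A3 = (\<Prod>e\<leftarrow>es. [:- e, 1:])"
    by (subst (asm) mult_left_cancel) auto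
  from Cons(1)[OF A3 A3sym this] obtain Q3 where Q3: "Q3 \<in> carrier_mat m m" "transpose_mat Q3 * Q3 = 1\<^sub>m m"
     "A3 * Q3 = Q3 * mat m m (\<lambda>(i,j). if i = j then es ! i else 0)" by (auto simp: m_def)
  let ?D3 = "mat m m (\<lambda>(i,j). if i = j then es ! i else 0)"
  let ?D = "mat n n (\<lambda>(i,j). if i = j then (e # es) ! i else 0)"
  have Dblock: "?D = four_block_mat ?E (0\<^sub>m 1 m) (0\<^sub>m m 1) ?D3"
    by (rule eq_matI) (auto simp: n nth_Cons')
  define F where "F = four_block_mat (1\<^sub>m 1) (0\<^sub>m 1 m) (0\<^sub>m m 1) Q3"
  have F: "F \<in> carrier_mat n n" using Q3 n by (auto simp: F_def)
  have FF: "transpose_mat F * F = 1\<^sub>m n"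
  proof -
    have "transpose_mat F = four_block_mat (1\<^sub>m 1) (0\<^sub>m 1 m) (0\<^sub>m m 1) (transpose_mat Q3)"
      unfolding F_def using Q3(1) by (subst transpose_four_block_mat) auto
    then show ?thesis unfolding F_def using Q3(1,2)
      by (simp add: mult_four_block_mat[of _ 1 1 _ m _ m _ _ 1 _ m] n)
  qed
  have BF: "B * F = F * ?D"
    unfolding Bblock Dblock F_def using Q3(1,3) A3
    by (simp add: mult_four_block_mat[of _ 1 1 _ m _ m _ _ 1 _ m])
  have "transpose_mat (H * F) * (H * F) = transpose_mat F * ((H * H) * F)"
    using H(1,2) F by (simp add: transpose_mult[of _ n n _ n] assoc_mult_mat[of _ n n _ n _ n])
  then have 1: "transpose_mat (H * F) * (H * F) = 1\<^sub>m n" using H(3) F FF by simp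
  have "A * (H * F) = (A * H) * F" using A H(1) F by (simp add: assoc_mult_mat[of _ n n _ n _ n])
  also have "\<dots> = H * (B * F)" unfolding HB[symmetric] using B H(1) F by (simp add: assoc_mult_mat[of _ n n _ n _ n])
  also have "\<dots> = (H * F) * ?D" unfolding BF using H(1) F by (simp add: assoc_mult_mat[of _ n n _ n _ n])
  finally show ?case using 1 H(1) F by (intro bexI[of _ "H * F"]) auto
qed

section \<open>Variational characterisation of eigenvalues\<close>

text \<open>Vectors and matrices are plain functions of which only the values below \<open>n\<close>
  count. This removes carrier conditions; \<open>ip_cong\<close> and \<open>mv_cong\<close> take
  their place.\<close>

definition ip :: "nat \<Rightarrow> (nat \<Rightarrow> real) \<Rightarrow> (nat \<Rightarrow> real) \<Rightarrow> real" where
  "ip n u v = (\<Sum>a<n. u a * v a)"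

definition mv :: "nat \<Rightarrow> (nat \<Rightarrow> nat \<Rightarrow> real) \<Rightarrow> (nat \<Rightarrow> real) \<Rightarrow> nat \<Rightarrow> real" where
  "mv n S u a = (\<Sum>b<n. S a b * u b)"

text \<open>Orthonormality and completeness are both recorded, so that expansions need no dimension
  argument. Indices start at 0: \<open>l m\<close> is the eigenvalue of rank \<open>m + 1\<close> in
  decreasing order.\<close>

definition spectral ::
  "nat \<Rightarrow> (nat \<Rightarrow> nat \<Rightarrow> real) \<Rightarrow> (nat \<Rightarrow> real) \<Rightarrow> (nat \<Rightarrow> nat \<Rightarrow> real) \<Rightarrow> bool" where
  "spectral n S l v \<longleftrightarrow>
     (\<forall>i<n. \<forall>j<n. ip n (v i) (v j) = (if i = j then 1 else 0)) \<and>
     (\<forall>a<n. \<forall>b<n. (\<Sum>j<n. v j a * v j b) = (if a = b then 1 else 0)) \<and>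
     (\<forall>j<n. \<forall>a<n. mv n S (v j) a = l j * v j a) \<and>
     (\<forall>i j. i \<le> j \<longrightarrow> j < n \<longrightarrow> l j \<le> l i)"

lemma ip_commute: "ip n u v = ip n v u"
  by (simp add: ip_def mult.commute)

lemma ip_add_left: "ip n (\<lambda>a. u a + u' a) v = ip n u v + ip n u' v"
  by (simp add: ip_def sum.distrib algebra_simps)

lemma ip_add_right: "ip n u (\<lambda>a. v a + v' a) = ip n u v + ip n u v'"
  by (simp add: ip_def sum.distrib algebra_simps)

lemma ip_diff_right: "ip n u (\<lambda>a. v a - v' a) = ip n u v - ip n u v'"
  by (simp add: ip_def sum_subtractf algebra_simps)

lemma ip_scale_left: "ip n (\<lambda>a. c * u a) v = c * ip n u v"
  by (simp add: ip_def sum_distrib_left algebra_simps)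

lemma ip_scale_right: "ip n u (\<lambda>a. c * v a) = c * ip n u v"
  by (simp add: ip_def sum_distrib_left algebra_simps)

lemma ip_sum_left: "ip n (\<lambda>a. \<Sum>s\<in>T. c s * y s a) v = (\<Sum>s\<in>T. c s * ip n (y s) v)"
  unfolding ip_def sum_distrib_left sum_distrib_right by (subst sum.swap) (simp add: mult_ac)

lemma ip_sum_right: "ip n v (\<lambda>a. \<Sum>s\<in>T. c s * y s a) = (\<Sum>s\<in>T. c s * ip n v (y s))"
  by (subst (1 2) ip_commute) (rule ip_sum_left)

lemma ip_self_nonneg: "ip n u u \<ge> 0"
  by (simp add: ip_def sum_nonneg)

lemma ip_cong: "(\<And>a. a < n \<Longrightarrow> u a = u' a) \<Longrightarrow> (\<And>a. a < n \<Longrightarrow> v a = v' a) \<Longrightarrow> ip n u v = ip n u' v'"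
  by (simp add: ip_def)

lemma ip_Cauchy_Schwarz: "(ip n u v)\<^sup>2 \<le> ip n u u * ip n v v"
  using Cauchy_Schwarz_ineq_sum[of u v "{..<n}"] by (simp add: ip_def power2_eq_square)

lemma ip_mv_symmetric:
  assumes "\<And>a b. a < n \<Longrightarrow> b < n \<Longrightarrow> S a b = S b a"
  shows "ip n u (mv n S v) = ip n (mv n S u) v"
proof -
  have "ip n u (mv n S v) = (\<Sum>a<n. \<Sum>b<n. u a * S a b * v b)"
    by (simp add: ip_def mv_def sum_distrib_left mult_ac)
  also have "\<dots> = (\<Sum>b<n. \<Sum>a<n. u a * S a b * v b)" by (rule sum.swap)
  also have "\<dots> = ip n (mv n S u) v"
    unfolding ip_def mv_def sum_distrib_right by (intro sum.cong refl) (simp add: assms)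
  finally show ?thesis .
qed

lemma ip_mv_abs_le:
  assumes S: "\<And>a b. a < n \<Longrightarrow> b < n \<Longrightarrow> \<bar>S a b\<bar> \<le> C"
  shows "\<bar>ip n z (mv n S z)\<bar> \<le> C * real n * ip n z z"
proof (cases "n = 0")
  case False
  then have C: "C \<ge> 0" using S[of 0 0] by auto
  have "\<bar>ip n z (mv n S z)\<bar> = \<bar>\<Sum>a<n. \<Sum>b<n. z a * (S a b * z b)\<bar>"
    by (simp add: ip_def mv_def sum_distrib_left)
  also have "\<dots> \<le> (\<Sum>a<n. \<Sum>b<n. \<bar>z a * (S a b * z b)\<bar>)"
    by (intro order_trans[OF sum_abs] sum_mono sum_abs)
  also have "\<dots> \<le> (\<Sum>a<n. \<Sum>b<n. \<bar>z a\<bar> * (C * \<bar>z b\<bar>))"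
    unfolding abs_mult by (intro sum_mono mult_left_mono mult_right_mono S) auto
  also have "\<dots> = C * (\<Sum>a<n. \<bar>z a\<bar>)\<^sup>2"
    by (simp add: power2_eq_square sum_distrib_left sum_distrib_right mult_ac)
  also have "\<dots> \<le> C * (real n * ip n z z)"
    using Cauchy_Schwarz_ineq_sum[of "\<lambda>_. 1" "\<lambda>a. \<bar>z a\<bar>" "{..<n}"] C
    by (intro mult_left_mono) (auto simp: ip_def power2_eq_square)
  finally show ?thesis by (simp add: mult.assoc)
qed (simp add: ip_def)

lemma ip_mv_diff: "ip n z (mv n S z) - ip n z (mv n T z) = ip n z (mv n (\<lambda>a b. S a b - T a b) z)"
  by (simp add: ip_def mv_def left_diff_distrib right_diff_distrib sum_subtractf)

lemma mv_add: "mv n S (\<lambda>a. u a + u' a) b = mv n S u b + mv n S u' b"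
  by (simp add: mv_def sum.distrib algebra_simps)

lemma mv_scale: "mv n S (\<lambda>a. c * u a) b = c * mv n S u b"
  by (simp add: mv_def sum_distrib_left algebra_simps)

lemma mv_sum: "mv n S (\<lambda>a. \<Sum>s\<in>T. c s * y s a) b = (\<Sum>s\<in>T. c s * mv n S (y s) b)"
  unfolding mv_def sum_distrib_left by (subst sum.swap) (simp add: mult_ac)

lemma mv_cong: "(\<And>a. a < n \<Longrightarrow> u a = u' a) \<Longrightarrow> mv n S u b = mv n S u' b"
  by (simp add: mv_def)

lemma real_symmetric_spectral:
  assumes A: "A \<in> carrier_mat n n" and sym: "transpose_mat A = A"
  shows "\<exists>v. spectral n (\<lambda>a b. A $$ (a,b)) (\<lambda>j. eigval_desc (Suc j) A) v"
proof -
  obtain es0 where es0: "char_poly A = (\<Prod>e\<leftarrow>es0. [:- e, 1:])" "length es0 = n"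
    using real_symmetric_char_poly_splits[OF A sym] by blast
  \<comment> \<open>Diagonalisation accepts the roots in any order, so they are put into the order
    of \<open>eigval_desc\<close> beforehand.\<close>
  define es where "es = rev (sort es0)"
  have mset: "mset es = mset es0" by (simp add: es_def)
  have len: "length es = n" using mset_eq_length[OF mset] es0(2) by simp
  have "(\<Prod>e\<leftarrow>es. [:- e, 1:]) = (\<Prod>e\<leftarrow>es0. [:- e, 1:])"
    using arg_cong[OF mset, of "\<lambda>m. prod_mset (image_mset (\<lambda>e. [:- e, 1::real:]) m)"]
    by (simp add: prod_mset_prod_list[symmetric])
  with es0 have es: "char_poly A = (\<Prod>e\<leftarrow>es. [:- e, 1:])" by simp
  have "proots (\<Prod>e\<leftarrow>es. [:- e, 1:]) = mset es"
    by (induct es) (simp_all add: proots_mult prod_list_zero_iff image_iff del: mult_pCons_left mult_pCons_right)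
  then have "rev (sorted_list_of_multiset (proots (char_poly A))) = es"
    unfolding es by (simp add: es_def)
  then have ev: "eigval_desc (Suc j) A = es ! j" for j
    by (simp add: eigval_desc_def)
  obtain Q where Q: "Q \<in> carrier_mat n n" "transpose_mat Q * Q = 1\<^sub>m n"
     "A * Q = Q * mat n n (\<lambda>(i,j). if i = j then es ! i else 0)"
    using symmetric_orthogonal_diagonalization[OF A sym es len] by auto
  \<comment> \<open>For square matrices a left inverse is a right inverse: orthonormal columns are
    complete.\<close>
  have Q2: "Q * transpose_mat Q = 1\<^sub>m n"
    using mat_mult_left_right_inverse[OF _ Q(1) Q(2)] Q(1) by simp
  have 1: "(\<Sum>a<n. Q $$ (a,i) * Q $$ (a,j)) = (if i = j then 1 else 0)" if "i < n" "j < n" for i j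
    using arg_cong[OF Q(2), of "\<lambda>M. M $$ (i,j)"] that Q(1)
    by (simp add: scalar_prod_def atLeast0LessThan)
  have 2: "(\<Sum>j<n. Q $$ (a,j) * Q $$ (b,j)) = (if a = b then 1 else 0)" if "a < n" "b < n" for a b
    using arg_cong[OF Q2, of "\<lambda>M. M $$ (a,b)"] that Q(1)
    by (simp add: scalar_prod_def atLeast0LessThan)
  have 3: "(\<Sum>b<n. A $$ (a,b) * Q $$ (b,j)) = es ! j * Q $$ (a,j)" if "a < n" "j < n" for a j
  proof -
    have "(\<Sum>b<n. A $$ (a,b) * Q $$ (b,j)) = (\<Sum>i<n. Q $$ (a,i) * (if i = j then es ! i else 0))"
      using arg_cong[OF Q(3), of "\<lambda>M. M $$ (a,j)"] that Q(1) A
      by (simp add: scalar_prod_def atLeast0LessThan)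
    also have "\<dots> = (\<Sum>i<n. if i = j then es ! j * Q $$ (a,j) else 0)"
      by (intro sum.cong) auto
    finally show ?thesis using that by simp
  qed
  have "sorted (rev es)" by (simp add: es_def)
  then have 4: "es ! j \<le> es ! i" if "i \<le> j" "j < n" for i j
    using that len by (intro sorted_rev_nth_mono) auto
  show ?thesis
    by (intro exI[of _ "\<lambda>j a. Q $$ (a,j)"])
       (auto simp: spectral_def ip_def mv_def ev 1 2 3 4)
qed

lemma spectral_mono: "spectral n S l v \<Longrightarrow> i \<le> j \<Longrightarrow> j < n \<Longrightarrow> l j \<le> l i"
  by (simp add: spectral_def)

lemma spectral_expand:
  assumes "spectral n S l v" "a < n"
  shows "u a = (\<Sum>j<n. ip n (v j) u * v j a)"
proof -
  have "(\<Sum>j<n. ip n (v j) u * v j a) = (\<Sum>j<n. \<Sum>b<n. u b * (v j a * v j b))"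
    by (simp add: ip_def sum_distrib_right sum_distrib_left mult_ac)
  also have "\<dots> = (\<Sum>b<n. \<Sum>j<n. u b * (v j a * v j b))" by (rule sum.swap)
  also have "\<dots> = (\<Sum>b<n. u b * (if a = b then 1 else 0))"
    using assms by (simp add: sum_distrib_left[symmetric] spectral_def)
  also have "\<dots> = (\<Sum>b<n. if b = a then u a else 0)" by (intro sum.cong) auto
  finally show ?thesis using assms by simp
qed

lemma spectral_ip:
  assumes "spectral n S l v"
  shows "ip n u w = (\<Sum>j<n. ip n (v j) u * ip n (v j) w)"
proof -
  have "ip n u w = ip n (\<lambda>a. \<Sum>j<n. ip n (v j) u * v j a) w"
    by (rule ip_cong) (auto intro: spectral_expand[OF assms])
  then show ?thesis by (simp add: ip_sum_left)
qed

lemma spectral_coeff_mv: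
  assumes "spectral n S l v" "i < n"
  shows "ip n (v i) (mv n S u) = l i * ip n (v i) u"
proof -
  have "mv n S u a = (\<Sum>j<n. (ip n (v j) u * l j) * v j a)" if "a < n" for a
  proof -
    have "mv n S u a = mv n S (\<lambda>a. \<Sum>j<n. ip n (v j) u * v j a) a"
      by (rule mv_cong) (auto intro: spectral_expand[OF assms(1)])
    also have "\<dots> = (\<Sum>j<n. ip n (v j) u * mv n S (v j) a)" by (rule mv_sum)
    finally show ?thesis using assms(1) that by (simp add: spectral_def mult_ac)
  qed
  then have "ip n (v i) (mv n S u) = ip n (v i) (\<lambda>a. \<Sum>j<n. (ip n (v j) u * l j) * v j a)"
    by (intro ip_cong) auto
  also have "\<dots> = (\<Sum>j<n. (ip n (v j) u * l j) * ip n (v i) (v j))" by (rule ip_sum_right)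
  also have "\<dots> = (\<Sum>j<n. if j = i then l i * ip n (v i) u else 0)"
    using assms by (intro sum.cong) (auto simp: spectral_def)
  finally show ?thesis using assms(2) by simp
qed

lemma spectral_quadratic:
  assumes "spectral n S l v"
  shows "ip n u (mv n S u) = (\<Sum>j<n. l j * (ip n (v j) u)\<^sup>2)"
    and "ip n u u = (\<Sum>j<n. (ip n (v j) u)\<^sup>2)"
  using spectral_ip[OF assms, of u "mv n S u"] spectral_ip[OF assms, of u u]
  by (simp_all add: spectral_coeff_mv[OF assms] power2_eq_square mult_ac)

section \<open>Min-max bounds, Weyl's inequality and Rayleigh quotients\<close>

text \<open>Gaussian elimination by induction on the equations: an unknown \<open>s0\<close> with
  nonzero coefficient in equation \<open>t\<close> is eliminated from the others and recovered by
  back-substitution. This is the dimension count behind both min-max bounds.\<close>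

lemma homogeneous_system_nontrivial:
  fixes f :: "'t \<Rightarrow> 's \<Rightarrow> real"
  assumes "finite T" "finite S" "card T < card S"
  shows "\<exists>c. (\<exists>s\<in>S. c s \<noteq> 0) \<and> (\<forall>t\<in>T. (\<Sum>s\<in>S. f t s * c s) = 0)"
  using assms
proof (induct T arbitrary: S f rule: finite_induct)
  case empty
  then show ?case by (intro exI[of _ "\<lambda>_. 1"]) (auto simp: card_gt_0_iff)
next
  case (insert t T S f)
  show ?case
  proof (cases "\<forall>s\<in>S. f t s = 0")
    case True
    have "card T < card S" using insert by simp
    then obtain c where "\<exists>s\<in>S. c s \<noteq> 0" "\<forall>t\<in>T. (\<Sum>s\<in>S. f t s * c s) = 0"
      using insert(3)[of S f] insert(4) by blast
    then show ?thesis using True by (intro exI[of _ c]) auto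
  next
    case False
    then obtain s0 where s0: "s0 \<in> S" "f t s0 \<noteq> 0" by auto
    define S' where "S' = S - {s0}"
    have "card T < card S'" using insert s0 by (simp add: S'_def)
    then obtain c where c: "\<exists>s\<in>S'. c s \<noteq> 0"
      "\<forall>t'\<in>T. (\<Sum>s\<in>S'. (f t' s - f t' s0 * f t s / f t s0) * c s) = 0"
      using insert(3)[of S' "\<lambda>t' s. f t' s - f t' s0 * f t s / f t s0"] insert(4)
      by (auto simp: S'_def)
    define d where "d s = (if s = s0 then - (\<Sum>s\<in>S'. f t s * c s) / f t s0 else c s)" for s
    have split: "(\<Sum>s\<in>S. g s * d s) = - g s0 * (\<Sum>s\<in>S'. f t s * c s) / f t s0 + (\<Sum>s\<in>S'. g s * c s)" for g
    proof -
      have "(\<Sum>s\<in>S. g s * d s) = g s0 * d s0 + (\<Sum>s\<in>S'. g s * d s)"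
        unfolding S'_def using insert(4) s0(1) by (rule sum.remove)
      also have "(\<Sum>s\<in>S'. g s * d s) = (\<Sum>s\<in>S'. g s * c s)"
        by (intro sum.cong) (auto simp: d_def S'_def)
      finally show ?thesis by (simp add: d_def)
    qed
    have "\<exists>s\<in>S. d s \<noteq> 0" using c(1) by (auto simp: d_def S'_def)
    moreover have "(\<Sum>s\<in>S. f t s * d s) = 0" using s0 by (simp add: split)
    moreover have "(\<Sum>s\<in>S. f t' s * d s) = 0" if "t' \<in> T" for t'
    proof -
      have "(\<Sum>s\<in>S. f t' s * d s) = (\<Sum>s\<in>S'. (f t' s - f t' s0 * f t s / f t s0) * c s)"
        unfolding split
        by (simp add: divide_inverse sum_distrib_left sum_negf[symmetric] sum.distrib[symmetric] algebra_simps
              del: sum_negf)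
      then show ?thesis using c(2) that by simp
    qed
    ultimately show ?thesis by (intro exI[of _ d]) auto
  qed
qed

text \<open>Lower half of the min-max principle. Some nonzero combination of the
  \<open>m + 1\<close> trial vectors is orthogonal to the \<open>m\<close> leading eigenvectors,
  where the quadratic form is at most \<open>l m\<close>. Independence of the trial vectors is
  contained in the demand \<open>ip n z z > 0\<close>.\<close>

lemma spectral_ge:
  assumes sp: "spectral n S l v" and "m < n"
    and y: "\<And>c z. (\<exists>s\<le>m. c s \<noteq> 0) \<Longrightarrow> z = (\<lambda>a. \<Sum>s\<le>m. c s * y s a) \<Longrightarrow>
        ip n z z > 0 \<and> ip n z (mv n S z) \<ge> t * ip n z z"
  shows "t \<le> l m"
proof -
  obtain c where c: "\<exists>s\<in>{..m}. c s \<noteq> 0" "\<forall>j\<in>{..<m}. (\<Sum>s\<in>{..m}. ip n (v j) (y s) * c s) = 0"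
    using homogeneous_system_nontrivial[of "{..<m}" "{..m}" "\<lambda>j s. ip n (v j) (y s)"] by auto
  define z where "z = (\<lambda>a. \<Sum>s\<le>m. c s * y s a)"
  have z0: "ip n (v j) z = 0" if "j < m" for j
    using c(2) that by (simp add: z_def ip_sum_right mult.commute)
  have pos: "ip n z z > 0" and ge: "ip n z (mv n S z) \<ge> t * ip n z z"
    using y[of c z] c(1) z_def by auto
  have "ip n z (mv n S z) \<le> (\<Sum>j<n. l m * (ip n (v j) z)\<^sup>2)"
    unfolding spectral_quadratic(1)[OF sp]
  proof (intro sum_mono)
    fix j assume "j \<in> {..<n}"
    then show "l j * (ip n (v j) z)\<^sup>2 \<le> l m * (ip n (v j) z)\<^sup>2"
      using z0[of j] spectral_mono[OF sp, of m j] by (cases "j < m") (auto intro: mult_right_mono)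
  qed
  also have "\<dots> = l m * ip n z z"
    by (simp add: spectral_quadratic(2)[OF sp] sum_distrib_left)
  finally have "t * ip n z z \<le> l m * ip n z z" using ge by simp
  then show ?thesis using pos by simp
qed

lemma spectral_span:
  assumes sp: "spectral n S l v" and "m < n" and c: "\<exists>s\<le>m. c s \<noteq> 0" and z: "z = (\<lambda>a. \<Sum>s\<le>m. c s * v s a)"
  shows "0 < ip n z z" and "l m * ip n z z \<le> ip n z (mv n S z)"
proof -
  have zc: "ip n (v j) z = (if j \<le> m then c j else 0)" if "j < n" for j
  proof -
    have "ip n (v j) z = (\<Sum>s\<le>m. c s * ip n (v j) (v s))" by (simp add: z ip_sum_right)
    also have "\<dots> = (\<Sum>s\<le>m. if s = j then c j else 0)"
      using sp that \<open>m < n\<close> by (intro sum.cong) (auto simp: spectral_def)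
    finally show ?thesis by simp
  qed
  obtain s where s: "s \<le> m" "c s \<noteq> 0" using c by auto
  show "0 < ip n z z"
    unfolding spectral_quadratic(2)[OF sp]
    using s \<open>m < n\<close> zc[of s] by (intro sum_pos2[of _ s]) auto
  have "l m * ip n z z = (\<Sum>j<n. l m * (ip n (v j) z)\<^sup>2)"
    by (simp add: spectral_quadratic(2)[OF sp] sum_distrib_left)
  also have "\<dots> \<le> ip n z (mv n S z)"
    unfolding spectral_quadratic(1)[OF sp]
  proof (intro sum_mono)
    fix j assume "j \<in> {..<n}"
    then show "l m * (ip n (v j) z)\<^sup>2 \<le> l j * (ip n (v j) z)\<^sup>2"
      using zc[of j] spectral_mono[OF sp, of j m] \<open>m < n\<close> by (cases "j \<le> m") (auto intro: mult_right_mono)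
  qed
  finally show "l m * ip n z z \<le> ip n z (mv n S z)" .
qed

text \<open>The dual half: some combination of the \<open>m + 1\<close> leading eigenvectors
  satisfies the \<open>m\<close> constraints \<open>g\<close>, and on their span the form is at
  least \<open>l m\<close>.\<close>

lemma spectral_le:
  assumes sp: "spectral n S l v" and "m < n"
    and g: "\<And>z. (\<And>s. s < m \<Longrightarrow> ip n (g s) z = 0) \<Longrightarrow> ip n z (mv n S z) \<le> t * ip n z z"
  shows "l m \<le> t"
proof -
  obtain c where c: "\<exists>s\<in>{..m}. c s \<noteq> 0" "\<forall>j\<in>{..<m}. (\<Sum>s\<in>{..m}. ip n (g j) (v s) * c s) = 0"
    using homogeneous_system_nontrivial[of "{..<m}" "{..m}" "\<lambda>j s. ip n (g j) (v s)"] by auto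
  have ex: "\<exists>s\<le>m. c s \<noteq> 0" using c(1) by auto
  define z where "z = (\<lambda>a. \<Sum>s\<le>m. c s * v s a)"
  have g0: "ip n (g j) z = 0" if "j < m" for j
    using c(2) that by (simp add: z_def ip_sum_right mult.commute)
  have "l m * ip n z z \<le> t * ip n z z"
    using spectral_span(2)[OF sp \<open>m < n\<close> ex z_def] g[OF g0] by linarith
  then show ?thesis using spectral_span(1)[OF sp \<open>m < n\<close> ex z_def] by simp
qed

text \<open>Weyl's inequality, with the eigenvectors of \<open>S\<close> as trial vectors for
  \<open>T\<close>.\<close>

lemma spectral_perturb:
  assumes S: "spectral n S l v" and T: "spectral n T l' v'" and "m < n"
    and close: "\<And>z. \<bar>ip n z (mv n S z) - ip n z (mv n T z)\<bar> \<le> \<delta> * ip n z z"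
  shows "l m \<le> l' m + \<delta>"
proof -
  have "l m - \<delta> \<le> l' m"
  proof (rule spectral_ge[OF T \<open>m < n\<close>, where y = v])
    fix c :: "nat \<Rightarrow> real" and z
    assume c: "\<exists>s\<le>m. c s \<noteq> 0" and z: "z = (\<lambda>a. \<Sum>s\<le>m. c s * v s a)"
    show "0 < ip n z z \<and> (l m - \<delta>) * ip n z z \<le> ip n z (mv n T z)"
      using spectral_span[OF S \<open>m < n\<close> c z] close[of z] by (simp add: algebra_simps)
  qed
  then show ?thesis by simp
qed

text \<open>In the eigenbasis the term \<open>j = i\<close> of the difference vanishes, and for
  every other \<open>j\<close> the distance \<open>|l j - \<mu>| \<ge> h\<close> allows a linear
  factor to be traded for a squared one:
  \<open>2 |l j - \<mu>| \<le> (2 / h) (l j - \<mu>)^2\<close>. This is the quadratic error of a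
  Rayleigh quotient. The second claim holds because \<open>l i\<close> is the eigenvalue nearest to
  \<open>\<mu>\<close>.\<close>

lemma spectral_residual:
  assumes sp: "spectral n S l v" and "i < n" and "h > 0"
    and i: "\<bar>l i - \<mu>\<bar> \<le> h" and far: "\<And>j. j < n \<Longrightarrow> j \<noteq> i \<Longrightarrow> h \<le> \<bar>l j - \<mu>\<bar>"
    and \<zeta>: "\<And>a. a < n \<Longrightarrow> \<zeta> a = mv n S u a - \<mu> * u a"
  shows "\<bar>(l i - \<mu>) * ip n u u - ip n u \<zeta>\<bar> \<le> 2 * ip n \<zeta> \<zeta> / h"
    and "(l i - \<mu>)\<^sup>2 * ip n u u \<le> ip n \<zeta> \<zeta>"
proof -
  define c where "c j = ip n (v j) u" for j
  have z: "ip n (v j) \<zeta> = (l j - \<mu>) * c j" if "j < n" for j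
  proof -
    have "ip n (v j) \<zeta> = ip n (v j) (\<lambda>a. mv n S u a - \<mu> * u a)" by (rule ip_cong) (auto simp: \<zeta>)
    then show ?thesis by (simp add: ip_diff_right ip_scale_right spectral_coeff_mv[OF sp that] c_def algebra_simps)
  qed
  have uu: "ip n u u = (\<Sum>j<n. (c j)\<^sup>2)"
    using spectral_ip[OF sp, of u u] by (simp add: c_def power2_eq_square)
  have uz: "ip n u \<zeta> = (\<Sum>j<n. (l j - \<mu>) * (c j)\<^sup>2)"
    using spectral_ip[OF sp, of u \<zeta>] by (simp add: z c_def[symmetric] power2_eq_square mult_ac)
  have zz: "ip n \<zeta> \<zeta> = (\<Sum>j<n. (l j - \<mu>)\<^sup>2 * (c j)\<^sup>2)"
    using spectral_ip[OF sp, of \<zeta> \<zeta>] by (simp add: z power2_eq_square mult_ac)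
  have "\<bar>(l i - \<mu>) * ip n u u - ip n u \<zeta>\<bar> = \<bar>\<Sum>j<n. ((l i - \<mu>) - (l j - \<mu>)) * (c j)\<^sup>2\<bar>"
    unfolding uu uz by (simp add: sum_distrib_left sum_subtractf left_diff_distrib)
  also have "\<dots> \<le> (\<Sum>j<n. \<bar>((l i - \<mu>) - (l j - \<mu>)) * (c j)\<^sup>2\<bar>)" by (rule sum_abs)
  also have "\<dots> \<le> (\<Sum>j<n. 2 / h * ((l j - \<mu>)\<^sup>2 * (c j)\<^sup>2))"
  proof (intro sum_mono)
    fix j assume j: "j \<in> {..<n}"
    show "\<bar>((l i - \<mu>) - (l j - \<mu>)) * (c j)\<^sup>2\<bar> \<le> 2 / h * ((l j - \<mu>)\<^sup>2 * (c j)\<^sup>2)"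
    proof (cases "j = i")
      case True
      then show ?thesis using \<open>h > 0\<close> by simp
    next
      case False
      then have h: "h \<le> \<bar>l j - \<mu>\<bar>" using far j by auto
      have "\<bar>(l i - \<mu>) - (l j - \<mu>)\<bar> \<le> 2 * \<bar>l j - \<mu>\<bar>" using i h by argo
      also have "\<dots> \<le> 2 / h * (l j - \<mu>)\<^sup>2"
      proof -
        have "h * \<bar>l j - \<mu>\<bar> \<le> \<bar>l j - \<mu>\<bar> * \<bar>l j - \<mu>\<bar>" using h by (intro mult_right_mono) auto
        then show ?thesis using \<open>h > 0\<close> by (simp add: field_simps power2_eq_square)
      qed
      finally have "\<bar>(l i - \<mu>) - (l j - \<mu>)\<bar> * (c j)\<^sup>2 \<le> 2 / h * (l j - \<mu>)\<^sup>2 * (c j)\<^sup>2"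
        by (intro mult_right_mono) auto
      then show ?thesis by (simp add: abs_mult mult_ac)
    qed
  qed
  also have "\<dots> = 2 * ip n \<zeta> \<zeta> / h" unfolding zz by (simp add: sum_distrib_left sum_divide_distrib)
  finally show "\<bar>(l i - \<mu>) * ip n u u - ip n u \<zeta>\<bar> \<le> 2 * ip n \<zeta> \<zeta> / h" .
  show "(l i - \<mu>)\<^sup>2 * ip n u u \<le> ip n \<zeta> \<zeta>"
    unfolding uu zz sum_distrib_left
  proof (intro sum_mono mult_right_mono)
    fix j assume j: "j \<in> {..<n}"
    have "\<bar>l i - \<mu>\<bar> \<le> \<bar>l j - \<mu>\<bar>" using i far[of j] j by (cases "j = i") auto
    then show "(l i - \<mu>)\<^sup>2 \<le> (l j - \<mu>)\<^sup>2" by (rule abs_le_square_iff[THEN iffD1])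
  qed auto
qed

lemma spectral_eigenvalue_bound:
  assumes sp: "spectral n S l v" and "j < n" and b: "\<And>a b. a < n \<Longrightarrow> b < n \<Longrightarrow> \<bar>S a b\<bar> \<le> C"
  shows "\<bar>l j\<bar> \<le> C * real n"
proof -
  have vv: "ip n (v j) (v j) = 1" using sp \<open>j < n\<close> by (simp add: spectral_def)
  have "l j = ip n (v j) (mv n S (v j))"
    using spectral_coeff_mv[OF sp \<open>j < n\<close>, of "v j"] vv by simp
  then show ?thesis using ip_mv_abs_le[of n S C "v j", OF b] vv by simp
qed

text \<open>Weyl's inequality makes an ordered eigenvalue Lipschitz in the entries, hence
  continuous, hence measurable as a function of measurable entries.\<close>

lemma eigval_desc_measurable:
  assumes A: "\<And>\<omega>. \<omega> \<in> space M \<Longrightarrow> A \<omega> \<in> carrier_mat n n \<and> transpose_mat (A \<omega>) = A \<omega>"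
    and meas: "\<And>a b. a < n \<Longrightarrow> b < n \<Longrightarrow> (\<lambda>\<omega>. A \<omega> $$ (a,b)) \<in> borel_measurable M"
    and "m < n"
  shows "(\<lambda>\<omega>. eigval_desc (Suc m) (A \<omega>)) \<in> borel_measurable M"
proof -
  \<comment> \<open>Symmetrising extends the eigenvalue to all functions on index pairs, so that
    continuity can be stated on a full product space; on symmetric matrices nothing changes.\<close>
  define G where "G g = mat n n (\<lambda>(a,b). (g (a,b) + g (b,a)) / 2)" for g :: "nat \<times> nat \<Rightarrow> real"
  define F where "F g = eigval_desc (Suc m) (G g)" for g
  define D where "D g g' p = \<bar>G g $$ p - G g' $$ p\<bar>" for g g' p
  define \<delta> where "\<delta> g g' = (\<Sum>p\<in>{..<n} \<times> {..<n}. D g g' p) * real n" for g g' :: "nat \<times> nat \<Rightarrow> real"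
  have F_le: "F g \<le> F g' + \<delta> g g'" for g g'
  proof -
    have G: "G g \<in> carrier_mat n n" "transpose_mat (G g) = G g" for g
      by (auto simp: G_def intro!: eq_matI)
    obtain v where v: "spectral n (\<lambda>a b. G g $$ (a,b)) (\<lambda>j. eigval_desc (Suc j) (G g)) v"
      using real_symmetric_spectral[OF G] by blast
    obtain v' where v': "spectral n (\<lambda>a b. G g' $$ (a,b)) (\<lambda>j. eigval_desc (Suc j) (G g')) v'"
      using real_symmetric_spectral[OF G] by blast
    show ?thesis unfolding F_def
    proof (rule spectral_perturb[OF v v' \<open>m < n\<close>])
      fix z :: "nat \<Rightarrow> real"
      show "\<bar>ip n z (mv n (\<lambda>a b. G g $$ (a,b)) z) - ip n z (mv n (\<lambda>a b. G g' $$ (a,b)) z)\<bar> \<le> \<delta> g g' * ip n z z"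
        unfolding ip_mv_diff \<delta>_def
      proof (rule ip_mv_abs_le)
        fix a b assume "a < n" "b < n"
        then show "\<bar>G g $$ (a,b) - G g' $$ (a,b)\<bar> \<le> (\<Sum>p\<in>{..<n} \<times> {..<n}. D g g' p)"
          using member_le_sum[of "(a,b)" "{..<n} \<times> {..<n}" "D g g'"] by (simp add: D_def)
      qed
    qed
  qed
  have \<delta>_sym: "\<delta> g g' = \<delta> g' g" for g g' by (simp add: \<delta>_def D_def abs_minus_commute)
  have "continuous_on UNIV F"
  proof (rule continuous_at_imp_continuous_on, intro ballI)
    fix g' :: "nat \<times> nat \<Rightarrow> real"
    have coord: "continuous_on UNIV (\<lambda>g :: nat \<times> nat \<Rightarrow> real. g x)" for x
      by (rule continuous_on_product_coordinates)
    have "continuous_on UNIV (\<lambda>g. \<delta> g g')"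
      unfolding \<delta>_def
    proof (intro continuous_intros)
      fix p assume "p \<in> {..<n} \<times> {..<n}"
      then have "D g g' p = \<bar>(g p + g (snd p, fst p)) / 2 - G g' $$ p\<bar>" for g by (auto simp: D_def G_def)
      then show "continuous_on UNIV (\<lambda>g. D g g' p)" by (simp only:) (intro continuous_intros coord, auto)
    qed
    then have "isCont (\<lambda>g. \<delta> g g') g'" by (simp add: continuous_on_eq_continuous_at)
    then have "((\<lambda>g. \<delta> g g') \<longlongrightarrow> \<delta> g' g') (at g')" by (simp add: isCont_def)
    moreover have "\<delta> g' g' = 0" by (simp add: \<delta>_def D_def)
    ultimately have lim: "((\<lambda>g. \<delta> g g') \<longlongrightarrow> 0) (at g')" by simp
    have "\<bar>F g - F g'\<bar> \<le> \<delta> g g'" for g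
      using F_le[of g g'] F_le[of g' g] \<delta>_sym[of g g'] by (simp add: abs_le_iff)
    then have "((\<lambda>g. F g - F g') \<longlongrightarrow> 0) (at g')"
      by (intro Lim_null_comparison[OF _ lim]) (auto intro!: always_eventually)
    then show "isCont F g'" unfolding isCont_def by (rule LIM_zero_cancel)
  qed
  then have F_meas: "F \<in> borel_measurable borel" by (rule borel_measurable_continuous_onI)
  define X where "X \<omega> = (\<lambda>(a,b). if a < n \<and> b < n then A \<omega> $$ (a,b) else 0)" for \<omega>
  have "X \<in> borel_measurable M"
  proof (rule measurable_coordinatewise_then_product)
    fix p :: "nat \<times> nat"
    show "(\<lambda>\<omega>. X \<omega> p) \<in> borel_measurable M"
      by (cases p; cases "fst p < n \<and> snd p < n") (auto simp: X_def meas)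
  qed
  then have "(\<lambda>\<omega>. F (X \<omega>)) \<in> borel_measurable M" using F_meas by (rule measurable_compose)
  moreover have "F (X \<omega>) = eigval_desc (Suc m) (A \<omega>)" if "\<omega> \<in> space M" for \<omega>
  proof -
    have "G (X \<omega>) = A \<omega>"
    proof (rule eq_matI)
      fix a b assume "a < dim_row (A \<omega>)" "b < dim_col (A \<omega>)"
      then have ab: "a < n" "b < n" using A[OF that] by auto
      have "A \<omega> $$ (a,b) = A \<omega> $$ (b,a)"
        using A[OF that] ab by (metis carrier_matD index_transpose_mat(1))
      then show "G (X \<omega>) $$ (a,b) = A \<omega> $$ (a,b)" using ab by (simp add: G_def X_def)
    qed (use A[OF that] in \<open>auto simp: G_def\<close>)
    then show ?thesis by (simp add: F_def)
  qed
  ultimately show ?thesis by (simp cong: measurable_cong)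
qed

section \<open>Eigenvalues of a perturbed finite-rank form on nearly orthonormal vectors\<close>

lemma near_orthonormal_norm:
  assumes "finite L" and gram: "\<And>i j. i \<in> L \<Longrightarrow> j \<in> L \<Longrightarrow> \<bar>ip n (e i) (e j) - (if i = j then 1 else 0)\<bar> \<le> \<rho>"
    and z: "z = (\<lambda>a. \<Sum>i\<in>L. c i * e i a)"
  shows "\<bar>ip n z z - (\<Sum>i\<in>L. (c i)\<^sup>2)\<bar> \<le> real (card L) * \<rho> * (\<Sum>i\<in>L. (c i)\<^sup>2)"
proof (cases "L = {}")
  case True
  then show ?thesis by (simp add: z ip_def)
next
  case False
  then obtain i0 where "i0 \<in> L" by auto
  then have "\<rho> \<ge> 0" using gram[of i0 i0] by auto
  have "ip n z z = (\<Sum>i\<in>L. c i * (\<Sum>j\<in>L. c j * ip n (e i) (e j)))"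
    unfolding z by (simp only: ip_sum_left ip_sum_right)
  moreover have "(\<Sum>i\<in>L. (c i)\<^sup>2) = (\<Sum>i\<in>L. c i * (\<Sum>j\<in>L. c j * (if i = j then 1 else 0)))"
    using \<open>finite L\<close> by (intro sum.cong) (auto simp: power2_eq_square if_distrib cong: if_cong)
  ultimately have "\<bar>ip n z z - (\<Sum>i\<in>L. (c i)\<^sup>2)\<bar>
     = \<bar>\<Sum>i\<in>L. \<Sum>j\<in>L. c i * c j * (ip n (e i) (e j) - (if i = j then 1 else 0))\<bar>"
    by (simp only: sum_subtractf[symmetric] sum_distrib_left right_diff_distrib mult.assoc)
  also have "\<dots> \<le> (\<Sum>i\<in>L. \<Sum>j\<in>L. \<bar>c i * c j * (ip n (e i) (e j) - (if i = j then 1 else 0))\<bar>)"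
    by (intro order_trans[OF sum_abs] sum_mono sum_abs)
  also have "\<dots> \<le> (\<Sum>i\<in>L. \<Sum>j\<in>L. \<bar>c i\<bar> * \<bar>c j\<bar> * \<rho>)"
    by (intro sum_mono) (simp only: abs_mult, intro mult_left_mono gram, auto)
  also have "\<dots> = \<rho> * (\<Sum>i\<in>L. \<bar>c i\<bar>)\<^sup>2"
    by (simp add: power2_eq_square sum_distrib_left sum_distrib_right mult_ac)
  also have "\<dots> \<le> \<rho> * (real (card L) * (\<Sum>i\<in>L. (c i)\<^sup>2))"
    using Cauchy_Schwarz_ineq_sum[of "\<lambda>_. 1" "\<lambda>i. \<bar>c i\<bar>" L] \<open>\<rho> \<ge> 0\<close> by (intro mult_left_mono) auto
  finally show ?thesis by (simp add: mult_ac)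
qed

text \<open>Min-max with the \<open>e i\<close> themselves: \<open>e 1, ..., e m\<close> are trial
  vectors for the lower bound and constraints for the upper one. The Gram error costs a relative
  \<open>\<kappa> = k \<rho>\<close>, the perturbation an absolute \<open>\<delta>\<close>. Beyond
  index \<open>k\<close> the finite-rank form vanishes, whence the 0 in place of
  \<open>\<theta> (Suc m)\<close>.\<close>

lemma finite_rank_eigenvalues:
  assumes sp: "spectral n S l v"
    and gram: "\<And>i j. i \<in> {1..k} \<Longrightarrow> j \<in> {1..k} \<Longrightarrow> \<bar>ip n (e i) (e j) - (if i = j then 1 else 0)\<bar> \<le> \<rho>"
    and dec: "\<And>i j. 1 \<le> i \<Longrightarrow> i \<le> j \<Longrightarrow> j \<le> k \<Longrightarrow> \<theta> j \<le> \<theta> i"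
    and pos: "\<And>i. 1 \<le> i \<Longrightarrow> i \<le> k \<Longrightarrow> 0 < \<theta> i"
    and "q \<ge> 0" and \<rho>: "0 \<le> \<rho>" "real k * \<rho> < 1"
    and close: "\<And>z. \<bar>ip n z (mv n S z) - q * (\<Sum>i=1..k. \<theta> i * (ip n (e i) z)\<^sup>2)\<bar> \<le> \<delta> * ip n z z"
  shows "1 \<le> m \<Longrightarrow> m \<le> k \<Longrightarrow> m \<le> n \<Longrightarrow> q * \<theta> m * (1 - real k * \<rho>) - \<delta> \<le> l (m - 1)"
    and "m \<le> k \<Longrightarrow> m < n \<Longrightarrow> l m \<le> q * (if m < k then \<theta> (Suc m) else 0) * (1 + real k * \<rho>) + \<delta>"
proof -
  define \<kappa> where "\<kappa> = real k * \<rho>"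
  have \<kappa>: "0 \<le> \<kappa>" "\<kappa> < 1" using \<rho> by (auto simp: \<kappa>_def)
  have norm: "\<bar>ip n z z - (\<Sum>i\<in>L. (c i)\<^sup>2)\<bar> \<le> \<kappa> * (\<Sum>i\<in>L. (c i)\<^sup>2)"
    if "L \<subseteq> {1..k}" "z = (\<lambda>a. \<Sum>i\<in>L. c i * e i a)" for L z c
  proof -
    have "finite L" "card L \<le> k"
      using that(1) finite_subset card_mono[of "{1..k}" L] by auto
    have "\<bar>ip n z z - (\<Sum>i\<in>L. (c i)\<^sup>2)\<bar> \<le> real (card L) * \<rho> * (\<Sum>i\<in>L. (c i)\<^sup>2)"
      using that(1) by (intro near_orthonormal_norm[OF \<open>finite L\<close> gram that(2)]) auto
    also have "\<dots> \<le> \<kappa> * (\<Sum>i\<in>L. (c i)\<^sup>2)"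
      unfolding \<kappa>_def using \<open>card L \<le> k\<close> \<rho>(1) by (intro mult_right_mono sum_nonneg) auto
    finally show ?thesis .
  qed
  {
    assume m: "1 \<le> m" "m \<le> k" "m \<le> n"
    show "q * \<theta> m * (1 - real k * \<rho>) - \<delta> \<le> l (m - 1)"
    proof (rule spectral_ge[OF sp, where y = "\<lambda>s. e (Suc s)"])
      show "m - 1 < n" using m by auto
      fix c0 :: "nat \<Rightarrow> real" and z
      assume c0: "\<exists>s\<le>m - 1. c0 s \<noteq> 0" and z: "z = (\<lambda>a. \<Sum>s\<le>m - 1. c0 s * e (Suc s) a)"
      define c where "c i = c0 (i - 1)" for i
      have img: "{1..m} = Suc ` {..m - 1}" using m by (auto simp: image_Suc_atMost)
      have z': "z = (\<lambda>a. \<Sum>i=1..m. c i * e i a)"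
        unfolding z img c_def by (simp add: sum.reindex)
      have L: "{1..m} \<subseteq> {1..k}" using m by auto
      define C where "C = (\<Sum>i=1..m. (c i)\<^sup>2)"
      define D where "D = (\<Sum>i=1..m. (ip n (e i) z)\<^sup>2)"
      obtain s where "s \<le> m - 1" "c0 s \<noteq> 0" using c0 by auto
      then have "C > 0" unfolding C_def using m
        by (intro sum_pos2[of _ "Suc s"]) (auto simp: c_def)
      have nz: "\<bar>ip n z z - C\<bar> \<le> \<kappa> * C" using norm[OF L z'] by (simp add: C_def)
      then have zC: "(1 - \<kappa>) * C \<le> ip n z z" by (simp add: algebra_simps abs_le_iff)
      have zpos: "ip n z z > 0" using zC \<open>C > 0\<close> \<kappa> by (smt (verit) mult_pos_pos)
      \<comment> \<open>Cauchy-Schwarz on \<open>z'z = \<Sum> c_i (e_i'z)\<close>, combined with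
        \<open>(1 - \<kappa>) C \<le> z'z\<close>, turns the bound on coefficients into a lower
        bound for \<open>D\<close>.\<close>
      have "ip n z z = ip n (\<lambda>a. \<Sum>i=1..m. c i * e i a) z" using z' by simp
      also have "\<dots> = (\<Sum>i=1..m. c i * ip n (e i) z)" by (rule ip_sum_left)
      finally have "(ip n z z)\<^sup>2 \<le> C * D"
        unfolding C_def D_def using Cauchy_Schwarz_ineq_sum[of c "\<lambda>i. ip n (e i) z" "{1..m}"] by simp
      then have "(1 - \<kappa>) * (ip n z z)\<^sup>2 \<le> (1 - \<kappa>) * C * D"
        using \<kappa> by (simp add: mult.assoc mult_left_mono)
      also have "\<dots> \<le> ip n z z * D" using zC by (intro mult_right_mono) (auto simp: D_def sum_nonneg)
      finally have "ip n z z * ((1 - \<kappa>) * ip n z z) \<le> ip n z z * D" by (simp add: power2_eq_square mult_ac)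
      then have D: "(1 - \<kappa>) * ip n z z \<le> D" using zpos by (simp only: mult_le_cancel_left_pos)
      have "q * \<theta> m * (1 - \<kappa>) * ip n z z \<le> q * \<theta> m * D"
        using D \<open>q \<ge> 0\<close> pos[of m] m by (simp add: mult.assoc mult_left_mono)
      also have "\<dots> = q * (\<Sum>i=1..m. \<theta> m * (ip n (e i) z)\<^sup>2)" by (simp add: D_def sum_distrib_left mult_ac)
      also have "\<dots> \<le> q * (\<Sum>i=1..m. \<theta> i * (ip n (e i) z)\<^sup>2)"
        using \<open>q \<ge> 0\<close> m by (intro mult_left_mono sum_mono mult_right_mono dec) auto
      also have "\<dots> \<le> q * (\<Sum>i=1..k. \<theta> i * (ip n (e i) z)\<^sup>2)"
        using \<open>q \<ge> 0\<close> m by (intro mult_left_mono sum_mono2) (auto intro!: mult_nonneg_nonneg less_imp_le[OF pos])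
      finally have "q * \<theta> m * (1 - \<kappa>) * ip n z z \<le> ip n z (mv n S z) + \<delta> * ip n z z"
        using close[of z] by linarith
      then show "0 < ip n z z \<and> (q * \<theta> m * (1 - real k * \<rho>) - \<delta>) * ip n z z \<le> ip n z (mv n S z)"
        using zpos by (simp add: \<kappa>_def algebra_simps)
    qed
  }
  {
    assume m: "m \<le> k" "m < n"
    define t where "t = (if m < k then \<theta> (Suc m) else 0)"
    have t0: "t \<ge> 0" using pos[of "Suc m"] by (auto simp: t_def)
    show "l m \<le> q * (if m < k then \<theta> (Suc m) else 0) * (1 + real k * \<rho>) + \<delta>"
    proof (rule spectral_le[OF sp \<open>m < n\<close>, where g = "\<lambda>s. e (Suc s)"])
      fix z assume orth: "\<And>s. s < m \<Longrightarrow> ip n (e (Suc s)) z = 0"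
      have orth': "ip n (e i) z = 0" if "1 \<le> i" "i \<le> m" for i using orth[of "i - 1"] that by simp
      define L where "L = {Suc m..k}"
      define d where "d i = ip n (e i) z" for i
      define D where "D = (\<Sum>i\<in>L. (d i)\<^sup>2)"
      define y where "y = (\<lambda>a. \<Sum>i\<in>L. d i * e i a)"
      have "\<bar>ip n y y - D\<bar> \<le> \<kappa> * D" unfolding D_def by (rule norm) (auto simp: L_def y_def)
      then have yy: "ip n y y \<le> (1 + \<kappa>) * D" by (simp add: algebra_simps abs_le_iff)
      have "D \<ge> 0" by (simp add: D_def sum_nonneg)
      \<comment> \<open>An approximate Bessel inequality: \<open>z\<close> is paired with
        \<open>y\<close>, which would be its projection if the \<open>e i\<close> were
        orthonormal.\<close>
      have "ip n y z = D" by (simp add: y_def ip_sum_left D_def d_def power2_eq_square)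
      then have "D\<^sup>2 \<le> ip n y y * ip n z z" using ip_Cauchy_Schwarz[of n y z] by simp
      also have "\<dots> \<le> (1 + \<kappa>) * D * ip n z z" using yy by (intro mult_right_mono ip_self_nonneg)
      finally have "D * D \<le> D * ((1 + \<kappa>) * ip n z z)" by (simp add: power2_eq_square mult_ac)
      then have D: "D \<le> (1 + \<kappa>) * ip n z z"
        using \<open>D \<ge> 0\<close> \<kappa> ip_self_nonneg[of n z] by (cases "D = 0") auto
      have "(\<Sum>i=1..k. \<theta> i * (d i)\<^sup>2) = (\<Sum>i\<in>L. \<theta> i * (d i)\<^sup>2)"
        by (intro sum.mono_neutral_right) (auto simp: L_def d_def orth')
      also have "\<dots> \<le> (\<Sum>i\<in>L. t * (d i)\<^sup>2)"
        by (intro sum_mono mult_right_mono) (auto simp: L_def t_def intro!: dec)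
      also have "\<dots> = t * D" by (simp add: D_def sum_distrib_left)
      finally have "q * (\<Sum>i=1..k. \<theta> i * (d i)\<^sup>2) \<le> q * (t * D)" using \<open>q \<ge> 0\<close> by (rule mult_left_mono)
      also have "\<dots> \<le> q * (t * ((1 + \<kappa>) * ip n z z))" using \<open>q \<ge> 0\<close> t0 D by (intro mult_left_mono)
      finally have "ip n z (mv n S z) \<le> q * (t * ((1 + \<kappa>) * ip n z z)) + \<delta> * ip n z z"
        using close[of z] unfolding d_def by linarith
      then show "ip n z (mv n S z) \<le> (q * (if m < k then \<theta> (Suc m) else 0) * (1 + real k * \<rho>) + \<delta>) * ip n z z"
        unfolding t_def[symmetric] \<kappa>_def[symmetric] by (simp add: algebra_simps)
    qed
  }
qed

section \<open>Walks and powers of a matrix\<close>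

fun wprod :: "(nat \<Rightarrow> nat \<Rightarrow> real) \<Rightarrow> nat list \<Rightarrow> real" where
  "wprod W (x # y # ys) = W x y * wprod W (y # ys)"
| "wprod W [x] = 1"
| "wprod W [] = 1"

text \<open>A step is stored as (min, max), the index of an independent entry on or above the
  diagonal, so that both directions of crossing count as the same edge. Loops are allowed.\<close>

fun edges :: "nat list \<Rightarrow> (nat \<times> nat) list" where
  "edges (x # y # ys) = (min x y, max x y) # edges (y # ys)"
| "edges [x] = []"
| "edges [] = []"

definition walks :: "nat \<Rightarrow> nat \<Rightarrow> nat list set" where
  "walks N m = {xs. length xs = m \<and> set xs \<subseteq> {..<N}}"

lemma finite_walks [simp]: "finite (walks N m)"
  using finite_lists_length_eq[of "{..<N}" m] by (simp add: walks_def conj_commute)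

lemma walks_0 [simp]: "walks N 0 = {[]}"
  by (auto simp: walks_def)

lemma sum_walks_Suc: "(\<Sum>xs\<in>walks N (Suc m). g xs) = (\<Sum>x<N. \<Sum>xs\<in>walks N m. g (x # xs))"
proof -
  have eq: "walks N (Suc m) = (\<lambda>(x,xs). x # xs) ` ({..<N} \<times> walks N m)"
    by (auto simp: walks_def length_Suc_conv image_iff)
  show ?thesis
    unfolding eq by (subst sum.reindex) (auto simp: inj_on_def sum.cartesian_product case_prod_beta intro!: sum.cong)
qed

lemma length_edges: "length (edges xs) = length xs - 1"
  by (induct xs rule: edges.induct) auto

lemma edges_vertices: "(i, j) \<in> set (edges xs) \<Longrightarrow> i \<in> set xs \<and> j \<in> set xs \<and> i \<le> j"
  by (induct xs rule: edges.induct) (auto simp: min_def max_def split: if_splits)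

text \<open>The connectivity bound for graphs: a vertex that is new when prepended brings an edge
  that is new.\<close>

lemma card_vertices_le: "card (set xs) \<le> Suc (card (set (edges xs)))"
proof (induct xs rule: edges.induct)
  case (1 x y ys)
  show ?case
  proof (cases "x \<in> set (y # ys)")
    case True
    then have "card (set (x # y # ys)) = card (set (y # ys))" by (simp add: insert_absorb)
    also have "\<dots> \<le> Suc (card (set (edges (y # ys))))" by (rule 1)
    also have "card (set (edges (y # ys))) \<le> card (set (edges (x # y # ys)))"
      by (intro card_mono) auto
    finally show ?thesis by simp
  next
    case False
    then have "(min x y, max x y) \<notin> set (edges (y # ys))"
      using edges_vertices[of "min x y" "max x y" "y # ys"] by (auto simp: min_def max_def split: if_splits)
    then have "card (set (edges (x # y # ys))) = Suc (card (set (edges (y # ys))))" by simp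
    moreover have "card (set (x # y # ys)) = Suc (card (set (y # ys)))" using False by simp
    ultimately show ?thesis using 1 by linarith
  qed
qed auto

lemma wprod_edges:
  assumes "\<And>a b. a \<in> set xs \<Longrightarrow> b \<in> set xs \<Longrightarrow> W a b = W b a"
  shows "wprod W xs = prod_list (map (\<lambda>(i,j). W i j) (edges xs))"
  using assms by (induct xs rule: edges.induct) (auto simp: min_def max_def)

lemma prod_list_count:
  fixes f :: "'a \<Rightarrow> 'b::comm_monoid_mult"
  assumes "finite A" "set xs \<subseteq> A"
  shows "prod_list (map f xs) = (\<Prod>x\<in>A. f x ^ count_list xs x)"
  using assms(2)
proof (induct xs)
  case (Cons a xs)
  have "(\<Prod>x\<in>A. f x ^ count_list (a # xs) x) = (\<Prod>x\<in>A. (if a = x then f x else 1) * f x ^ count_list xs x)"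
    by (intro prod.cong) auto
  also have "\<dots> = f a * (\<Prod>x\<in>A. f x ^ count_list xs x)"
    using Cons(2) assms(1) by (simp add: prod.distrib)
  finally show ?case using Cons by simp
qed simp

lemma card_set_le_half:
  assumes "\<And>x. x \<in> set xs \<Longrightarrow> count_list xs x \<ge> 2"
  shows "2 * card (set xs) \<le> length xs"
proof -
  have "2 * card (set xs) = (\<Sum>x\<in>set xs. 2)" by simp
  also have "\<dots> \<le> (\<Sum>x\<in>set xs. count_list xs x)" by (intro sum_mono assms)
  also have "\<dots> = length xs" by (rule sum_count_set) auto
  finally show ?thesis .
qed

text \<open>When a vertex is prepended to a walk on \<open>m\<close> vertices, at most
  \<open>m\<close> choices are old and keep the weight, while at most \<open>N\<close> are new and
  each carries a factor \<open>1 / N\<close>. The total grows by at most \<open>m + 1\<close>, which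
  is the origin of the factorials in all moment bounds.\<close>

lemma sum_walks_weight:
  assumes "N \<ge> 1" "m \<ge> 1"
  shows "(\<Sum>xs\<in>walks N m. (1 / real N) ^ (card (set xs) - 1)) \<le> real N * fact m"
  using assms(2)
proof (induct m rule: dec_induct)
  case base
  show ?case by (simp add: sum_walks_Suc)
next
  case (step m)
  define w where "w xs = (1 / real N) ^ (card (set xs) - 1)" for xs :: "nat list"
  have w0: "w xs \<ge> 0" for xs by (simp add: w_def)
  have "(\<Sum>xs\<in>walks N (Suc m). w xs) = (\<Sum>xs\<in>walks N m. \<Sum>x<N. w (x # xs))"
    unfolding sum_walks_Suc by (rule sum.swap)
  also have "\<dots> \<le> (\<Sum>xs\<in>walks N m. real (Suc m) * w xs)"
  proof (intro sum_mono)
    fix xs assume "xs \<in> walks N m"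
    then have len: "length xs = m" and sub: "set xs \<subseteq> {..<N}" by (auto simp: walks_def)
    have c: "card (set xs) \<ge> 1" using len step(1) by (auto simp: Suc_le_eq card_gt_0_iff)
    have 1: "w (x # xs) = w xs" if "x \<in> set xs" for x using that by (simp add: w_def insert_absorb)
    have 2: "w (x # xs) = w xs / real N" if "x \<notin> set xs" for x
      using that c by (cases "card (set xs)") (auto simp: w_def)
    have "(\<Sum>x<N. w (x # xs)) = (\<Sum>x\<in>set xs. w (x # xs)) + (\<Sum>x\<in>{..<N} - set xs. w (x # xs))"
      using sub by (subst sum.subset_diff[of "set xs"]) auto
    also have "\<dots> = real (card (set xs)) * w xs + real (card ({..<N} - set xs)) * (w xs / real N)"
      by (simp add: 1 2)
    also have "\<dots> \<le> real m * w xs + real N * (w xs / real N)"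
      using card_length[of xs] len w0[of xs] card_mono[of "{..<N}" "{..<N} - set xs"]
      by (intro add_mono mult_right_mono) auto
    also have "\<dots> = real (Suc m) * w xs" using assms(1) by (simp add: algebra_simps)
    finally show "(\<Sum>x<N. w (x # xs)) \<le> real (Suc m) * w xs" .
  qed
  also have "\<dots> = real (Suc m) * (\<Sum>xs\<in>walks N m. w xs)" by (simp add: sum_distrib_left)
  also have "\<dots> \<le> real (Suc m) * (real N * fact m)"
    using step(3) by (intro mult_left_mono) (auto simp: w_def)
  finally show ?case by (simp add: w_def mult_ac)
qed

section \<open>Powers and traces as sums over walks, and the operator norm\<close>

lemma mv_power_walks:
  "(mv N S ^^ n) f a = (\<Sum>xs\<in>walks N n. wprod S (a # xs) * f (last (a # xs)))"
proof (induct n arbitrary: a)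
  case (Suc n)
  have "(mv N S ^^ Suc n) f a = (\<Sum>b<N. S a b * (\<Sum>xs\<in>walks N n. wprod S (b # xs) * f (last (b # xs))))"
    by (simp add: mv_def Suc)
  also have "\<dots> = (\<Sum>b<N. \<Sum>xs\<in>walks N n. wprod S (a # b # xs) * f (last (a # b # xs)))"
    by (simp add: sum_distrib_left mult_ac)
  finally show ?case by (simp add: sum_walks_Suc)
qed simp

lemma ip_mv_power_walks:
  "ip N e ((mv N S ^^ n) f) = (\<Sum>xs\<in>walks N (Suc n). e (hd xs) * f (last xs) * wprod S xs)"
  by (simp add: ip_def mv_power_walks sum_walks_Suc sum_distrib_left mult_ac)

lemma ip_mv_power_swap:
  assumes "\<And>a b. a < n \<Longrightarrow> b < n \<Longrightarrow> S a b = S b a"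
  shows "ip n ((mv n S ^^ i) u) v = ip n u ((mv n S ^^ i) v)"
proof (induct i arbitrary: u)
  case (Suc i)
  have "ip n ((mv n S ^^ Suc i) u) v = ip n ((mv n S ^^ i) (mv n S u)) v"
    by (simp only: funpow_Suc_right o_apply)
  also have "\<dots> = ip n (mv n S u) ((mv n S ^^ i) v)" by (rule Suc)
  also have "\<dots> = ip n u (mv n S ((mv n S ^^ i) v))" by (rule ip_mv_symmetric[OF assms, symmetric])
  finally show ?case by simp
qed simp

text \<open>The functions \<open>\<lambda>b. of_bool (b = a)\<close> are the standard basis vectors.
  Written in this form, the trace of the power inherits the walk expansion of
  \<open>ip N e ((mv N S ^^ n) f)\<close>.\<close>

definition trace_power :: "nat \<Rightarrow> (nat \<Rightarrow> nat \<Rightarrow> real) \<Rightarrow> nat \<Rightarrow> real" where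
  "trace_power n S p = (\<Sum>a<n. ip n (\<lambda>b. of_bool (b = a)) ((mv n S ^^ p) (\<lambda>b. of_bool (b = a))))"

lemma mv_power_sum: "(mv n S ^^ p) (\<lambda>a. \<Sum>s\<in>T. c s * y s a) = (\<lambda>b. \<Sum>s\<in>T. c s * (mv n S ^^ p) (y s) b)"
proof (induct p)
  case (Suc p)
  show ?case by (rule ext) (simp add: Suc mv_sum)
qed simp

lemma mv_power_cong:
  assumes "\<And>a. a < n \<Longrightarrow> u a = v a" "b < n"
  shows "(mv n S ^^ p) u b = (mv n S ^^ p) v b"
  using assms(2) by (induct p arbitrary: b) (auto simp: assms intro!: mv_cong)

lemma trace_power_double:
  assumes "\<And>a b. a < n \<Longrightarrow> b < n \<Longrightarrow> S a b = S b a"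
  shows "trace_power n S (2 * p) =
    (\<Sum>s<n. ip n ((mv n S ^^ p) (\<lambda>b. of_bool (b = s))) ((mv n S ^^ p) (\<lambda>b. of_bool (b = s))))"
  unfolding trace_power_def mult_2 funpow_add o_apply
  by (intro sum.cong refl ip_mv_power_swap[OF assms, symmetric])

lemma trace_power_nonneg:
  assumes "\<And>a b. a < n \<Longrightarrow> b < n \<Longrightarrow> S a b = S b a"
  shows "trace_power n S (2 * p) \<ge> 0"
  using trace_power_double[of n S p] assms by (simp add: sum_nonneg ip_self_nonneg)

text \<open>For symmetric \<open>S\<close> the trace of the power \<open>2 p\<close> is the squared
  Hilbert-Schmidt norm of the power \<open>p\<close>, which dominates its squared operator
  norm.\<close>

lemma mv_norm_power_le_trace:
  assumes sym: "\<And>a b. a < n \<Longrightarrow> b < n \<Longrightarrow> S a b = S b a"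
  shows "ip n ((mv n S ^^ p) u) ((mv n S ^^ p) u) \<le> trace_power n S (2 * p) * ip n u u"
proof -
  define d where "d a = (\<lambda>b. of_bool (b = a) :: real)" for a :: nat
  have u: "u a = (\<Sum>s<n. u s * d s a)" if "a < n" for a
  proof -
    have "(\<Sum>s<n. u s * d s a) = (\<Sum>s<n. if s = a then u a else 0)"
      by (intro sum.cong) (auto simp: d_def)
    then show ?thesis using that by simp
  qed
  have "(mv n S ^^ p) u b = (\<Sum>s<n. u s * (mv n S ^^ p) (d s) b)" if "b < n" for b
    using mv_power_cong[of n u "\<lambda>a. \<Sum>s<n. u s * d s a" b p S] u that
    by (simp add: mv_power_sum)
  then have "((mv n S ^^ p) u b)\<^sup>2 \<le> ip n u u * (\<Sum>s<n. ((mv n S ^^ p) (d s) b)\<^sup>2)" if "b < n" for b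
    using Cauchy_Schwarz_ineq_sum[of u "\<lambda>s. (mv n S ^^ p) (d s) b" "{..<n}"] that
    by (simp add: ip_def power2_eq_square)
  then have "ip n ((mv n S ^^ p) u) ((mv n S ^^ p) u) \<le> (\<Sum>b<n. ip n u u * (\<Sum>s<n. ((mv n S ^^ p) (d s) b)\<^sup>2))"
    unfolding ip_def[of n "(mv n S ^^ p) u"] power2_eq_square[symmetric] by (intro sum_mono) auto
  also have "\<dots> = ip n u u * (\<Sum>s<n. \<Sum>b<n. ((mv n S ^^ p) (d s) b)\<^sup>2)"
    by (simp add: sum_distrib_left[symmetric]) (rule disjI2, rule sum.swap)
  also have "(\<Sum>s<n. \<Sum>b<n. ((mv n S ^^ p) (d s) b)\<^sup>2) = trace_power n S (2 * p)"
    using trace_power_double[of n S p] sym by (simp add: d_def ip_def power2_eq_square)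
  finally show ?thesis by (simp add: mult.commute)
qed

text \<open>The norms of \<open>S\<^sup>p u\<close> are log-convex in \<open>p\<close>, so the first ratio is at most every later one.\<close>

lemma mv_norm_log_convex:
  assumes sym: "\<And>a b. a < n \<Longrightarrow> b < n \<Longrightarrow> S a b = S b a"
  defines "g \<equiv> \<lambda>p u. ip n ((mv n S ^^ p) u) ((mv n S ^^ p) u)"
  shows "g 1 u ^ p * g 0 u \<le> g p u * g 0 u ^ p"
proof -
  have g0: "g p u \<ge> 0" for p by (simp add: g_def ip_self_nonneg)
  have lc: "(g (Suc p) u)\<^sup>2 \<le> g p u * g (Suc (Suc p)) u" for p
  proof -
    have "g (Suc p) u = ip n ((mv n S ^^ p) u) ((mv n S ^^ Suc (Suc p)) u)"
      unfolding g_def by (simp add: ip_mv_symmetric[OF sym, symmetric])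
    then show ?thesis unfolding g_def by (simp only: ip_Cauchy_Schwarz)
  qed
  have ratio: "g p u * g 1 u \<le> g (Suc p) u * g 0 u" for p
  proof (induct p)
    case (Suc p)
    show ?case
    proof (cases "g p u = 0")
      case True
      then have "g (Suc p) u = 0" using lc[of p] g0[of "Suc p"] by simp
      then show ?thesis using g0 by simp
    next
      case False
      then have pos: "g p u > 0" using g0[of p] by simp
      have "g p u * (g (Suc p) u * g 1 u) \<le> g (Suc p) u * (g (Suc p) u * g 0 u)"
        using mult_left_mono[OF Suc g0[of "Suc p"]] by (simp add: mult_ac)
      also have "\<dots> \<le> g p u * (g (Suc (Suc p)) u * g 0 u)"
        using mult_right_mono[OF lc[of p] g0[of 0]] by (simp add: power2_eq_square mult_ac)
      finally show ?thesis using pos by (simp only: mult_le_cancel_left_pos)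
    qed
  qed simp
  show ?thesis
  proof (induct p)
    case (Suc p)
    have "g 1 u ^ Suc p * g 0 u \<le> g 1 u * (g p u * g 0 u ^ p)"
      using mult_left_mono[OF Suc g0[of 1]] by (simp add: mult_ac)
    also have "\<dots> \<le> (g (Suc p) u * g 0 u) * g 0 u ^ p"
      using mult_right_mono[OF ratio[of p], of "g 0 u ^ p"] g0[of 0] by (simp add: mult_ac)
    finally show ?case by (simp add: mult_ac)
  qed simp
qed

text \<open>Log-convexity bounds the \<open>p\<close>-th power of \<open>|S u|^2 / |u|^2\<close> by
  \<open>|S^p u|^2 / |u|^2\<close>, hence by the trace; taking a \<open>p\<close>-th root bounds the
  operator norm. With \<open>p\<close> of order \<open>log N\<close> the trace costs only a bounded
  factor per root for its \<open>N\<close> diagonal terms.\<close>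

lemma mv_norm_le_of_trace:
  assumes sym: "\<And>a b. a < n \<Longrightarrow> b < n \<Longrightarrow> S a b = S b a"
    and "p \<ge> 1" "c \<ge> 0" and tr: "trace_power n S (2 * p) \<le> c ^ p"
  shows "ip n (mv n S u) (mv n S u) \<le> c * ip n u u"
proof (cases "ip n u u = 0")
  case True
  then have "\<forall>a\<in>{..<n}. u a * u a = 0" unfolding ip_def by (subst (asm) sum_nonneg_eq_0_iff) auto
  then have "mv n S u b = 0" for b by (simp add: mv_def)
  then show ?thesis using True by (simp add: ip_def)
next
  case False
  then have pos: "ip n u u > 0" using ip_self_nonneg[of n u] by simp
  have "ip n (mv n S u) (mv n S u) ^ p * ip n u u \<le> ip n ((mv n S ^^ p) u) ((mv n S ^^ p) u) * ip n u u ^ p"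
    using mv_norm_log_convex[OF sym, where p = p and u = u] by simp
  also have "\<dots> \<le> (c ^ p * ip n u u) * ip n u u ^ p"
  proof (intro mult_right_mono)
    have "ip n ((mv n S ^^ p) u) ((mv n S ^^ p) u) \<le> trace_power n S (2 * p) * ip n u u"
      by (rule mv_norm_power_le_trace[OF sym])
    also have "\<dots> \<le> c ^ p * ip n u u" using tr pos by (intro mult_right_mono) auto
    finally show "ip n ((mv n S ^^ p) u) ((mv n S ^^ p) u) \<le> c ^ p * ip n u u" .
  qed (use pos in auto)
  finally have "ip n u u * ip n (mv n S u) (mv n S u) ^ p \<le> ip n u u * (c * ip n u u) ^ p"
    by (simp add: power_mult_distrib mult_ac)
  then have "ip n (mv n S u) (mv n S u) ^ p \<le> (c * ip n u u) ^ p"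
    using pos by (simp only: mult_le_cancel_left_pos)
  then show ?thesis using \<open>p \<ge> 1\<close> \<open>c \<ge> 0\<close> pos
    by (cases p) (auto intro: power_le_imp_le_base)
qed

section \<open>Moments of a centred symmetric random matrix\<close>

text \<open>\<open>s\<close> dominates all variances. The condition
  \<open>1 \<le> real N * s\<close> makes powers of \<open>N s\<close> increase, so walks with few
  distinct edges are covered by the largest exponent. Boundedness is almost sure because entries
  will be known only through their law.\<close>

locale centred_symmetric = prob_space M for M :: "'w measure" +
  fixes N :: nat and W :: "'w \<Rightarrow> nat \<Rightarrow> nat \<Rightarrow> real" and s :: real
  assumes N_pos: "N \<ge> 1"
    and indep: "indep_vars (\<lambda>_. borel) (\<lambda>(i,j) \<omega>. W \<omega> i j) {(i,j). i \<le> j \<and> j < N}"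
    and W_sym: "\<And>\<omega> a b. \<omega> \<in> space M \<Longrightarrow> a < N \<Longrightarrow> b < N \<Longrightarrow> W \<omega> a b = W \<omega> b a"
    and W_bdd: "\<And>a b. a < N \<Longrightarrow> b < N \<Longrightarrow> AE \<omega> in M. \<bar>W \<omega> a b\<bar> \<le> 1"
    and W_mean: "\<And>a b. a < N \<Longrightarrow> b < N \<Longrightarrow> expectation (\<lambda>\<omega>. W \<omega> a b) = 0"
    and W_var: "\<And>a b. a < N \<Longrightarrow> b < N \<Longrightarrow> expectation (\<lambda>\<omega>. (W \<omega> a b)\<^sup>2) \<le> s"
    and s: "0 \<le> s" "s \<le> 1" "1 \<le> real N * s"
begin

lemma W_measurable:
  assumes "a < N" "b < N"
  shows "(\<lambda>\<omega>. W \<omega> a b) \<in> borel_measurable M"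
proof -
  have le: "(\<lambda>\<omega>. W \<omega> a b) \<in> borel_measurable M" if "a \<le> b" "b < N" for a b
    using indep that unfolding indep_vars_def by auto
  show ?thesis
  proof (cases "a \<le> b")
    case False
    then have "(\<lambda>\<omega>. W \<omega> b a) \<in> borel_measurable M" using le assms by simp
    then show ?thesis using W_sym[OF _ assms] by (simp cong: measurable_cong)
  qed (use le assms in auto)
qed

lemma W_bdd_all: "AE \<omega> in M. \<forall>a\<in>{..<N}. \<forall>b\<in>{..<N}. \<bar>W \<omega> a b\<bar> \<le> 1"
  by (intro eventually_ball_finite ballI) (auto intro: W_bdd)

lemma wprod_measurable:
  assumes "set xs \<subseteq> {..<N}"
  shows "(\<lambda>\<omega>. wprod (W \<omega>) xs) \<in> borel_measurable M"
  using assms by (induct xs rule: edges.induct) (auto intro!: borel_measurable_times W_measurable)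

lemma wprod_bdd: "AE \<omega> in M. \<forall>xs. set xs \<subseteq> {..<N} \<longrightarrow> \<bar>wprod (W \<omega>) xs\<bar> \<le> 1"
  using W_bdd_all
proof eventually_elim
  case (elim \<omega>)
  have "\<bar>wprod (W \<omega>) xs\<bar> \<le> 1" if "set xs \<subseteq> {..<N}" for xs
    using that by (induct xs rule: edges.induct) (use elim in \<open>auto simp: abs_mult intro!: mult_le_one\<close>)
  then show ?case by blast
qed

lemma wprod_integrable: "set xs \<subseteq> {..<N} \<Longrightarrow> integrable M (\<lambda>\<omega>. wprod (W \<omega>) xs)"
  using wprod_bdd by (intro integrable_const_bound[where B = 1] wprod_measurable) auto

lemma W_power_integrable: "a < N \<Longrightarrow> b < N \<Longrightarrow> integrable M (\<lambda>\<omega>. W \<omega> a b ^ m)"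
  using W_bdd[of a b]
  by (intro integrable_const_bound[where B = 1] borel_measurable_power W_measurable)
     (auto simp: power_abs intro!: power_le_one)

lemma W_integrable: "a < N \<Longrightarrow> b < N \<Longrightarrow> integrable M (\<lambda>\<omega>. W \<omega> a b)"
  using W_power_integrable[of a b 1] by simp

lemma W_power_expectation:
  assumes "a < N" "b < N" "m \<ge> 2"
  shows "\<bar>expectation (\<lambda>\<omega>. W \<omega> a b ^ m)\<bar> \<le> s"
proof -
  have "\<bar>expectation (\<lambda>\<omega>. W \<omega> a b ^ m)\<bar> \<le> expectation (\<lambda>\<omega>. \<bar>W \<omega> a b ^ m\<bar>)"
    using integral_norm_bound[of M "\<lambda>\<omega>. W \<omega> a b ^ m"] by simp
  also have "\<dots> \<le> expectation (\<lambda>\<omega>. (W \<omega> a b)\<^sup>2)"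
  proof (intro integral_mono_AE integrable_abs W_power_integrable assms)
    show "AE \<omega> in M. \<bar>W \<omega> a b ^ m\<bar> \<le> (W \<omega> a b)\<^sup>2"
      using W_bdd[OF assms(1,2)]
    proof eventually_elim
      case (elim \<omega>)
      then have "\<bar>W \<omega> a b\<bar> ^ m \<le> \<bar>W \<omega> a b\<bar> ^ 2" using assms(3) by (intro power_decreasing) auto
      then show ?case by (simp add: power_abs)
    qed
  qed
  also have "\<dots> \<le> s" by (rule W_var[OF assms(1,2)])
  finally show ?thesis .
qed

text \<open>Independence factorises over distinct edges. An edge used once contributes its mean,
  which is 0; an edge used more often contributes at most \<open>s\<close>, since
  \<open>|W| \<le> 1\<close> reduces higher powers to the variance.\<close>

lemma expectation_prod_list:
  assumes es: "set es \<subseteq> {(i,j). i \<le> j \<and> j < N}"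
  shows "\<bar>expectation (\<lambda>\<omega>. prod_list (map (\<lambda>(i,j). W \<omega> i j) es))\<bar>
    \<le> (if \<forall>e\<in>set es. count_list es e \<ge> 2 then s ^ card (set es) else 0)"
proof -
  define Y where "Y = (\<lambda>(i,j) \<omega>. W \<omega> i j)"
  have "indep_vars (\<lambda>_. borel) Y (set es)"
    unfolding Y_def by (rule indep_vars_subset[OF indep es])
  then have ind: "indep_vars (\<lambda>_. borel) (\<lambda>e \<omega>. Y e \<omega> ^ count_list es e) (set es)"
    by (rule indep_vars_compose2) auto
  have int: "integrable M (\<lambda>\<omega>. Y e \<omega> ^ m)" if "e \<in> set es" for e m
    using that es W_power_integrable by (auto simp: Y_def split: prod.splits)
  have "expectation (\<lambda>\<omega>. prod_list (map (\<lambda>(i,j). W \<omega> i j) es))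
    = expectation (\<lambda>\<omega>. \<Prod>e\<in>set es. Y e \<omega> ^ count_list es e)"
    by (subst prod_list_count[of "set es"]) (auto simp: Y_def case_prod_unfold)
  also have "\<dots> = (\<Prod>e\<in>set es. expectation (\<lambda>\<omega>. Y e \<omega> ^ count_list es e))"
    by (rule indep_vars_lebesgue_integral[OF _ ind int]) auto
  finally have eq: "expectation (\<lambda>\<omega>. prod_list (map (\<lambda>(i,j). W \<omega> i j) es))
     = (\<Prod>e\<in>set es. expectation (\<lambda>\<omega>. Y e \<omega> ^ count_list es e))" .
  show ?thesis
  proof (cases "\<forall>e\<in>set es. count_list es e \<ge> 2")
    case True
    have "\<bar>\<Prod>e\<in>set es. expectation (\<lambda>\<omega>. Y e \<omega> ^ count_list es e)\<bar> \<le> (\<Prod>e\<in>set es. s)"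
      unfolding abs_prod
    proof (intro prod_mono conjI)
      fix e assume e: "e \<in> set es"
      then show "\<bar>expectation (\<lambda>\<omega>. Y e \<omega> ^ count_list es e)\<bar> \<le> s"
        using es True W_power_expectation[of "fst e" "snd e" "count_list es e"]
        by (auto simp: Y_def case_prod_unfold)
    qed auto
    then show ?thesis using True by (simp add: eq)
  next
    case False
    then obtain e where e: "e \<in> set es" "count_list es e < 2" by force
    moreover have "count_list es e \<noteq> 0" using e(1) by (simp add: count_list_0_iff)
    ultimately have "count_list es e = 1" by simp
    then have "expectation (\<lambda>\<omega>. Y e \<omega> ^ count_list es e) = 0"
      using e(1) es W_mean by (auto simp: Y_def case_prod_unfold)
    then have zero: "(\<Prod>e\<in>set es. expectation (\<lambda>\<omega>. Y e \<omega> ^ count_list es e)) = 0"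
      using e(1) by (intro prod_zero) auto
    show ?thesis unfolding eq zero using s by simp
  qed
qed

text \<open>A walk contributes only if it crosses every edge at least twice, so it has at most half as
  many edges as steps, and at most one vertex more than edges. Trading \<open>s\<close> per edge for \<open>1 / N\<close>
  per newly visited vertex leaves weights whose sum over all walks is computed step by step.\<close>

lemma expectation_wprod:
  assumes xs: "set xs \<subseteq> {..<N}"
  shows "\<bar>expectation (\<lambda>\<omega>. wprod (W \<omega>) xs)\<bar>
    \<le> (real N * s) ^ ((length xs - 1) div 2) * (1 / real N) ^ (card (set xs) - 1)"
proof -
  let ?es = "edges xs"
  have es: "set ?es \<subseteq> {(i,j). i \<le> j \<and> j < N}" using edges_vertices[of _ _ xs] xs by auto
  have "expectation (\<lambda>\<omega>. wprod (W \<omega>) xs) = expectation (\<lambda>\<omega>. prod_list (map (\<lambda>(i,j). W \<omega> i j) ?es))"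
    by (intro Bochner_Integration.integral_cong refl wprod_edges W_sym) (use xs in auto)
  then have le: "\<bar>expectation (\<lambda>\<omega>. wprod (W \<omega>) xs)\<bar>
    \<le> (if \<forall>e\<in>set ?es. count_list ?es e \<ge> 2 then s ^ card (set ?es) else 0)"
    using expectation_prod_list[OF es] by simp
  show ?thesis
  proof (cases "\<forall>e\<in>set ?es. count_list ?es e \<ge> 2")
    case True
    define d where "d = card (set xs) - 1"
    have d: "d \<le> card (set ?es)" using card_vertices_le[of xs] by (simp add: d_def)
    have "2 * card (set ?es) \<le> length xs - 1" using card_set_le_half[of ?es] True by (simp add: length_edges)
    then have d2: "d \<le> (length xs - 1) div 2" using d by linarith
    have "s ^ card (set ?es) \<le> s ^ d" using d s by (intro power_decreasing) auto
    also have "\<dots> = (real N * s) ^ d * (1 / real N) ^ d"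
      using N_pos by (simp add: power_mult_distrib power_divide)
    also have "\<dots> \<le> (real N * s) ^ ((length xs - 1) div 2) * (1 / real N) ^ d"
      using d2 s by (intro mult_right_mono power_increasing) auto
    finally show ?thesis using le True by (simp add: d_def)
  next
    case False
    then show ?thesis using le s by (intro order_trans[OF le]) auto
  qed
qed

lemma sum_expectation_wprod:
  "(\<Sum>xs\<in>walks N (Suc n). \<bar>expectation (\<lambda>\<omega>. wprod (W \<omega>) xs)\<bar>) \<le> real N * fact (Suc n) * (real N * s) ^ (n div 2)"
proof -
  have "(\<Sum>xs\<in>walks N (Suc n). \<bar>expectation (\<lambda>\<omega>. wprod (W \<omega>) xs)\<bar>)
    \<le> (\<Sum>xs\<in>walks N (Suc n). (real N * s) ^ (n div 2) * (1 / real N) ^ (card (set xs) - 1))"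
  proof (intro sum_mono)
    fix xs assume "xs \<in> walks N (Suc n)"
    then show "\<bar>expectation (\<lambda>\<omega>. wprod (W \<omega>) xs)\<bar> \<le> (real N * s) ^ (n div 2) * (1 / real N) ^ (card (set xs) - 1)"
      using expectation_wprod[of xs] by (simp add: walks_def)
  qed
  also have "\<dots> \<le> (real N * s) ^ (n div 2) * (real N * fact (Suc n))"
    unfolding sum_distrib_left[symmetric]
    using s by (intro mult_left_mono sum_walks_weight N_pos) auto
  finally show ?thesis by (simp add: mult_ac)
qed

lemma ip_mv_power_integrable: "integrable M (\<lambda>\<omega>. ip N e ((mv N (W \<omega>) ^^ n) f))"
  unfolding ip_mv_power_walks
  by (intro Bochner_Integration.integrable_sum integrable_mult_right wprod_integrable) (auto simp: walks_def)

text \<open>The endpoint factors \<open>K / sqrt N\<close> of two delocalised vectors cancel the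
  factor \<open>N\<close> for the choice of the starting vertex. The rounding in
  \<open>n div 2\<close> matters: the third moment is only of order \<open>N s\<close>, like the
  second.\<close>

lemma expectation_ip_mv_power:
  assumes e: "\<And>a. a < N \<Longrightarrow> \<bar>e a\<bar> \<le> K / sqrt N" and f: "\<And>a. a < N \<Longrightarrow> \<bar>f a\<bar> \<le> K / sqrt N"
  shows "\<bar>expectation (\<lambda>\<omega>. ip N e ((mv N (W \<omega>) ^^ n) f))\<bar> \<le> K\<^sup>2 * fact (Suc n) * (real N * s) ^ (n div 2)"
proof -
  have K: "K / sqrt N \<ge> 0" using e[of 0] N_pos by auto
  have "expectation (\<lambda>\<omega>. ip N e ((mv N (W \<omega>) ^^ n) f))
    = (\<Sum>xs\<in>walks N (Suc n). e (hd xs) * f (last xs) * expectation (\<lambda>\<omega>. wprod (W \<omega>) xs))"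
    unfolding ip_mv_power_walks
    by (subst Bochner_Integration.integral_sum) (auto intro!: integrable_mult_right wprod_integrable simp: walks_def)
  then have "\<bar>expectation (\<lambda>\<omega>. ip N e ((mv N (W \<omega>) ^^ n) f))\<bar>
    \<le> (\<Sum>xs\<in>walks N (Suc n). \<bar>e (hd xs) * f (last xs) * expectation (\<lambda>\<omega>. wprod (W \<omega>) xs)\<bar>)"
    by (simp add: sum_abs)
  also have "\<dots> \<le> (\<Sum>xs\<in>walks N (Suc n). (K / sqrt N) * (K / sqrt N) * \<bar>expectation (\<lambda>\<omega>. wprod (W \<omega>) xs)\<bar>)"
  proof (intro sum_mono)
    fix xs assume "xs \<in> walks N (Suc n)"
    then have "xs \<noteq> []" "set xs \<subseteq> {..<N}" by (auto simp: walks_def)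
    then have "hd xs < N" "last xs < N" using hd_in_set last_in_set by blast+
    then show "\<bar>e (hd xs) * f (last xs) * expectation (\<lambda>\<omega>. wprod (W \<omega>) xs)\<bar>
       \<le> (K / sqrt N) * (K / sqrt N) * \<bar>expectation (\<lambda>\<omega>. wprod (W \<omega>) xs)\<bar>"
      unfolding abs_mult using e f K by (intro mult_right_mono mult_mono) auto
  qed
  also have "\<dots> = (K\<^sup>2 / real N) * (\<Sum>xs\<in>walks N (Suc n). \<bar>expectation (\<lambda>\<omega>. wprod (W \<omega>) xs)\<bar>)"
    by (simp add: sum_distrib_left power2_eq_square)
  also have "\<dots> \<le> (K\<^sup>2 / real N) * (real N * fact (Suc n) * (real N * s) ^ (n div 2))"
    by (intro mult_left_mono sum_expectation_wprod) auto
  also have "\<dots> = K\<^sup>2 * fact (Suc n) * (real N * s) ^ (n div 2)" using N_pos by simp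
  finally show ?thesis .
qed

lemma trace_power_integrable: "integrable M (\<lambda>\<omega>. trace_power N (W \<omega>) n)"
  unfolding trace_power_def by (intro Bochner_Integration.integrable_sum ip_mv_power_integrable)

lemma expectation_trace_power:
  "expectation (\<lambda>\<omega>. trace_power N (W \<omega>) n) \<le> real N * fact (Suc n) * (real N * s) ^ (n div 2)"
proof -
  define d where "d a = (\<lambda>b. of_bool (b = a) :: real)" for a :: nat
  have "expectation (\<lambda>\<omega>. trace_power N (W \<omega>) n) = (\<Sum>a<N. expectation (\<lambda>\<omega>. ip N (d a) ((mv N (W \<omega>) ^^ n) (d a))))"
    unfolding trace_power_def d_def by (intro Bochner_Integration.integral_sum ip_mv_power_integrable)
  also have "\<dots> = (\<Sum>a<N. \<Sum>xs\<in>walks N (Suc n). d a (hd xs) * d a (last xs) * expectation (\<lambda>\<omega>. wprod (W \<omega>) xs))"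
    unfolding ip_mv_power_walks
    by (subst Bochner_Integration.integral_sum) (auto intro!: integrable_mult_right wprod_integrable simp: walks_def)
  \<comment> \<open>The inner sum is the indicator of a closed walk. Bounding it by 1 admits all
    walks, so the factor \<open>N\<close> for the starting vertex stays.\<close>
  also have "\<dots> = (\<Sum>xs\<in>walks N (Suc n). (\<Sum>a<N. d a (hd xs) * d a (last xs)) * expectation (\<lambda>\<omega>. wprod (W \<omega>) xs))"
    by (subst sum.swap) (simp add: sum_distrib_right)
  also have "\<dots> \<le> (\<Sum>xs\<in>walks N (Suc n). \<bar>expectation (\<lambda>\<omega>. wprod (W \<omega>) xs)\<bar>)"
  proof (intro sum_mono)
    fix xs :: "nat list"
    have "(\<Sum>a<N. d a (hd xs) * d a (last xs)) \<le> (\<Sum>a<N. if a = hd xs then 1 else 0)"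
      by (intro sum_mono) (auto simp: d_def)
    also have "\<dots> \<le> 1" by simp
    finally have "(\<Sum>a<N. d a (hd xs) * d a (last xs)) \<le> 1" .
    moreover have 0: "0 \<le> (\<Sum>a<N. d a (hd xs) * d a (last xs))" by (intro sum_nonneg) (auto simp: d_def)
    ultimately have "(\<Sum>a<N. d a (hd xs) * d a (last xs)) * \<bar>expectation (\<lambda>\<omega>. wprod (W \<omega>) xs)\<bar>
      \<le> 1 * \<bar>expectation (\<lambda>\<omega>. wprod (W \<omega>) xs)\<bar>"
      by (intro mult_right_mono) auto
    moreover have "(\<Sum>a<N. d a (hd xs) * d a (last xs)) * expectation (\<lambda>\<omega>. wprod (W \<omega>) xs)
      \<le> (\<Sum>a<N. d a (hd xs) * d a (last xs)) * \<bar>expectation (\<lambda>\<omega>. wprod (W \<omega>) xs)\<bar>"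
      using 0 by (intro mult_left_mono) auto
    ultimately show "(\<Sum>a<N. d a (hd xs) * d a (last xs)) * expectation (\<lambda>\<omega>. wprod (W \<omega>) xs)
      \<le> \<bar>expectation (\<lambda>\<omega>. wprod (W \<omega>) xs)\<bar>"
      by linarith
  qed
  also have "\<dots> \<le> real N * fact (Suc n) * (real N * s) ^ (n div 2)" by (rule sum_expectation_wprod)
  finally show ?thesis .
qed

lemma expectation_ip_mv: "expectation (\<lambda>\<omega>. ip N e (mv N (W \<omega>) f)) = 0"
proof -
  have "expectation (\<lambda>\<omega>. ip N e (mv N (W \<omega>) f)) = expectation (\<lambda>\<omega>. \<Sum>a<N. \<Sum>b<N. e a * f b * W \<omega> a b)"
    by (simp add: ip_def mv_def sum_distrib_left mult_ac)
  also have "\<dots> = (\<Sum>a<N. expectation (\<lambda>\<omega>. \<Sum>b<N. e a * f b * W \<omega> a b))"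
    by (intro Bochner_Integration.integral_sum Bochner_Integration.integrable_sum integrable_mult_right W_integrable) auto
  also have "\<dots> = (\<Sum>a<N. \<Sum>b<N. expectation (\<lambda>\<omega>. e a * f b * W \<omega> a b))"
    by (intro sum.cong refl Bochner_Integration.integral_sum integrable_mult_right W_integrable) auto
  finally show ?thesis by (simp add: W_mean)
qed

lemma ip_mv_square_expand:
  "(ip N e (mv N S f))\<^sup>2 = (\<Sum>a<N. \<Sum>b<N. \<Sum>c<N. \<Sum>d<N. e a * f b * e c * f d * (S a b * S c d))"
proof -
  have "ip N e (mv N S f) = (\<Sum>a<N. \<Sum>b<N. e a * f b * S a b)"
    by (simp add: ip_def mv_def sum_distrib_left mult_ac)
  then have "(ip N e (mv N S f))\<^sup>2 =
    (\<Sum>a<N. \<Sum>b<N. e a * f b * S a b * (\<Sum>c<N. \<Sum>d<N. e c * f d * S c d))"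
    by (simp only: power2_eq_square sum_distrib_right)
  then show ?thesis by (simp only: sum_distrib_left mult_ac)
qed

lemma W_pair_integrable:
  assumes "a < N" "b < N" "c < N" "d < N"
  shows "integrable M (\<lambda>\<omega>. W \<omega> a b * W \<omega> c d)"
proof (rule integrable_const_bound[where B = 1])
  show "AE \<omega> in M. norm (W \<omega> a b * W \<omega> c d) \<le> 1"
    using W_bdd[OF assms(1,2)] W_bdd[OF assms(3,4)]
    by eventually_elim (auto simp: abs_mult intro!: mult_le_one)
qed (intro borel_measurable_times W_measurable assms)

lemma ip_mv_square_integrable: "integrable M (\<lambda>\<omega>. (ip N e (mv N (W \<omega>) f))\<^sup>2)"
  unfolding ip_mv_square_expand
  by (intro Bochner_Integration.integrable_sum integrable_mult_right W_pair_integrable) auto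

lemma W_pair_expectation:
  assumes "a < N" "b < N" "c < N" "d < N"
  shows "\<bar>expectation (\<lambda>\<omega>. W \<omega> a b * W \<omega> c d)\<bar> \<le> s * (of_bool (c = a \<and> d = b) + of_bool (c = b \<and> d = a))"
proof -
  define p r where "p = (min a b, max a b)" and "r = (min c d, max c d)"
  have "expectation (\<lambda>\<omega>. W \<omega> a b * W \<omega> c d) = expectation (\<lambda>\<omega>. prod_list (map (\<lambda>(i,j). W \<omega> i j) [p, r]))"
    using assms W_sym unfolding p_def r_def
    by (intro Bochner_Integration.integral_cong refl) (auto simp: min_def max_def)
  moreover have "set [p, r] \<subseteq> {(i,j). i \<le> j \<and> j < N}"
    using assms by (auto simp: p_def r_def min_def max_def)
  ultimately have le: "\<bar>expectation (\<lambda>\<omega>. W \<omega> a b * W \<omega> c d)\<bar>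
    \<le> (if \<forall>e\<in>set [p, r]. count_list [p, r] e \<ge> 2 then s ^ card (set [p, r]) else 0)"
    using expectation_prod_list[of "[p, r]"] by presburger
  show ?thesis
  proof (cases "(c = a \<and> d = b) \<or> (c = b \<and> d = a)")
    case True
    then have "r = p" by (auto simp: p_def r_def min_def max_def)
    then have "\<bar>expectation (\<lambda>\<omega>. W \<omega> a b * W \<omega> c d)\<bar> \<le> s" using le by simp
    moreover have ge: "1 \<le> of_bool (c = a \<and> d = b) + (of_bool (c = b \<and> d = a) :: real)" using True by auto
    ultimately show ?thesis using mult_left_mono[OF ge s(1)] by linarith
  next
    case False
    then have "r \<noteq> p" by (auto simp: p_def r_def min_def max_def split: if_splits)
    then have "count_list [p, r] p = 1" by simp
    then have nle: "\<not> (\<forall>e\<in>set [p, r]. count_list [p, r] e \<ge> 2)" by (intro notI) (drule bspec[of _ _ p], auto)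
    have "\<bar>expectation (\<lambda>\<omega>. W \<omega> a b * W \<omega> c d)\<bar> \<le> 0" using le by (simp only: if_not_P[OF nle])
    moreover have "0 \<le> s * (of_bool (c = a \<and> d = b) + of_bool (c = b \<and> d = a))"
      using s(1) by (intro mult_nonneg_nonneg) auto
    ultimately show ?thesis by (rule order_trans)
  qed
qed

text \<open>This square is not a sum over single walks and is expanded directly. Two entries
  correlate only if they agree up to transposition, so of the \<open>N^4\<close> quadruples about
  \<open>2 N^2\<close> survive, each of size at most \<open>K^4 s / N^2\<close>. Thus
  \<open>e' W f\<close> is of order 1 in mean square, although the norm of \<open>W f\<close> may
  grow with \<open>N s\<close>.\<close>

lemma expectation_ip_mv_square:
  assumes e: "\<And>a. a < N \<Longrightarrow> \<bar>e a\<bar> \<le> K / sqrt N" and f: "\<And>a. a < N \<Longrightarrow> \<bar>f a\<bar> \<le> K / sqrt N"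
  shows "expectation (\<lambda>\<omega>. (ip N e (mv N (W \<omega>) f))\<^sup>2) \<le> 2 * K ^ 4"
proof -
  define k where "k = K / sqrt N"
  have k: "k \<ge> 0" using e[of 0] N_pos by (auto simp: k_def)
  have ek: "\<bar>e a\<bar> \<le> k" and fk: "\<bar>f a\<bar> \<le> k" if "a < N" for a using e f that by (auto simp: k_def)
  define G where "G a b c d \<omega> = e a * f b * e c * f d * (W \<omega> a b * W \<omega> c d)" for a b c d \<omega>
  have G: "integrable M (G a b c d)" if "a \<in> {..<N}" "b \<in> {..<N}" "c \<in> {..<N}" "d \<in> {..<N}" for a b c d
    unfolding G_def using that by (intro integrable_mult_right W_pair_integrable) auto
  have "expectation (\<lambda>\<omega>. (ip N e (mv N (W \<omega>) f))\<^sup>2)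
    = expectation (\<lambda>\<omega>. \<Sum>a<N. \<Sum>b<N. \<Sum>c<N. \<Sum>d<N. G a b c d \<omega>)"
    unfolding ip_mv_square_expand G_def ..
  also have "\<dots> = (\<Sum>a<N. expectation (\<lambda>\<omega>. \<Sum>b<N. \<Sum>c<N. \<Sum>d<N. G a b c d \<omega>))"
    by (intro Bochner_Integration.integral_sum Bochner_Integration.integrable_sum G)
  also have "\<dots> = (\<Sum>a<N. \<Sum>b<N. expectation (\<lambda>\<omega>. \<Sum>c<N. \<Sum>d<N. G a b c d \<omega>))"
    by (intro sum.cong refl Bochner_Integration.integral_sum Bochner_Integration.integrable_sum G)
  also have "\<dots> = (\<Sum>a<N. \<Sum>b<N. \<Sum>c<N. expectation (\<lambda>\<omega>. \<Sum>d<N. G a b c d \<omega>))"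
    by (intro sum.cong refl Bochner_Integration.integral_sum Bochner_Integration.integrable_sum G)
  also have "\<dots> = (\<Sum>a<N. \<Sum>b<N. \<Sum>c<N. \<Sum>d<N. expectation (G a b c d))"
    by (intro sum.cong refl Bochner_Integration.integral_sum G)
  also have "\<dots> = (\<Sum>a<N. \<Sum>b<N. \<Sum>c<N. \<Sum>d<N. e a * f b * e c * f d * expectation (\<lambda>\<omega>. W \<omega> a b * W \<omega> c d))"
    unfolding G_def by simp
  also have "\<dots> \<le> (\<Sum>a<N. \<Sum>b<N. \<Sum>c<N. \<Sum>d<N. k ^ 4 * s * (of_bool (c = a \<and> d = b) + of_bool (c = b \<and> d = a)))"
  proof (intro sum_mono)
    fix a b c d assume "a \<in> {..<N}" "b \<in> {..<N}" "c \<in> {..<N}" "d \<in> {..<N}"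
    then have l: "a < N" "b < N" "c < N" "d < N" by auto
    have "\<bar>e a * f b * e c * f d * expectation (\<lambda>\<omega>. W \<omega> a b * W \<omega> c d)\<bar>
      \<le> k * k * k * k * (s * (of_bool (c = a \<and> d = b) + of_bool (c = b \<and> d = a)))"
      unfolding abs_mult using ek fk l k by (intro mult_mono W_pair_expectation) auto
    then show "e a * f b * e c * f d * expectation (\<lambda>\<omega>. W \<omega> a b * W \<omega> c d)
      \<le> k ^ 4 * s * (of_bool (c = a \<and> d = b) + of_bool (c = b \<and> d = a))"
      by (simp add: eval_nat_numeral mult_ac)
  qed
  also have "\<dots> = (\<Sum>a<N. \<Sum>b<N. k ^ 4 * s * 2)"
  proof (intro sum.cong refl)
    fix a b assume ab: "a \<in> {..<N}" "b \<in> {..<N}"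
    have "(\<Sum>c<N. \<Sum>d<N. of_bool (c = x \<and> d = y)) = (1 :: real)" if "x < N" "y < N" for x y
    proof -
      have "(\<Sum>c<N. \<Sum>d<N. of_bool (c = x \<and> d = y)) = (\<Sum>c<N. \<Sum>d<N. if d = y then (if c = x then 1 else 0) else (0::real))"
        by (intro sum.cong) auto
      then show ?thesis using that by simp
    qed
    then show "(\<Sum>c<N. \<Sum>d<N. k ^ 4 * s * (of_bool (c = a \<and> d = b) + of_bool (c = b \<and> d = a))) = k ^ 4 * s * 2"
      using ab by (simp add: sum_distrib_left[symmetric] sum.distrib)
  qed
  also have "\<dots> = 2 * s * K ^ 4"
    using N_pos by (simp add: k_def power_divide power4_eq_xxxx power2_eq_square real_sqrt_mult_self field_simps)
  also have "\<dots> \<le> 2 * K ^ 4" using s by (simp add: mult_left_le_one_le)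
  finally show ?thesis .
qed

end

section \<open>The approximate eigenvector\<close>

lemma square_diff_le: "(a - b)\<^sup>2 \<le> 2 * (a\<^sup>2 + b\<^sup>2)" for a b :: real
  using zero_le_square[of "a + b"] by (simp add: power2_eq_square algebra_simps)

lemma square_add_le: "(a + b)\<^sup>2 \<le> 2 * (a\<^sup>2 + b\<^sup>2)" for a b :: real
  using square_diff_le[of a "- b"] by simp

lemma ip_sum_self_le:
  assumes "finite L" and e: "\<And>l. l \<in> L \<Longrightarrow> ip n (e l) (e l) \<le> B"
  shows "ip n (\<lambda>a. \<Sum>l\<in>L. c l * e l a) (\<lambda>a. \<Sum>l\<in>L. c l * e l a) \<le> real (card L) * B * (\<Sum>l\<in>L. (c l)\<^sup>2)"
proof -
  have "ip n (\<lambda>a. \<Sum>l\<in>L. c l * e l a) (\<lambda>a. \<Sum>l\<in>L. c l * e l a) \<le> (\<Sum>a<n. (\<Sum>l\<in>L. (c l)\<^sup>2) * (\<Sum>l\<in>L. (e l a)\<^sup>2))"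
    unfolding ip_def power2_eq_square[symmetric] by (intro sum_mono Cauchy_Schwarz_ineq_sum)
  also have "\<dots> = (\<Sum>l\<in>L. (c l)\<^sup>2) * (\<Sum>l\<in>L. ip n (e l) (e l))"
    unfolding ip_def sum_distrib_left[symmetric] power2_eq_square by (subst sum.swap) (rule refl)
  also have "\<dots> \<le> (\<Sum>l\<in>L. (c l)\<^sup>2) * (\<Sum>l\<in>L. B)"
    by (intro mult_left_mono sum_mono e) (auto intro: sum_nonneg)
  finally show ?thesis by (simp add: mult_ac)
qed

text \<open>The trial vector is \<open>u = w + W w / \<mu>\<close>, where \<open>w\<close> is built from the eigenvector of \<open>B\<close> belonging
  to \<open>\<mu>\<close>; \<open>eigen\<close> restates that eigenvector equation, with \<open>\<sigma> l\<close> in the role of \<open>E (e\<^sub>l' W\<^sup>2 w)\<close>.\<close>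

locale trial_vector =
  fixes N k :: nat and \<theta> :: "nat \<Rightarrow> real" and e :: "nat \<Rightarrow> nat \<Rightarrow> real" and q :: real
    and w :: "nat \<Rightarrow> real" and \<mu> :: real and \<sigma> :: "nat \<Rightarrow> real" and t K \<Theta> \<alpha> :: real
  assumes eigen: "\<And>a. a < N \<Longrightarrow> \<mu> * w a = (\<Sum>l=1..k. q * \<theta> l * (ip N (e l) w + \<sigma> l / (t * q\<^sup>2)) * e l a)"
    and pos: "q > 0" "\<mu> > 0" "t > 0" and \<mu>: "q \<le> \<alpha> * \<mu>"
    and \<theta>_bound: "\<And>l. l \<in> {1..k} \<Longrightarrow> 0 \<le> \<theta> l \<and> \<theta> l \<le> \<Theta>"
    and e_norm: "\<And>l. l \<in> {1..k} \<Longrightarrow> ip N (e l) (e l) \<le> K\<^sup>2"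
    and w_norm: "ip N w w \<le> K\<^sup>2"
begin

definition trial :: "(nat \<Rightarrow> nat \<Rightarrow> real) \<Rightarrow> nat \<Rightarrow> real" where
  "trial V a = w a + mv N V w a / \<mu>"

text \<open>This is \<open>A u - \<mu> u\<close> after two cancellations: the terms
  \<open>W w\<close> drop out, and the eigenvector equation replaces \<open>P w - \<mu> w\<close> by
  the \<open>\<sigma>\<close> terms. In this form it mentions only \<open>V\<close>, whose moments
  are controlled.\<close>

definition residual :: "(nat \<Rightarrow> nat \<Rightarrow> real) \<Rightarrow> nat \<Rightarrow> real" where
  "residual V a = (\<Sum>l=1..k. q * \<theta> l * (ip N (e l) (mv N V w) / \<mu> - \<sigma> l / (t * q\<^sup>2)) * e l a)
     + (mv N V ^^ 2) w a / \<mu>"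

text \<open>The form \<open>u' (A - \<mu>) u\<close> as a polynomial in \<open>V\<close>. The
  constant term and \<open>w' V^2 w / \<mu>\<close> are both of order 1 and must cancel in mean; the
  linear terms are centred; the squares and the cubic term are of order \<open>1/q\<close> in
  mean.\<close>

definition rayleigh :: "(nat \<Rightarrow> nat \<Rightarrow> real) \<Rightarrow> real" where
  "rayleigh V = - (\<Sum>l=1..k. q * \<theta> l * \<sigma> l * ip N (e l) w) / (t * q\<^sup>2)
     + (\<Sum>l=1..k. q * \<theta> l * ip N (e l) w * ip N (e l) (mv N V w)) / \<mu>
     + ip N w ((mv N V ^^ 2) w) / \<mu>
     - (\<Sum>l=1..k. q * \<theta> l * \<sigma> l * ip N (e l) (mv N V w)) / (t * q\<^sup>2 * \<mu>)
     + (\<Sum>l=1..k. q * \<theta> l * (ip N (e l) (mv N V w))\<^sup>2) / \<mu>\<^sup>2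
     + ip N w ((mv N V ^^ 3) w) / \<mu>\<^sup>2"

text \<open>Bounds the squared norm of the residual: \<open>(x + y)^2 \<le> 2 x^2 + 2 y^2\<close> is
  used once for the sum of two vectors and once inside each coefficient, whence the 4, and
  \<open>q / \<mu> \<le> \<alpha>\<close> removes the ratio. Each summand has bounded mean.\<close>

definition residual_bound :: "(nat \<Rightarrow> nat \<Rightarrow> real) \<Rightarrow> real" where
  "residual_bound V = 4 * real k * K\<^sup>2 * \<Theta>\<^sup>2 * (\<Sum>l=1..k. \<alpha>\<^sup>2 * (ip N (e l) (mv N V w))\<^sup>2 + (\<sigma> l)\<^sup>2 / (t\<^sup>2 * q\<^sup>2))
     + 2 * \<alpha>\<^sup>2 * ip N w ((mv N V ^^ 4) w) / q\<^sup>2"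

lemma mv_finite_rank:
  assumes A: "\<And>a b. a < N \<Longrightarrow> b < N \<Longrightarrow> A a b = q * (\<Sum>l=1..k. \<theta> l * e l a * e l b) + V a b"
    and "a < N"
  shows "mv N A u a = (\<Sum>l=1..k. q * \<theta> l * ip N (e l) u * e l a) + mv N V u a"
proof -
  have "mv N A u a = (\<Sum>b<N. (\<Sum>l=1..k. q * \<theta> l * e l a * e l b * u b) + V a b * u b)"
    unfolding mv_def using assms(2)
    by (intro sum.cong refl) (simp add: A algebra_simps sum_distrib_left sum_distrib_right)
  also have "\<dots> = (\<Sum>l=1..k. q * \<theta> l * ip N (e l) u * e l a) + mv N V u a"
    unfolding sum.distrib mv_def ip_def
    by (subst sum.swap) (simp add: sum_distrib_left sum_distrib_right mult_ac)
  finally show ?thesis .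
qed

text \<open>\<open>2 / \<gamma>\<close> comes from the Rayleigh error over a gap
  \<open>\<gamma> q\<close>. The remaining terms pay for the replacement of \<open>u'u\<close> by
  \<open>w'w\<close>, where \<open>d\<close> is a lower bound of \<open>w'w\<close>.\<close>

definition error_bound :: "(nat \<Rightarrow> nat \<Rightarrow> real) \<Rightarrow> real \<Rightarrow> real \<Rightarrow> real" where
  "error_bound V \<gamma> d = (2 / \<gamma> + 2 / d) / q * residual_bound V + 4 * \<alpha>\<^sup>2 * (ip N w (mv N V w))\<^sup>2 / q
     + \<alpha> ^ 4 * K\<^sup>2 * ip N w ((mv N V ^^ 4) w) / q ^ 3"

lemma residual_eq:
  assumes A: "\<And>a b. a < N \<Longrightarrow> b < N \<Longrightarrow> A a b = q * (\<Sum>l=1..k. \<theta> l * e l a * e l b) + V a b"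
    and "a < N"
  shows "residual V a = mv N A (trial V) a - \<mu> * trial V a"
proof -
  have e_trial: "ip N (e l) (trial V) = ip N (e l) w + ip N (e l) (mv N V w) / \<mu>" for l
  proof -
    have "ip N (e l) (trial V) = ip N (e l) (\<lambda>a. w a + 1 / \<mu> * mv N V w a)"
      by (simp add: trial_def[abs_def])
    then show ?thesis by (simp only: ip_add_right ip_scale_right) simp
  qed
  have V_trial: "mv N V (trial V) a = mv N V w a + (mv N V ^^ 2) w a / \<mu>"
  proof -
    have "mv N V (trial V) a = mv N V (\<lambda>a. w a + 1 / \<mu> * mv N V w a) a"
      by (simp add: trial_def[abs_def])
    then show ?thesis by (simp only: mv_add mv_scale) (simp add: eval_nat_numeral)
  qed
  have "mv N A (trial V) a = (\<Sum>l=1..k. q * \<theta> l * ip N (e l) (trial V) * e l a) + mv N V (trial V) a"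
    by (rule mv_finite_rank[OF assms])
  then show ?thesis
    using eigen[OF assms(2)] pos
    unfolding residual_def V_trial e_trial
    by (simp add: trial_def algebra_simps sum.distrib sum_subtractf)
qed

lemma trial_norm:
  assumes sym: "\<And>a b. a < N \<Longrightarrow> b < N \<Longrightarrow> V a b = V b a"
  shows "ip N (trial V) (trial V) = ip N w w + (2 * ip N w (mv N V w) / \<mu> + ip N w ((mv N V ^^ 2) w) / \<mu>\<^sup>2)"
proof -
  have "trial V = (\<lambda>a. w a + 1 / \<mu> * mv N V w a)" by (simp add: trial_def[abs_def])
  then have "ip N (trial V) (trial V) = ip N w w + 2 / \<mu> * ip N w (mv N V w) + 1 / \<mu>\<^sup>2 * ip N (mv N V w) (mv N V w)"
    by (simp only: ip_add_right ip_add_left ip_scale_right ip_scale_left)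
       (simp add: ip_commute[of N "mv N V w" w] power2_eq_square algebra_simps)
  also have "ip N (mv N V w) (mv N V w) = ip N w ((mv N V ^^ 2) w)"
    by (simp add: ip_mv_symmetric[OF sym] eval_nat_numeral)
  finally show ?thesis by simp
qed

lemma rayleigh_eq:
  assumes sym: "\<And>a b. a < N \<Longrightarrow> b < N \<Longrightarrow> V a b = V b a"
  shows "ip N (trial V) (residual V) = rayleigh V"
proof -
  define c where "c l = q * \<theta> l * (ip N (e l) (mv N V w) / \<mu> - \<sigma> l / (t * q\<^sup>2))" for l
  have res: "residual V = (\<lambda>a. (\<Sum>l=1..k. c l * e l a) + 1 / \<mu> * (mv N V ^^ 2) w a)"
    by (simp add: residual_def[abs_def] c_def)
  have tr: "trial V = (\<lambda>a. w a + 1 / \<mu> * mv N V w a)" by (simp add: trial_def[abs_def])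
  have X3: "ip N (mv N V w) ((mv N V ^^ 2) w) = ip N w ((mv N V ^^ 3) w)"
    by (simp add: ip_mv_symmetric[OF sym] eval_nat_numeral)
  have "ip N (trial V) (residual V) = (\<Sum>l=1..k. c l * ip N (e l) w) + ip N w ((mv N V ^^ 2) w) / \<mu>
     + (\<Sum>l=1..k. c l * ip N (e l) (mv N V w)) / \<mu> + ip N w ((mv N V ^^ 3) w) / \<mu>\<^sup>2"
    unfolding res tr
    by (simp only: ip_add_right ip_add_left ip_scale_right ip_scale_left ip_sum_right X3)
       (simp add: ip_commute[of N w "e _"] ip_commute[of N "mv N V w" "e _"] power2_eq_square algebra_simps)
  also have "(\<Sum>l=1..k. c l * ip N (e l) w) = - (\<Sum>l=1..k. q * \<theta> l * \<sigma> l * ip N (e l) w) / (t * q\<^sup>2)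
     + (\<Sum>l=1..k. q * \<theta> l * ip N (e l) w * ip N (e l) (mv N V w)) / \<mu>"
    unfolding c_def sum_negf[symmetric] sum_divide_distrib sum.distrib[symmetric]
    by (intro sum.cong refl) (simp add: algebra_simps)
  also have "(\<Sum>l=1..k. c l * ip N (e l) (mv N V w)) / \<mu> = - (\<Sum>l=1..k. q * \<theta> l * \<sigma> l * ip N (e l) (mv N V w)) / (t * q\<^sup>2 * \<mu>)
     + (\<Sum>l=1..k. q * \<theta> l * (ip N (e l) (mv N V w))\<^sup>2) / \<mu>\<^sup>2"
    unfolding c_def sum_negf[symmetric] sum_divide_distrib sum.distrib[symmetric]
    using pos by (intro sum.cong refl) (simp add: field_simps power2_eq_square)
  finally show ?thesis by (simp add: rayleigh_def algebra_simps)
qed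

lemma residual_norm:
  assumes sym: "\<And>a b. a < N \<Longrightarrow> b < N \<Longrightarrow> V a b = V b a"
  shows "ip N (residual V) (residual V) \<le> residual_bound V"
proof -
  define x where "x l = ip N (e l) (mv N V w)" for l
  define c where "c l = q * \<theta> l * (x l / \<mu> - \<sigma> l / (t * q\<^sup>2))" for l
  define y where "y = (\<lambda>a. \<Sum>l=1..k. c l * e l a)"
  define z where "z = (\<lambda>a. (mv N V ^^ 2) w a / \<mu>)"
  have q\<mu>: "q\<^sup>2 / \<mu>\<^sup>2 \<le> \<alpha>\<^sup>2"
  proof -
    have "q\<^sup>2 \<le> (\<alpha> * \<mu>)\<^sup>2" using \<mu> pos by (intro power_mono) auto
    then show ?thesis using pos by (simp add: power_mult_distrib divide_le_eq)
  qed
  have c2: "(c l)\<^sup>2 \<le> 2 * \<Theta>\<^sup>2 * (\<alpha>\<^sup>2 * (x l)\<^sup>2 + (\<sigma> l)\<^sup>2 / (t\<^sup>2 * q\<^sup>2))" if "l \<in> {1..k}" for l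
  proof -
    have "(x l / \<mu> - \<sigma> l / (t * q\<^sup>2))\<^sup>2 \<le> 2 * ((x l / \<mu>)\<^sup>2 + (\<sigma> l / (t * q\<^sup>2))\<^sup>2)"
      by (rule square_diff_le)
    then have "q\<^sup>2 * (x l / \<mu> - \<sigma> l / (t * q\<^sup>2))\<^sup>2 \<le> q\<^sup>2 * (2 * ((x l / \<mu>)\<^sup>2 + (\<sigma> l / (t * q\<^sup>2))\<^sup>2))"
      by (intro mult_left_mono) auto
    also have "\<dots> = 2 * (q\<^sup>2 / \<mu>\<^sup>2 * (x l)\<^sup>2 + (\<sigma> l)\<^sup>2 / (t\<^sup>2 * q\<^sup>2))"
      using pos by (simp add: power_divide power_mult_distrib field_simps power2_eq_square)
    also have "\<dots> \<le> 2 * (\<alpha>\<^sup>2 * (x l)\<^sup>2 + (\<sigma> l)\<^sup>2 / (t\<^sup>2 * q\<^sup>2))"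
      using q\<mu> by (intro mult_left_mono add_right_mono mult_right_mono) auto
    finally have le: "q\<^sup>2 * (x l / \<mu> - \<sigma> l / (t * q\<^sup>2))\<^sup>2 \<le> 2 * (\<alpha>\<^sup>2 * (x l)\<^sup>2 + (\<sigma> l)\<^sup>2 / (t\<^sup>2 * q\<^sup>2))" .
    have "(c l)\<^sup>2 = (\<theta> l)\<^sup>2 * (q\<^sup>2 * (x l / \<mu> - \<sigma> l / (t * q\<^sup>2))\<^sup>2)"
      by (simp add: c_def power_mult_distrib mult_ac)
    also have "\<dots> \<le> \<Theta>\<^sup>2 * (2 * (\<alpha>\<^sup>2 * (x l)\<^sup>2 + (\<sigma> l)\<^sup>2 / (t\<^sup>2 * q\<^sup>2)))"
      using \<theta>_bound[OF that] by (intro mult_mono[OF power_mono le]) auto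
    finally show ?thesis by (simp only: mult_ac)
  qed
  have yy: "ip N y y \<le> real k * K\<^sup>2 * (2 * \<Theta>\<^sup>2 * (\<Sum>l=1..k. \<alpha>\<^sup>2 * (x l)\<^sup>2 + (\<sigma> l)\<^sup>2 / (t\<^sup>2 * q\<^sup>2)))"
  proof -
    have "ip N y y \<le> real (card {1..k}) * K\<^sup>2 * (\<Sum>l=1..k. (c l)\<^sup>2)"
      unfolding y_def by (rule ip_sum_self_le) (auto intro: e_norm)
    also have "\<dots> \<le> real k * K\<^sup>2 * (2 * \<Theta>\<^sup>2 * (\<Sum>l=1..k. \<alpha>\<^sup>2 * (x l)\<^sup>2 + (\<sigma> l)\<^sup>2 / (t\<^sup>2 * q\<^sup>2)))"
      unfolding sum_distrib_left[of "2 * \<Theta>\<^sup>2"]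
      by (intro mult_mono sum_mono c2) (auto intro: sum_nonneg)
    finally show ?thesis .
  qed
  have zz: "ip N z z \<le> \<alpha>\<^sup>2 * ip N w ((mv N V ^^ 4) w) / q\<^sup>2"
  proof -
    have "ip N ((mv N V ^^ 2) w) ((mv N V ^^ 2) w) = ip N w ((mv N V ^^ 4) w)"
      by (simp add: ip_mv_symmetric[OF sym] eval_nat_numeral)
    then have "ip N z z = (q\<^sup>2 / \<mu>\<^sup>2) * (ip N w ((mv N V ^^ 4) w) / q\<^sup>2)"
      using ip_scale_left[of N "1/\<mu>" "(mv N V ^^ 2) w" "\<lambda>a. (1/\<mu>) * (mv N V ^^ 2) w a"]
        ip_scale_right[of N "(mv N V ^^ 2) w" "1/\<mu>" "(mv N V ^^ 2) w"] pos
      by (simp add: z_def power2_eq_square)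
    also have "\<dots> \<le> \<alpha>\<^sup>2 * (ip N w ((mv N V ^^ 4) w) / q\<^sup>2)"
      using q\<mu> \<open>ip N ((mv N V ^^ 2) w) ((mv N V ^^ 2) w) = _\<close>[symmetric] ip_self_nonneg[of N "(mv N V ^^ 2) w"]
      by (intro mult_right_mono) auto
    finally show ?thesis by simp
  qed
  have "ip N (residual V) (residual V) = (\<Sum>a<N. (y a + z a)\<^sup>2)"
    by (simp add: ip_def residual_def y_def z_def c_def x_def power2_eq_square)
  also have "\<dots> \<le> (\<Sum>a<N. 2 * ((y a)\<^sup>2 + (z a)\<^sup>2))" by (intro sum_mono square_add_le)
  also have "\<dots> = 2 * ip N y y + 2 * ip N z z"
    by (simp add: ip_def sum.distrib sum_distrib_left power2_eq_square)
  also have "\<dots> \<le> residual_bound V"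
    using yy zz unfolding residual_bound_def x_def by (simp add: mult_ac)
  finally show ?thesis .
qed

text \<open>\<open>spectral_residual\<close> controls \<open>\<tau> u'u\<close> with the random
  factor \<open>u'u\<close>. Passing to \<open>w'w\<close> leaves \<open>\<tau> \<delta>\<close>
  with \<open>\<delta> = u'u - w'w\<close>; here \<open>\<tau>\<close> is of the order of the
  residual and \<open>\<delta>\<close> of order \<open>1/q\<close> in mean square, so their product
  is again of order \<open>1/q\<close>.\<close>

lemma eigenvalue_error:
  assumes sym: "\<And>a b. a < N \<Longrightarrow> b < N \<Longrightarrow> V a b = V b a"
    and A: "\<And>a b. a < N \<Longrightarrow> b < N \<Longrightarrow> A a b = q * (\<Sum>l=1..k. \<theta> l * e l a * e l b) + V a b"
    and sp: "spectral N A \<Lambda> v" and i: "i < N" and \<gamma>: "\<gamma> > 0"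
    and near: "\<bar>\<Lambda> i - \<mu>\<bar> \<le> \<gamma> * q" and far: "\<And>j. j < N \<Longrightarrow> j \<noteq> i \<Longrightarrow> \<gamma> * q \<le> \<bar>\<Lambda> j - \<mu>\<bar>"
    and small: "ip N (mv N V w) (mv N V w) \<le> \<mu>\<^sup>2 / 4 * ip N w w" and d: "0 < d" "d \<le> ip N w w"
  shows "\<bar>(\<Lambda> i - \<mu>) * ip N w w - rayleigh V\<bar> \<le>
    error_bound V \<gamma> d"
proof -
  define \<tau> where "\<tau> = \<Lambda> i - \<mu>"
  define Z where "Z = ip N (residual V) (residual V)"
  define D where "D = ip N (trial V) (trial V)"
  define d0 where "d0 = ip N w w"
  define X1 where "X1 = ip N w (mv N V w)"
  define X2 where "X2 = ip N w ((mv N V ^^ 2) w)"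
  define X4 where "X4 = ip N w ((mv N V ^^ 4) w)"
  have d0: "d0 > 0" using d by (simp add: d0_def)
  have h: "\<gamma> * q > 0" using \<gamma> pos by simp
  note r = spectral_residual[OF sp i h near far residual_eq[OF A]]
  have r1: "\<bar>\<tau> * D - rayleigh V\<bar> \<le> 2 * Z / (\<gamma> * q)"
    using r(1) by (simp add: rayleigh_eq[OF sym] \<tau>_def D_def Z_def)
  have r2: "\<tau>\<^sup>2 * D \<le> Z" using r(2) by (simp add: \<tau>_def D_def Z_def)
  have X2: "ip N (mv N V w) (mv N V w) = X2"
    by (simp add: X2_def ip_mv_symmetric[OF sym] eval_nat_numeral)
  have X2_0: "X2 \<ge> 0" using ip_self_nonneg[of N "mv N V w"] X2 by simp
  have X4: "ip N ((mv N V ^^ 2) w) ((mv N V ^^ 2) w) = X4"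
    by (simp add: X4_def ip_mv_symmetric[OF sym] eval_nat_numeral)
  have X4_0: "X4 \<ge> 0" using ip_self_nonneg[of N "(mv N V ^^ 2) w"] X4 by simp
  have Dd: "D = d0 + (2 * X1 / \<mu> + X2 / \<mu>\<^sup>2)"
    using trial_norm[OF sym] by (simp add: D_def d0_def X1_def X2_def)
  \<comment> \<open>\<open>small\<close> says that \<open>W w / \<mu>\<close> has at most half the
    norm of \<open>w\<close>, so \<open>u\<close> keeps at least half of it.\<close>
  have D4: "D \<ge> d0 / 4"
  proof -
    have "X1\<^sup>2 \<le> d0 * X2" using ip_Cauchy_Schwarz[of N w "mv N V w"] by (simp add: X1_def X2 d0_def)
    define g where "g = X1 / \<mu>"
    define b where "b = X2 / \<mu>\<^sup>2"
    have b: "0 \<le> b" "b \<le> d0 / 4" using small pos X2_0 by (auto simp: b_def X2 d0_def field_simps)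
    have "g\<^sup>2 \<le> d0 * b" using \<open>X1\<^sup>2 \<le> d0 * X2\<close> pos by (simp add: g_def b_def power_divide divide_right_mono)
    have "4 * \<bar>g\<bar> \<le> d0 + 4 * b"
    proof (rule power2_le_imp_le)
      have "(4 * \<bar>g\<bar>)\<^sup>2 = 16 * g\<^sup>2" by (simp add: power_mult_distrib)
      also have "\<dots> \<le> 16 * (d0 * b)" using \<open>g\<^sup>2 \<le> d0 * b\<close> by simp
      also have "\<dots> \<le> (d0 + 4 * b)\<^sup>2"
        using zero_le_square[of "d0 - 4 * b"] by (simp add: power2_eq_square algebra_simps)
      finally show "(4 * \<bar>g\<bar>)\<^sup>2 \<le> (d0 + 4 * b)\<^sup>2" .
    qed (use b d0 in auto)
    then have "D \<ge> d0 / 2 - b" unfolding Dd g_def[symmetric] b_def[symmetric] times_divide_eq_right[symmetric]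
      by (simp add: g_def[symmetric] abs_le_iff)
    then show ?thesis using b by argo
  qed
  have Z0: "Z \<ge> 0" by (simp add: Z_def ip_self_nonneg)
  have \<tau>2: "\<tau>\<^sup>2 \<le> 4 * Z / d"
  proof -
    have "\<tau>\<^sup>2 * (d / 4) \<le> \<tau>\<^sup>2 * D" using D4 d by (intro mult_left_mono) (auto simp: d0_def)
    then have "\<tau>\<^sup>2 * d \<le> 4 * Z" using r2 by (simp add: algebra_simps)
    then show ?thesis using d by (simp add: pos_le_divide_eq)
  qed
  define \<delta> where "\<delta> = D - d0"
  have \<delta>2: "q * \<delta>\<^sup>2 / 2 \<le> 4 * \<alpha>\<^sup>2 * X1\<^sup>2 / q + \<alpha> ^ 4 * K\<^sup>2 * X4 / q ^ 3"
  proof -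
    have inv: "1 / \<mu> \<le> \<alpha> / q" using \<mu> pos by (simp add: field_simps)
    have inv2: "1 / \<mu>\<^sup>2 \<le> \<alpha>\<^sup>2 / q\<^sup>2"
      using power_mono[OF inv, of 2] pos by (simp add: power_divide)
    have inv4: "1 / \<mu> ^ 4 \<le> \<alpha> ^ 4 / q ^ 4"
      using power_mono[OF inv, of 4] pos by (simp add: power_divide)
    have "X2\<^sup>2 \<le> d0 * X4" using ip_Cauchy_Schwarz[of N w "(mv N V ^^ 2) w"] by (simp only: X2_def X4 d0_def)
    also have "\<dots> \<le> K\<^sup>2 * X4" using w_norm X4_0 by (intro mult_right_mono) (auto simp: d0_def)
    finally have X24: "X2\<^sup>2 \<le> K\<^sup>2 * X4" .
    have "\<delta>\<^sup>2 \<le> 2 * ((2 * X1 / \<mu>)\<^sup>2 + (X2 / \<mu>\<^sup>2)\<^sup>2)"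
      unfolding \<delta>_def Dd using square_add_le[of "2 * X1 / \<mu>" "X2 / \<mu>\<^sup>2"] by simp
    also have "\<dots> = 8 * X1\<^sup>2 * (1 / \<mu>\<^sup>2) + 2 * X2\<^sup>2 * (1 / \<mu> ^ 4)"
      by (simp add: power_divide power_mult_distrib flip: power_mult)
    also have "\<dots> \<le> 8 * X1\<^sup>2 * (\<alpha>\<^sup>2 / q\<^sup>2) + 2 * (K\<^sup>2 * X4) * (\<alpha> ^ 4 / q ^ 4)"
      using inv2 inv4 X24 X4_0 by (intro add_mono mult_mono) auto
    finally have "q / 2 * \<delta>\<^sup>2 \<le> q / 2 * (8 * X1\<^sup>2 * (\<alpha>\<^sup>2 / q\<^sup>2) + 2 * (K\<^sup>2 * X4) * (\<alpha> ^ 4 / q ^ 4))"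
      using pos by (intro mult_left_mono) auto
    also have "\<dots> = 4 * \<alpha>\<^sup>2 * X1\<^sup>2 / q + \<alpha> ^ 4 * K\<^sup>2 * X4 / q ^ 3"
      using pos by (simp add: field_simps eval_nat_numeral)
    finally show ?thesis by simp
  qed
  \<comment> \<open>AM-GM with weight \<open>q\<close>, chosen so that both squares end up of order
    \<open>1/q\<close>.\<close>
  have "\<bar>\<tau> * \<delta>\<bar> \<le> \<tau>\<^sup>2 / (2 * q) + q * \<delta>\<^sup>2 / 2"
  proof -
    have "2 * q * \<bar>\<tau> * \<delta>\<bar> \<le> \<tau>\<^sup>2 + q\<^sup>2 * \<delta>\<^sup>2"
      using zero_le_square[of "\<bar>\<tau>\<bar> - q * \<bar>\<delta>\<bar>"] pos
      by (simp add: power2_eq_square algebra_simps abs_mult)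
    then show ?thesis using pos by (simp add: field_simps power2_eq_square)
  qed
  also have "\<dots> \<le> 4 * Z / d / (2 * q) + q * \<delta>\<^sup>2 / 2"
    using \<tau>2 pos by (intro add_right_mono divide_right_mono) auto
  finally have 1: "\<bar>\<tau> * \<delta>\<bar> \<le> 2 * Z / (d * q) + q * \<delta>\<^sup>2 / 2" using pos d by (simp add: field_simps)
  have "\<tau> * d0 - rayleigh V = (\<tau> * D - rayleigh V) - \<tau> * \<delta>" by (simp add: \<delta>_def algebra_simps)
  then have "\<bar>\<tau> * d0 - rayleigh V\<bar> \<le> 2 * Z / (\<gamma> * q) + (2 * Z / (d * q) + q * \<delta>\<^sup>2 / 2)"
    using r1 1 by linarith
  also have "\<dots> = (2 / \<gamma> + 2 / d) / q * Z + q * \<delta>\<^sup>2 / 2"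
    using pos \<gamma> d by (simp add: field_simps)
  also have "\<dots> \<le> (2 / \<gamma> + 2 / d) / q * residual_bound V + (4 * \<alpha>\<^sup>2 * X1\<^sup>2 / q + \<alpha> ^ 4 * K\<^sup>2 * X4 / q ^ 3)"
    using \<delta>2 residual_norm[OF sym] pos \<gamma> d unfolding Z_def
    by (intro add_mono mult_left_mono) auto
  finally show ?thesis by (simp add: \<tau>_def d0_def X1_def X4_def error_bound_def)
qed

end

text \<open>\<open>C\<close> relates the variance scale \<open>N s\<close> to \<open>q\<close>, so
  every moment becomes a power of \<open>q\<close>. \<open>\<beta>\<close> measures how far the
  weight \<open>1 / (t q^2)\<close> built into the vector equation is from
  \<open>1 / \<mu>^2\<close>.\<close>

locale random_trial_vector = centred_symmetric M N W s + trial_vector N k \<theta> e q w \<mu> \<sigma> t K \<Theta> \<alpha>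
  for M :: "'w measure" and N W s k \<theta> e q w \<mu> \<sigma> t K \<Theta> \<alpha> +
  fixes C \<beta> :: real
  assumes \<sigma>_eq: "\<And>l. l \<in> {1..k} \<Longrightarrow> \<sigma> l = expectation (\<lambda>\<omega>. ip N (e l) ((mv N (W \<omega>) ^^ 2) w))"
    and e_bound: "\<And>l a. l \<in> {1..k} \<Longrightarrow> a < N \<Longrightarrow> \<bar>e l a\<bar> \<le> K / sqrt N"
    and w_bound: "\<And>a. a < N \<Longrightarrow> \<bar>w a\<bar> \<le> K / sqrt N"
    and Ns: "real N * s = C * q" and C: "C > 0" and q1: "q \<ge> 1"
    and \<beta>: "\<bar>1 / \<mu> - \<mu> / (t * q\<^sup>2)\<bar> \<le> \<beta> / q\<^sup>2"
begin

lemma \<Theta>_nonneg: "l \<in> {1..k} \<Longrightarrow> 0 \<le> \<Theta>"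
  using \<theta>_bound[of l] by linarith

lemma \<sigma>_bound:
  assumes "l \<in> {1..k}"
  shows "\<bar>\<sigma> l\<bar> \<le> 6 * K\<^sup>2 * C * q"
proof -
  have "\<bar>\<sigma> l\<bar> \<le> K\<^sup>2 * fact (Suc 2) * (real N * s) ^ (2 div 2)"
    unfolding \<sigma>_eq[OF assms] by (rule expectation_ip_mv_power) (use e_bound[OF assms] w_bound in auto)
  then show ?thesis by (simp add: Ns eval_nat_numeral)
qed

lemma \<sigma>_square_bound:
  assumes "l \<in> {1..k}"
  shows "(\<sigma> l)\<^sup>2 \<le> 36 * K ^ 4 * C\<^sup>2 * q\<^sup>2"
proof -
  have "\<bar>\<sigma> l\<bar>\<^sup>2 \<le> (6 * K\<^sup>2 * C * q)\<^sup>2" using \<sigma>_bound[OF assms] by (intro power_mono) auto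
  then show ?thesis by (simp add: power_mult_distrib flip: power_mult)
qed

lemma inverse_\<mu>: "1 / \<mu> \<le> \<alpha> / q" "1 / \<mu>\<^sup>2 \<le> \<alpha>\<^sup>2 / q\<^sup>2" "0 < \<alpha>" "1 / \<mu> \<le> \<alpha>" "1 / \<mu>\<^sup>2 \<le> \<alpha>\<^sup>2"
proof -
  show 1: "1 / \<mu> \<le> \<alpha> / q" using \<mu> pos by (simp add: field_simps)
  show "1 / \<mu>\<^sup>2 \<le> \<alpha>\<^sup>2 / q\<^sup>2" using power_mono[OF 1, of 2] pos by (simp add: power_divide)
  show \<alpha>: "0 < \<alpha>" using \<mu> pos by (smt (verit) mult_nonpos_nonneg)
  have "\<alpha> / q \<le> \<alpha> / 1" using q1 \<alpha> by (intro divide_left_mono) auto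
  then show 2: "1 / \<mu> \<le> \<alpha>" using 1 by simp
  show "1 / \<mu>\<^sup>2 \<le> \<alpha>\<^sup>2" using power_mono[OF 2, of 2] pos by (simp add: power_divide)
qed

text \<open>The numbers are factorials from the walk estimate: \<open>36 = (3!)^2\<close> through
  the bound on \<open>\<sigma>\<close>, and \<open>240 = 2 * 5!\<close> through the fourth power of
  \<open>W\<close>.\<close>

definition residual_const :: real where
  "residual_const = 4 * real k * K\<^sup>2 * \<Theta>\<^sup>2 * (real k * (2 * \<alpha>\<^sup>2 * K ^ 4 + 36 * K ^ 4 * C\<^sup>2 / t\<^sup>2)) + 240 * \<alpha>\<^sup>2 * K\<^sup>2 * C\<^sup>2"

lemma e_w_square:
  assumes "l \<in> {1..k}"
  shows "expectation (\<lambda>\<omega>. (ip N (e l) (mv N (W \<omega>) w))\<^sup>2) \<le> 2 * K ^ 4"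
  by (rule expectation_ip_mv_square) (use e_bound[OF assms] w_bound in auto)

lemma w_fourth: "expectation (\<lambda>\<omega>. ip N w ((mv N (W \<omega>) ^^ 4) w)) \<le> 120 * K\<^sup>2 * C\<^sup>2 * q\<^sup>2"
proof -
  have "\<bar>expectation (\<lambda>\<omega>. ip N w ((mv N (W \<omega>) ^^ 4) w))\<bar> \<le> K\<^sup>2 * fact (Suc 4) * (real N * s) ^ (4 div 2)"
    by (rule expectation_ip_mv_power) (use w_bound in auto)
  moreover have "fact (Suc 4) = (120 :: real)" by (simp add: fact_numeral)
  moreover have "(real N * s) ^ (4 div 2) = C\<^sup>2 * q\<^sup>2" unfolding Ns by (simp add: power_mult_distrib)
  ultimately show ?thesis by (simp only: mult_ac)
qed

lemma residual_bound_integrable: "integrable M (\<lambda>\<omega>. residual_bound (W \<omega>))"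
  unfolding residual_bound_def
  by (intro Bochner_Integration.integrable_add integrable_mult_right Bochner_Integration.integrable_sum
      integrable_divide ip_mv_square_integrable ip_mv_power_integrable) auto

lemma expectation_residual_bound: "expectation (\<lambda>\<omega>. residual_bound (W \<omega>)) \<le> residual_const"
proof -
  define x where "x l \<omega> = (ip N (e l) (mv N (W \<omega>) w))\<^sup>2" for l \<omega>
  define X4 where "X4 \<omega> = ip N w ((mv N (W \<omega>) ^^ 4) w)" for \<omega>
  have xi: "integrable M (x l)" for l unfolding x_def by (rule ip_mv_square_integrable)
  have X4i: "integrable M X4" unfolding X4_def by (rule ip_mv_power_integrable)
  have inner: "integrable M (\<lambda>\<omega>. \<Sum>l=1..k. \<alpha>\<^sup>2 * x l \<omega> + (\<sigma> l)\<^sup>2 / (t\<^sup>2 * q\<^sup>2))"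
    by (intro Bochner_Integration.integrable_sum Bochner_Integration.integrable_add integrable_mult_right xi) auto
  have "expectation (\<lambda>\<omega>. residual_bound (W \<omega>)) =
     expectation (\<lambda>\<omega>. 4 * real k * K\<^sup>2 * \<Theta>\<^sup>2 * (\<Sum>l=1..k. \<alpha>\<^sup>2 * x l \<omega> + (\<sigma> l)\<^sup>2 / (t\<^sup>2 * q\<^sup>2)) + 2 * \<alpha>\<^sup>2 / q\<^sup>2 * X4 \<omega>)"
    by (simp add: residual_bound_def x_def X4_def)
  also have "\<dots> = 4 * real k * K\<^sup>2 * \<Theta>\<^sup>2 * expectation (\<lambda>\<omega>. \<Sum>l=1..k. \<alpha>\<^sup>2 * x l \<omega> + (\<sigma> l)\<^sup>2 / (t\<^sup>2 * q\<^sup>2))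
      + 2 * \<alpha>\<^sup>2 / q\<^sup>2 * expectation X4"
    by (subst Bochner_Integration.integral_add) (intro integrable_mult_right inner X4i | simp)+
  finally have E1: "expectation (\<lambda>\<omega>. residual_bound (W \<omega>)) =
     4 * real k * K\<^sup>2 * \<Theta>\<^sup>2 * expectation (\<lambda>\<omega>. \<Sum>l=1..k. \<alpha>\<^sup>2 * x l \<omega> + (\<sigma> l)\<^sup>2 / (t\<^sup>2 * q\<^sup>2))
      + 2 * \<alpha>\<^sup>2 / q\<^sup>2 * expectation X4" .
  have "expectation (\<lambda>\<omega>. \<Sum>l=1..k. \<alpha>\<^sup>2 * x l \<omega> + (\<sigma> l)\<^sup>2 / (t\<^sup>2 * q\<^sup>2))
     = (\<Sum>l=1..k. expectation (\<lambda>\<omega>. \<alpha>\<^sup>2 * x l \<omega> + (\<sigma> l)\<^sup>2 / (t\<^sup>2 * q\<^sup>2)))"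
    by (intro Bochner_Integration.integral_sum Bochner_Integration.integrable_add integrable_mult_right xi) auto
  also have "\<dots> = (\<Sum>l=1..k. \<alpha>\<^sup>2 * expectation (x l) + (\<sigma> l)\<^sup>2 / (t\<^sup>2 * q\<^sup>2))"
  proof (intro sum.cong refl)
    fix l
    show "expectation (\<lambda>\<omega>. \<alpha>\<^sup>2 * x l \<omega> + (\<sigma> l)\<^sup>2 / (t\<^sup>2 * q\<^sup>2)) = \<alpha>\<^sup>2 * expectation (x l) + (\<sigma> l)\<^sup>2 / (t\<^sup>2 * q\<^sup>2)"
      by (subst Bochner_Integration.integral_add) (auto simp: prob_space intro: xi)
  qed
  also have "\<dots> \<le> (\<Sum>l=1..k. \<alpha>\<^sup>2 * (2 * K ^ 4) + 36 * K ^ 4 * C\<^sup>2 / t\<^sup>2)"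
  proof (intro sum_mono add_mono mult_left_mono)
    fix l assume l: "l \<in> {1..k}"
    show "expectation (x l) \<le> 2 * K ^ 4" unfolding x_def by (rule e_w_square[OF l])
    have "(\<sigma> l)\<^sup>2 / (t\<^sup>2 * q\<^sup>2) \<le> 36 * K ^ 4 * C\<^sup>2 * q\<^sup>2 / (t\<^sup>2 * q\<^sup>2)"
      using \<sigma>_square_bound[OF l] by (intro divide_right_mono) auto
    then show "(\<sigma> l)\<^sup>2 / (t\<^sup>2 * q\<^sup>2) \<le> 36 * K ^ 4 * C\<^sup>2 / t\<^sup>2" using pos by simp
  qed auto
  finally have E2: "expectation (\<lambda>\<omega>. \<Sum>l=1..k. \<alpha>\<^sup>2 * x l \<omega> + (\<sigma> l)\<^sup>2 / (t\<^sup>2 * q\<^sup>2))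
    \<le> (\<Sum>l=1..k. \<alpha>\<^sup>2 * (2 * K ^ 4) + 36 * K ^ 4 * C\<^sup>2 / t\<^sup>2)" .
  have E3: "expectation X4 \<le> 120 * K\<^sup>2 * C\<^sup>2 * q\<^sup>2"
    using w_fourth by (simp add: X4_def[abs_def])
  have "expectation (\<lambda>\<omega>. residual_bound (W \<omega>)) \<le>
     4 * real k * K\<^sup>2 * \<Theta>\<^sup>2 * (\<Sum>l=1..k. \<alpha>\<^sup>2 * (2 * K ^ 4) + 36 * K ^ 4 * C\<^sup>2 / t\<^sup>2)
     + 2 * \<alpha>\<^sup>2 / q\<^sup>2 * (120 * K\<^sup>2 * C\<^sup>2 * q\<^sup>2)"
    unfolding E1 by (intro add_mono mult_left_mono E2 E3) auto
  also have "\<dots> = residual_const"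
    using pos by (simp add: residual_const_def mult_ac)
  finally show ?thesis .
qed

lemma rayleigh_integrable: "integrable M (\<lambda>\<omega>. rayleigh (W \<omega>))"
proof -
  have "integrable M (\<lambda>\<omega>. ip N f (mv N (W \<omega>) g))" for f g
    using ip_mv_power_integrable[of f 1 g] by simp
  then show ?thesis
    unfolding rayleigh_def
    by (intro Bochner_Integration.integrable_add Bochner_Integration.integrable_diff integrable_mult_right
        Bochner_Integration.integrable_sum integrable_divide ip_mv_square_integrable ip_mv_power_integrable) auto
qed

definition rayleigh_const :: real where
  "rayleigh_const = 6 * K\<^sup>2 * C * \<beta> + 36 * real k * \<Theta> * K ^ 4 * C\<^sup>2 / t\<^sup>2 + 2 * real k * \<Theta> * K ^ 4 * \<alpha>\<^sup>2
     + 24 * K\<^sup>2 * C * \<alpha>\<^sup>2"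

text \<open>The two terms of order 1 combine, by means of the eigenvector equation, into
  \<open>E (w' W^2 w)\<close> times the \<open>\<beta>\<close> discrepancy plus a sum of squares
  \<open>G / (t^2 q^4)\<close>; both are of order \<open>1/q\<close>.\<close>

lemma expectation_rayleigh: "\<bar>expectation (\<lambda>\<omega>. rayleigh (W \<omega>))\<bar> \<le> rayleigh_const / q"
proof -
  define X2 where "X2 \<omega> = ip N w ((mv N (W \<omega>) ^^ 2) w)" for \<omega>
  define X3 where "X3 \<omega> = ip N w ((mv N (W \<omega>) ^^ 3) w)" for \<omega>
  define x where "x l \<omega> = ip N (e l) (mv N (W \<omega>) w)" for l \<omega>
  define y where "y l = ip N (e l) w" for l
  have X2i: "integrable M X2" and X3i: "integrable M X3"
    unfolding X2_def X3_def by (rule ip_mv_power_integrable)+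
  have xi: "integrable M (x l)" for l
    unfolding x_def using ip_mv_power_integrable[of "e l" 1 w] by simp
  have xi2: "integrable M (\<lambda>\<omega>. (x l \<omega>)\<^sup>2)" for l unfolding x_def by (rule ip_mv_square_integrable)
  have x0: "expectation (x l) = 0" for l unfolding x_def by (rule expectation_ip_mv)
  have lin: "integrable M (\<lambda>\<omega>. \<Sum>l=1..k. g l * x l \<omega>)" "expectation (\<lambda>\<omega>. \<Sum>l=1..k. g l * x l \<omega>) = 0" for g
    by (auto intro!: Bochner_Integration.integrable_sum integrable_mult_right xi simp: Bochner_Integration.integral_sum xi x0)
  have sq: "integrable M (\<lambda>\<omega>. \<Sum>l=1..k. q * \<theta> l * (x l \<omega>)\<^sup>2)"
      "expectation (\<lambda>\<omega>. \<Sum>l=1..k. q * \<theta> l * (x l \<omega>)\<^sup>2) = (\<Sum>l=1..k. q * \<theta> l * expectation (\<lambda>\<omega>. (x l \<omega>)\<^sup>2))"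
    by (auto intro!: Bochner_Integration.integrable_sum integrable_mult_right xi2 simp: Bochner_Integration.integral_sum xi2)
  define F where "F = (\<Sum>l=1..k. q * \<theta> l * \<sigma> l * y l)"
  define G where "G = (\<Sum>l=1..k. q * \<theta> l * (\<sigma> l)\<^sup>2)"
  define Q where "Q = (\<Sum>l=1..k. q * \<theta> l * expectation (\<lambda>\<omega>. (x l \<omega>)\<^sup>2))"
  have "expectation (\<lambda>\<omega>. rayleigh (W \<omega>)) = expectation (\<lambda>\<omega>. - F / (t * q\<^sup>2)
     + (\<Sum>l=1..k. (q * \<theta> l * y l) * x l \<omega>) / \<mu> + X2 \<omega> / \<mu> - (\<Sum>l=1..k. (q * \<theta> l * \<sigma> l) * x l \<omega>) / (t * q\<^sup>2 * \<mu>)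
     + (\<Sum>l=1..k. q * \<theta> l * (x l \<omega>)\<^sup>2) / \<mu>\<^sup>2 + X3 \<omega> / \<mu>\<^sup>2)"
    by (simp add: rayleigh_def F_def X2_def X3_def x_def y_def)
  also have "\<dots> = - F / (t * q\<^sup>2) + expectation X2 / \<mu> + Q / \<mu>\<^sup>2 + expectation X3 / \<mu>\<^sup>2"
    using lin(1) X2i X3i sq(1)
    by (simp add: Bochner_Integration.integral_add Bochner_Integration.integral_diff Bochner_Integration.integrable_add
        Bochner_Integration.integrable_diff lin(2) sq(2) prob_space Q_def del: One_nat_def)
  finally have E: "expectation (\<lambda>\<omega>. rayleigh (W \<omega>))
     = - F / (t * q\<^sup>2) + expectation X2 / \<mu> + Q / \<mu>\<^sup>2 + expectation X3 / \<mu>\<^sup>2" .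
  \<comment> \<open>The eigenvector equation paired with \<open>W^2 w\<close>: taking expectations
    turns each \<open>e_l' W^2 w\<close> into \<open>\<sigma> l\<close>, and the constant term
    \<open>F\<close> of the Rayleigh form appears.\<close>
  have rel: "\<mu> * expectation X2 = F + G / (t * q\<^sup>2)"
  proof -
    have "\<mu> * X2 \<omega> = (\<Sum>l=1..k. q * \<theta> l * (y l + \<sigma> l / (t * q\<^sup>2)) * ip N (e l) ((mv N (W \<omega>) ^^ 2) w))" for \<omega>
    proof -
      have "\<mu> * X2 \<omega> = ip N (\<lambda>a. \<mu> * w a) ((mv N (W \<omega>) ^^ 2) w)" by (simp only: X2_def ip_scale_left)
      also have "\<dots> = ip N (\<lambda>a. \<Sum>l=1..k. q * \<theta> l * (y l + \<sigma> l / (t * q\<^sup>2)) * e l a) ((mv N (W \<omega>) ^^ 2) w)"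
        by (rule ip_cong) (auto simp: eigen y_def)
      finally show ?thesis by (simp only: ip_sum_left)
    qed
    then have "expectation (\<lambda>\<omega>. \<mu> * X2 \<omega>)
      = (\<Sum>l=1..k. expectation (\<lambda>\<omega>. q * \<theta> l * (y l + \<sigma> l / (t * q\<^sup>2)) * ip N (e l) ((mv N (W \<omega>) ^^ 2) w)))"
      by (simp only:) (intro Bochner_Integration.integral_sum integrable_mult_right ip_mv_power_integrable)
    also have "\<dots> = (\<Sum>l=1..k. q * \<theta> l * (y l + \<sigma> l / (t * q\<^sup>2)) * \<sigma> l)"
      by (intro sum.cong refl) (simp add: \<sigma>_eq)
    also have "\<dots> = F + G / (t * q\<^sup>2)"
      unfolding F_def G_def sum_divide_distrib sum.distrib[symmetric]
      by (intro sum.cong refl) (simp add: algebra_simps power2_eq_square)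
    finally show ?thesis by simp
  qed
  have eq: "- F / (t * q\<^sup>2) + expectation X2 / \<mu> = expectation X2 * (1 / \<mu> - \<mu> / (t * q\<^sup>2)) + G / (t\<^sup>2 * q ^ 4)"
  proof -
    have "F = \<mu> * expectation X2 - G / (t * q\<^sup>2)" using rel by simp
    then have "- F / (t * q\<^sup>2) = - (\<mu> * expectation X2) / (t * q\<^sup>2) + G / (t * q\<^sup>2) / (t * q\<^sup>2)"
      by (simp add: diff_divide_distrib)
    moreover have "G / (t * q\<^sup>2) / (t * q\<^sup>2) = G / (t\<^sup>2 * q ^ 4)" by (simp add: power2_eq_square eval_nat_numeral mult_ac)
    ultimately show ?thesis by (simp add: algebra_simps)
  qed
  have b1: "\<bar>expectation X2 * (1 / \<mu> - \<mu> / (t * q\<^sup>2))\<bar> \<le> 6 * K\<^sup>2 * C * \<beta> / q"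
  proof -
    have "\<bar>expectation X2\<bar> \<le> K\<^sup>2 * fact (Suc 2) * (real N * s) ^ (2 div 2)"
      unfolding X2_def by (rule expectation_ip_mv_power) (use w_bound in auto)
    then have "\<bar>expectation X2\<bar> \<le> 6 * K\<^sup>2 * C * q" by (simp add: Ns eval_nat_numeral)
    then have "\<bar>expectation X2 * (1 / \<mu> - \<mu> / (t * q\<^sup>2))\<bar> \<le> (6 * K\<^sup>2 * C * q) * (\<beta> / q\<^sup>2)"
      unfolding abs_mult using \<beta> C pos by (intro mult_mono) auto
    then show ?thesis using pos by (simp add: power2_eq_square)
  qed
  have b2: "\<bar>G / (t\<^sup>2 * q ^ 4)\<bar> \<le> 36 * real k * \<Theta> * K ^ 4 * C\<^sup>2 / t\<^sup>2 / q"
  proof -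
    have "0 \<le> G" unfolding G_def using \<theta>_bound pos by (intro sum_nonneg mult_nonneg_nonneg) auto
    have "G \<le> (\<Sum>l=1..k. q * \<Theta> * (36 * K ^ 4 * C\<^sup>2 * q\<^sup>2))"
      unfolding G_def using \<theta>_bound pos by (intro sum_mono mult_mono \<sigma>_square_bound) (auto intro!: mult_nonneg_nonneg \<Theta>_nonneg)
    also have "\<dots> = 36 * real k * \<Theta> * K ^ 4 * C\<^sup>2 * q ^ 3" by (simp add: eval_nat_numeral)
    finally have "G / (t\<^sup>2 * q ^ 4) \<le> 36 * real k * \<Theta> * K ^ 4 * C\<^sup>2 * q ^ 3 / (t\<^sup>2 * q ^ 4)"
      by (intro divide_right_mono) auto
    also have "\<dots> = 36 * real k * \<Theta> * K ^ 4 * C\<^sup>2 / t\<^sup>2 / q" using pos by (simp add: eval_nat_numeral)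
    finally show ?thesis using \<open>0 \<le> G\<close> pos by simp
  qed
  have b3: "\<bar>Q / \<mu>\<^sup>2\<bar> \<le> 2 * real k * \<Theta> * K ^ 4 * \<alpha>\<^sup>2 / q"
  proof -
    have "0 \<le> Q" unfolding Q_def using \<theta>_bound pos by (intro sum_nonneg mult_nonneg_nonneg) auto
    have "Q \<le> (\<Sum>l=1..k. q * \<Theta> * (2 * K ^ 4))"
      unfolding Q_def x_def using \<theta>_bound pos by (intro sum_mono mult_mono e_w_square) (auto intro!: mult_nonneg_nonneg \<Theta>_nonneg)
    note hQ = this
    have "Q * (1 / \<mu>\<^sup>2) \<le> (\<Sum>l=1..k. q * \<Theta> * (2 * K ^ 4)) * (\<alpha>\<^sup>2 / q\<^sup>2)"
      using inverse_\<mu>(2) by (intro mult_mono hQ order_trans[OF \<open>0 \<le> Q\<close> hQ]) auto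
    then show ?thesis using \<open>0 \<le> Q\<close> pos by (simp add: power2_eq_square mult_ac)
  qed
  have b4: "\<bar>expectation X3 / \<mu>\<^sup>2\<bar> \<le> 24 * K\<^sup>2 * C * \<alpha>\<^sup>2 / q"
  proof -
    have "\<bar>expectation X3\<bar> \<le> K\<^sup>2 * fact (Suc 3) * (real N * s) ^ (3 div 2)"
      unfolding X3_def by (rule expectation_ip_mv_power) (use w_bound in auto)
    moreover have "(real N * s) ^ (3 div 2) = C * q" by (simp add: Ns)
    moreover have "fact (Suc 3) = (24 :: real)" by (simp add: fact_numeral)
    ultimately have "\<bar>expectation X3\<bar> \<le> 24 * K\<^sup>2 * C * q" by (simp only: mult_ac)
    then have "\<bar>expectation X3\<bar> * (1 / \<mu>\<^sup>2) \<le> (24 * K\<^sup>2 * C * q) * (\<alpha>\<^sup>2 / q\<^sup>2)"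
      using inverse_\<mu>(2) C pos by (intro mult_mono) auto
    then show ?thesis using pos by (simp add: power2_eq_square abs_divide)
  qed
  have "\<bar>expectation (\<lambda>\<omega>. rayleigh (W \<omega>))\<bar> \<le> 6 * K\<^sup>2 * C * \<beta> / q + 36 * real k * \<Theta> * K ^ 4 * C\<^sup>2 / t\<^sup>2 / q
     + 2 * real k * \<Theta> * K ^ 4 * \<alpha>\<^sup>2 / q + 24 * K\<^sup>2 * C * \<alpha>\<^sup>2 / q"
    unfolding E eq using b1 b2 b3 b4 by linarith
  then show ?thesis by (simp add: rayleigh_const_def add_divide_distrib)
qed

text \<open>The exceptional event on which \<open>W\<close> has a large norm is never isolated: there the trace divided by
  its threshold is at least \<open>1\<close>, so it serves as an indicator whose expectation is known.\<close>

lemma expectation_eigenvalue: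
  assumes \<tau>: "integrable M \<tau>" and "\<gamma> > 0" "d > 0" "c > 0"
    and bound: "AE \<omega> in M. \<bar>\<tau> \<omega> * ip N w w - rayleigh (W \<omega>)\<bar> \<le>
      error_bound (W \<omega>) \<gamma> d
       + T * trace_power N (W \<omega>) (2 * p) / c ^ p"
    and "T \<ge> 0"
  shows "\<bar>expectation \<tau>\<bar> * ip N w w \<le>
    (rayleigh_const + (2 / \<gamma> + 2 / d) * residual_const + 8 * \<alpha>\<^sup>2 * K ^ 4 + 120 * \<alpha> ^ 4 * K ^ 4 * C\<^sup>2) / q
     + T * real N * fact (Suc (2 * p)) * (C * q / c) ^ p"
proof -
  define X1 where "X1 \<omega> = (ip N w (mv N (W \<omega>) w))\<^sup>2" for \<omega>
  define X4 where "X4 \<omega> = ip N w ((mv N (W \<omega>) ^^ 4) w)" for \<omega>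
  define tr where "tr \<omega> = trace_power N (W \<omega>) (2 * p)" for \<omega>
  have i1: "integrable M X1" unfolding X1_def by (rule ip_mv_square_integrable)
  have i4: "integrable M X4" unfolding X4_def by (rule ip_mv_power_integrable)
  have it: "integrable M tr" unfolding tr_def by (rule trace_power_integrable)
  define g0 where "g0 = 2 / \<gamma> + 2 / d"
  define R where "R \<omega> = (2 / \<gamma> + 2 / d) / q * residual_bound (W \<omega>) + 4 * \<alpha>\<^sup>2 / q * X1 \<omega>
     + \<alpha> ^ 4 * K\<^sup>2 / q ^ 3 * X4 \<omega> + T / c ^ p * tr \<omega>" for \<omega>
  have iR: "integrable M R"
    unfolding R_def by (intro Bochner_Integration.integrable_add integrable_mult_right residual_bound_integrable i1 i4 it)
  have ER: "expectation R = (2 / \<gamma> + 2 / d) / q * expectation (\<lambda>\<omega>. residual_bound (W \<omega>)) + 4 * \<alpha>\<^sup>2 / q * expectation X1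
     + \<alpha> ^ 4 * K\<^sup>2 / q ^ 3 * expectation X4 + T / c ^ p * expectation tr"
    unfolding R_def using residual_bound_integrable i1 i4 it
    by (simp add: Bochner_Integration.integral_add Bochner_Integration.integrable_add)
  have "expectation R \<le> (2 / \<gamma> + 2 / d) / q * residual_const + 4 * \<alpha>\<^sup>2 / q * (2 * K ^ 4)
     + \<alpha> ^ 4 * K\<^sup>2 / q ^ 3 * (120 * K\<^sup>2 * C\<^sup>2 * q\<^sup>2) + T / c ^ p * (real N * fact (Suc (2 * p)) * (C * q) ^ p)"
    unfolding ER
  proof (intro add_mono mult_left_mono)
    show "expectation X1 \<le> 2 * K ^ 4" unfolding X1_def by (rule expectation_ip_mv_square) (use w_bound in auto)
    show "expectation tr \<le> real N * fact (Suc (2 * p)) * (C * q) ^ p"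
      using expectation_trace_power[of "2 * p"] by (simp add: tr_def[abs_def] Ns)
  qed (use expectation_residual_bound w_fourth pos assms in \<open>auto simp: X4_def[abs_def]\<close>)
  also have "\<dots> = ((2 / \<gamma> + 2 / d) * residual_const + 8 * \<alpha>\<^sup>2 * K ^ 4 + 120 * \<alpha> ^ 4 * K ^ 4 * C\<^sup>2) / q
     + T * real N * fact (Suc (2 * p)) * (C * q / c) ^ p"
  proof -
    have "4 * \<alpha>\<^sup>2 / q * (2 * K ^ 4) = 8 * \<alpha>\<^sup>2 * K ^ 4 / q" by simp
    moreover have "\<alpha> ^ 4 * K\<^sup>2 / q ^ 3 * (120 * K\<^sup>2 * C\<^sup>2 * q\<^sup>2) = 120 * \<alpha> ^ 4 * K ^ 4 * C\<^sup>2 / q"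
      using pos by (simp add: field_simps eval_nat_numeral)
    moreover have "T / c ^ p * (real N * fact (Suc (2 * p)) * (C * q) ^ p) = T * real N * fact (Suc (2 * p)) * (C * q / c) ^ p"
      by (simp add: power_divide)
    ultimately show ?thesis unfolding g0_def[symmetric] by (simp only: add_divide_distrib times_divide_eq_left)
  qed
  finally have R: "expectation R \<le> \<dots>" .
  have ir: "integrable M (\<lambda>\<omega>. \<tau> \<omega> * ip N w w - rayleigh (W \<omega>))"
    by (intro Bochner_Integration.integrable_diff integrable_mult_left rayleigh_integrable \<tau>)
  have "\<bar>expectation (\<lambda>\<omega>. \<tau> \<omega> * ip N w w - rayleigh (W \<omega>))\<bar> \<le> expectation (\<lambda>\<omega>. \<bar>\<tau> \<omega> * ip N w w - rayleigh (W \<omega>)\<bar>)"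
    using integral_norm_bound[of M "\<lambda>\<omega>. \<tau> \<omega> * ip N w w - rayleigh (W \<omega>)"] by simp
  also have "\<dots> \<le> expectation R"
    by (intro integral_mono_AE integrable_abs ir iR) (use bound in \<open>simp add: R_def error_bound_def X1_def X4_def tr_def\<close>)
  also have "expectation (\<lambda>\<omega>. \<tau> \<omega> * ip N w w - rayleigh (W \<omega>))
     = expectation \<tau> * ip N w w - expectation (\<lambda>\<omega>. rayleigh (W \<omega>))"
    using \<tau> rayleigh_integrable by (simp add: Bochner_Integration.integral_diff)
  finally have "\<bar>expectation \<tau> * ip N w w\<bar> \<le> expectation R + \<bar>expectation (\<lambda>\<omega>. rayleigh (W \<omega>))\<bar>" by linarith
  also have "\<dots> \<le> ((2 / \<gamma> + 2 / d) * residual_const + 8 * \<alpha>\<^sup>2 * K ^ 4 + 120 * \<alpha> ^ 4 * K ^ 4 * C\<^sup>2) / q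
     + T * real N * fact (Suc (2 * p)) * (C * q / c) ^ p + rayleigh_const / q"
    using R expectation_rayleigh by (rule add_mono)
  also have "\<dots> = (rayleigh_const + (2 / \<gamma> + 2 / d) * residual_const + 8 * \<alpha>\<^sup>2 * K ^ 4 + 120 * \<alpha> ^ 4 * K ^ 4 * C\<^sup>2) / q
     + T * real N * fact (Suc (2 * p)) * (C * q / c) ^ p"
    by (simp add: add_divide_distrib)
  finally show ?thesis by (simp add: abs_mult ip_self_nonneg)
qed

end

section \<open>Polynomial bounds for the exceptional event, and the error at a sample point\<close>

lemma card_walks: "card (walks N m) = N ^ m"
  using card_lists_length_eq[of "{..<N}" m] by (simp add: walks_def conj_commute)

text \<open>No probability enters: there are \<open>N^(n+1)\<close> walks, each contributing at most
  \<open>K^2 / N\<close>. The bound is meant for the event on which nothing better is known.\<close>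

lemma ip_mv_power_trivial_bound:
  assumes S: "\<And>a b. a < N \<Longrightarrow> b < N \<Longrightarrow> \<bar>S a b\<bar> \<le> 1" and "N \<ge> 1"
    and f: "\<And>a. a < N \<Longrightarrow> \<bar>f a\<bar> \<le> K / sqrt N" and g: "\<And>a. a < N \<Longrightarrow> \<bar>g a\<bar> \<le> K / sqrt N"
  shows "\<bar>ip N f ((mv N S ^^ n) g)\<bar> \<le> K\<^sup>2 * real N ^ n"
proof -
  have K: "K / sqrt N \<ge> 0" using f[of 0] \<open>N \<ge> 1\<close> by auto
  have w: "\<bar>wprod S xs\<bar> \<le> 1" if "set xs \<subseteq> {..<N}" for xs
    using that by (induct xs rule: edges.induct) (use S in \<open>auto simp: abs_mult intro!: mult_le_one\<close>)
  have "\<bar>ip N f ((mv N S ^^ n) g)\<bar> \<le> (\<Sum>xs\<in>walks N (Suc n). \<bar>f (hd xs) * g (last xs) * wprod S xs\<bar>)"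
    unfolding ip_mv_power_walks by (rule sum_abs)
  also have "\<dots> \<le> (\<Sum>xs\<in>walks N (Suc n). K / sqrt N * (K / sqrt N) * 1)"
  proof (intro sum_mono)
    fix xs assume "xs \<in> walks N (Suc n)"
    then have "xs \<noteq> []" and sub: "set xs \<subseteq> {..<N}" by (auto simp: walks_def)
    then have "hd xs < N" "last xs < N" using hd_in_set last_in_set by blast+
    then show "\<bar>f (hd xs) * g (last xs) * wprod S xs\<bar> \<le> K / sqrt N * (K / sqrt N) * 1"
      unfolding abs_mult using f g K w[OF sub] by (intro mult_mono mult_nonneg_nonneg) auto
  qed
  also have "\<dots> = K\<^sup>2 * real N ^ n" using \<open>N \<ge> 1\<close> by (simp add: card_walks power2_eq_square)
  finally show ?thesis .
qed

context random_trial_vector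
begin

definition trivial_const :: real where
  "trivial_const = K\<^sup>2 * (1 + 2 * \<alpha> + \<alpha>\<^sup>2) + 4 * real k * K\<^sup>2 * \<Theta>\<^sup>2 * (real k * (\<alpha>\<^sup>2 * K ^ 4 + 36 * K ^ 4 * C\<^sup>2 / t\<^sup>2))
     + 2 * \<alpha>\<^sup>2 * K\<^sup>2"

lemma rayleigh_trivial_bound:
  assumes \<omega>: "\<omega> \<in> space M" and bdd: "\<And>a b. a < N \<Longrightarrow> b < N \<Longrightarrow> \<bar>W \<omega> a b\<bar> \<le> 1"
  shows "\<bar>rayleigh (W \<omega>)\<bar> \<le> trivial_const * real N ^ 4"
proof -
  have N1: "1 \<le> real N" using N_pos by simp
  note sym = W_sym[OF \<omega>]
  have b: "\<bar>ip N f ((mv N (W \<omega>) ^^ n) w)\<bar> \<le> K\<^sup>2 * real N ^ n"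
    if "\<And>a. a < N \<Longrightarrow> \<bar>f a\<bar> \<le> K / sqrt N" for f n
    by (rule ip_mv_power_trivial_bound) (use bdd N_pos that w_bound in auto)
  have x: "(ip N (e l) (mv N (W \<omega>) w))\<^sup>2 \<le> K ^ 4 * real N ^ 4" if l: "l \<in> {1..k}" for l
  proof -
    have "\<bar>ip N (e l) (mv N (W \<omega>) w)\<bar>\<^sup>2 \<le> (K\<^sup>2 * real N)\<^sup>2"
      using b[of "e l" 1] e_bound[OF l] by (intro power_mono) auto
    also have "\<dots> = K ^ 4 * real N ^ 2" by (simp add: power_mult_distrib flip: power_mult)
    also have "\<dots> \<le> K ^ 4 * real N ^ 4" using N1 by (intro mult_left_mono power_increasing) auto
    finally show ?thesis by simp
  qed
  have uu: "ip N (trial (W \<omega>)) (trial (W \<omega>)) \<le> K\<^sup>2 * (1 + 2 * \<alpha> + \<alpha>\<^sup>2) * real N ^ 4"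
  proof -
    have Npow: "1 \<le> real N ^ 4" "real N \<le> real N ^ 4" "real N ^ 2 \<le> real N ^ 4"
      using N1 power_increasing[of 1 4 "real N"] power_increasing[of 2 4 "real N"] by auto
    have 1: "\<bar>ip N w (mv N (W \<omega>) w)\<bar> \<le> K\<^sup>2 * real N ^ 4"
      using b[of w 1] w_bound mult_left_mono[OF Npow(2), of "K\<^sup>2"] by (auto intro: order_trans)
    have 2: "\<bar>ip N w ((mv N (W \<omega>) ^^ 2) w)\<bar> \<le> K\<^sup>2 * real N ^ 4"
      using b[of w 2] w_bound mult_left_mono[OF Npow(3), of "K\<^sup>2"] by (intro order_trans[OF b]) auto
    have "\<bar>ip N w (mv N (W \<omega>) w)\<bar> * (1 / \<mu>) \<le> K\<^sup>2 * real N ^ 4 * \<alpha>"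
      using 1 inverse_\<mu> pos by (intro mult_mono) auto
    then have 3: "ip N w (mv N (W \<omega>) w) / \<mu> \<le> K\<^sup>2 * real N ^ 4 * \<alpha>"
      using pos by (simp add: divide_right_mono order_trans[OF divide_right_mono[OF abs_ge_self]])
    have "\<bar>ip N w ((mv N (W \<omega>) ^^ 2) w)\<bar> * (1 / \<mu>\<^sup>2) \<le> K\<^sup>2 * real N ^ 4 * \<alpha>\<^sup>2"
      using 2 inverse_\<mu> pos by (intro mult_mono) auto
    then have 4: "ip N w ((mv N (W \<omega>) ^^ 2) w) / \<mu>\<^sup>2 \<le> K\<^sup>2 * real N ^ 4 * \<alpha>\<^sup>2"
      using pos by (simp add: divide_right_mono order_trans[OF divide_right_mono[OF abs_ge_self]])
    have "ip N w w \<le> K\<^sup>2 * real N ^ 4"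
      using w_norm mult_left_mono[OF Npow(1), of "K\<^sup>2"] by simp
    moreover have "ip N (trial (W \<omega>)) (trial (W \<omega>)) = ip N w w
       + (2 * ip N w (mv N (W \<omega>) w) / \<mu> + ip N w ((mv N (W \<omega>) ^^ 2) w) / \<mu>\<^sup>2)"
      by (rule trial_norm[OF sym])
    ultimately show ?thesis using 3 4 by (simp add: algebra_simps)
  qed
  have "(\<sigma> l)\<^sup>2 / (t\<^sup>2 * q\<^sup>2) \<le> 36 * K ^ 4 * C\<^sup>2 / t\<^sup>2 * real N ^ 4" if "l \<in> {1..k}" for l
  proof -
    have "(\<sigma> l)\<^sup>2 / (t\<^sup>2 * q\<^sup>2) \<le> 36 * K ^ 4 * C\<^sup>2 * q\<^sup>2 / (t\<^sup>2 * q\<^sup>2)"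
      using \<sigma>_square_bound[OF that] by (intro divide_right_mono) auto
    also have "\<dots> = 36 * K ^ 4 * C\<^sup>2 / t\<^sup>2 * 1" using pos by simp
    also have "\<dots> \<le> 36 * K ^ 4 * C\<^sup>2 / t\<^sup>2 * real N ^ 4" using N1 by (intro mult_left_mono) auto
    finally show ?thesis .
  qed
  then have "(\<Sum>l=1..k. \<alpha>\<^sup>2 * (ip N (e l) (mv N (W \<omega>) w))\<^sup>2 + (\<sigma> l)\<^sup>2 / (t\<^sup>2 * q\<^sup>2))
     \<le> (\<Sum>l=1..k. \<alpha>\<^sup>2 * (K ^ 4 * real N ^ 4) + 36 * K ^ 4 * C\<^sup>2 / t\<^sup>2 * real N ^ 4)"
    by (intro sum_mono add_mono mult_left_mono x) auto
  also have "\<dots> = real k * (\<alpha>\<^sup>2 * K ^ 4 + 36 * K ^ 4 * C\<^sup>2 / t\<^sup>2) * real N ^ 4" by (simp add: algebra_simps)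
  finally have "4 * real k * K\<^sup>2 * \<Theta>\<^sup>2 * (\<Sum>l=1..k. \<alpha>\<^sup>2 * (ip N (e l) (mv N (W \<omega>) w))\<^sup>2 + (\<sigma> l)\<^sup>2 / (t\<^sup>2 * q\<^sup>2))
     \<le> 4 * real k * K\<^sup>2 * \<Theta>\<^sup>2 * (real k * (\<alpha>\<^sup>2 * K ^ 4 + 36 * K ^ 4 * C\<^sup>2 / t\<^sup>2) * real N ^ 4)"
    by (intro mult_left_mono) auto
  moreover have "2 * \<alpha>\<^sup>2 * ip N w ((mv N (W \<omega>) ^^ 4) w) / q\<^sup>2 \<le> 2 * \<alpha>\<^sup>2 * K\<^sup>2 * real N ^ 4"
  proof -
    have "\<bar>ip N w ((mv N (W \<omega>) ^^ 4) w)\<bar> * (1 / q\<^sup>2) \<le> K\<^sup>2 * real N ^ 4 * 1"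
      using b[of w 4] w_bound q1 one_le_power[OF q1, of 2] by (intro mult_mono) auto
    then have "ip N w ((mv N (W \<omega>) ^^ 4) w) / q\<^sup>2 \<le> K\<^sup>2 * real N ^ 4"
      using pos by (simp add: order_trans[OF divide_right_mono[OF abs_ge_self]])
    then have "2 * \<alpha>\<^sup>2 * (ip N w ((mv N (W \<omega>) ^^ 4) w) / q\<^sup>2) \<le> 2 * \<alpha>\<^sup>2 * (K\<^sup>2 * real N ^ 4)"
      by (intro mult_left_mono) auto
    then show ?thesis by simp
  qed
  ultimately have rb: "residual_bound (W \<omega>) \<le> 4 * real k * K\<^sup>2 * \<Theta>\<^sup>2 * (real k * (\<alpha>\<^sup>2 * K ^ 4 + 36 * K ^ 4 * C\<^sup>2 / t\<^sup>2) * real N ^ 4)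
      + 2 * \<alpha>\<^sup>2 * K\<^sup>2 * real N ^ 4"
    unfolding residual_bound_def by linarith
  define u z where "u = trial (W \<omega>)" and "z = residual (W \<omega>)"
  \<comment> \<open>A crude inequality is enough here, as any fixed power of \<open>N\<close> will
    be beaten by the trace.\<close>
  have "\<bar>ip N u z\<bar> \<le> ip N u u + ip N z z"
  proof -
    have nn: "0 \<le> ip N (\<lambda>a. u a + c * z a) (\<lambda>a. u a + c * z a)" for c by (rule ip_self_nonneg)
    have "0 \<le> ip N u u + 2 * c * ip N u z + c\<^sup>2 * ip N z z" for c
      using nn[of c] by (simp only: ip_add_left ip_add_right ip_scale_left ip_scale_right)
        (simp add: ip_commute[of N z u] power2_eq_square algebra_simps)
    from this[of 1] this[of "-1"] show ?thesis using ip_self_nonneg[of N u] ip_self_nonneg[of N z] by auto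
  qed
  also have "ip N z z \<le> residual_bound (W \<omega>)" unfolding z_def by (rule residual_norm[OF sym])
  also have "ip N u z = rayleigh (W \<omega>)" unfolding u_def z_def by (rule rayleigh_eq[OF sym])
  finally have "\<bar>rayleigh (W \<omega>)\<bar> \<le> ip N u u + residual_bound (W \<omega>)" by simp
  also have "\<dots> \<le> K\<^sup>2 * (1 + 2 * \<alpha> + \<alpha>\<^sup>2) * real N ^ 4
     + (4 * real k * K\<^sup>2 * \<Theta>\<^sup>2 * (real k * (\<alpha>\<^sup>2 * K ^ 4 + 36 * K ^ 4 * C\<^sup>2 / t\<^sup>2) * real N ^ 4)
      + 2 * \<alpha>\<^sup>2 * K\<^sup>2 * real N ^ 4)"
    using uu rb unfolding u_def by (rule add_mono)
  also have "\<dots> = trivial_const * real N ^ 4"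
    unfolding trivial_const_def by (simp only: ring_distribs mult.assoc)
  finally show ?thesis .
qed

lemma trivial_const_nonneg: "trivial_const \<ge> 0"
  unfolding trivial_const_def using inverse_\<mu>(3) pos by (intro add_nonneg_nonneg mult_nonneg_nonneg) auto

text \<open>If the trace is at most its threshold, \<open>W\<close> has norm at most
  \<open>c q\<close>; min-max then isolates the eigenvalue and \<open>eigenvalue_error\<close>
  applies. Otherwise the ratio of trace to threshold exceeds 1, and multiplied by \<open>T\<close>
  it covers the polynomial bounds. The second claim provides integrability later.\<close>

lemma eigenvalue_error_pointwise:
  assumes \<omega>: "\<omega> \<in> space M" and bdd: "\<And>a b. a < N \<Longrightarrow> b < N \<Longrightarrow> \<bar>W \<omega> a b\<bar> \<le> 1"
    and A: "\<And>a b. a < N \<Longrightarrow> b < N \<Longrightarrow> A a b = q * (\<Sum>l=1..k. \<theta> l * e l a * e l b) + W \<omega> a b"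
    and A_bdd: "\<And>a b. a < N \<Longrightarrow> b < N \<Longrightarrow> \<bar>A a b\<bar> \<le> 2"
    and sp: "spectral N A \<Lambda> v" and m: "1 \<le> m" "m \<le> k" and kN: "k < N"
    and gram: "\<And>i j. i \<in> {1..k} \<Longrightarrow> j \<in> {1..k} \<Longrightarrow> \<bar>ip N (e i) (e j) - (if i = j then 1 else 0)\<bar> \<le> \<rho>"
    and dec: "\<And>i j. 1 \<le> i \<Longrightarrow> i \<le> j \<Longrightarrow> j \<le> k \<Longrightarrow> \<theta> j \<le> \<theta> i"
    and \<theta>pos: "\<And>i. 1 \<le> i \<Longrightarrow> i \<le> k \<Longrightarrow> 0 < \<theta> i"
    and \<rho>: "0 \<le> \<rho>" "real k * \<rho> < 1" "real k * \<rho> * \<Theta> \<le> g / 16"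
    and g: "g > 0" "m \<ge> 2 \<Longrightarrow> \<theta> m + g \<le> \<theta> (m - 1)" "(if m < k then \<theta> (Suc m) else 0) + g \<le> \<theta> m"
    and \<mu>_near: "\<bar>\<mu> - q * \<theta> m\<bar> \<le> q * (g / 16)"
    and c: "c > 0" "c \<le> g / 16" "c * \<alpha> \<le> 1 / 2"
    and d: "0 < d" "d \<le> ip N w w" and p: "p \<ge> 1"
  defines "T \<equiv> (trivial_const + K\<^sup>2 * (2 + (\<Theta> + g) / C)) * real N ^ 4"
  shows "\<bar>(\<Lambda> (m - 1) - \<mu>) * ip N w w - rayleigh (W \<omega>)\<bar> \<le>
      error_bound (W \<omega>) (g / 2) d
       + T * trace_power N (W \<omega>) (2 * p) / ((c * q)\<^sup>2) ^ p"
    and "\<bar>\<Lambda> (m - 1) - \<mu>\<bar> \<le> (2 + (\<Theta> + g) / C) * real N"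
proof -
  define R where "R = error_bound (W \<omega>) (g / 2) d"
  note sym = W_sym[OF \<omega>]
  have N1: "1 \<le> real N" using N_pos by simp
  have \<Theta>0: "\<Theta> \<ge> 0" using m by (intro \<Theta>_nonneg[of m]) auto
  have \<theta>m: "0 < \<theta> m" "\<theta> m \<le> \<Theta>" using \<theta>pos \<theta>_bound m by auto
  have i: "m - 1 < N" using m kN by auto
  \<comment> \<open>Since \<open>s \<le> 1\<close>, \<open>C q = N s\<close> is at most
    \<open>N\<close>.\<close>
  have qN: "q \<le> real N / C"
  proof -
    have "C * q \<le> real N" using Ns s N1 by (metis mult_left_le of_nat_0_le_iff)
    then show ?thesis using C by (simp add: field_simps)
  qed
  show crude: "\<bar>\<Lambda> (m - 1) - \<mu>\<bar> \<le> (2 + (\<Theta> + g) / C) * real N"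
  proof -
    have "\<bar>\<Lambda> (m - 1)\<bar> \<le> 2 * real N" by (rule spectral_eigenvalue_bound[OF sp i A_bdd])
    moreover have "\<bar>\<mu>\<bar> \<le> (\<Theta> + g) * (real N / C)"
    proof -
      have "\<bar>\<mu>\<bar> \<le> q * \<theta> m + q * (g / 16)" using \<mu>_near pos by linarith
      also have "\<dots> = q * (\<theta> m + g / 16)" by (simp only: distrib_left)
      also have "\<dots> \<le> q * (\<Theta> + g)" using \<theta>m g(1) pos by (intro mult_left_mono add_mono) auto
      also have "\<dots> \<le> (real N / C) * (\<Theta> + g)" using qN \<Theta>0 g by (intro mult_right_mono) auto
      finally show ?thesis by (simp add: mult.commute)
    qed
    ultimately have "\<bar>\<Lambda> (m - 1) - \<mu>\<bar> \<le> 2 * real N + (\<Theta> + g) * (real N / C)" by linarith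
    then show ?thesis by (simp add: algebra_simps)
  qed
  have T0: "T \<ge> 0" unfolding T_def using trivial_const_nonneg \<Theta>0 g C
    by (intro mult_nonneg_nonneg add_nonneg_nonneg) auto
  have tr0: "trace_power N (W \<omega>) (2 * p) \<ge> 0" by (rule trace_power_nonneg[OF sym])
  have X4: "ip N w ((mv N (W \<omega>) ^^ 4) w) \<ge> 0"
    using ip_self_nonneg[of N "(mv N (W \<omega>) ^^ 2) w"] by (simp add: ip_mv_symmetric[OF sym] eval_nat_numeral)
  have rb0: "residual_bound (W \<omega>) \<ge> 0"
    using residual_norm[where V = "W \<omega>", OF sym] ip_self_nonneg[of N "residual (W \<omega>)"] by linarith
  have R0: "R \<ge> 0" unfolding R_def error_bound_def using rb0 X4 pos g d by (intro add_nonneg_nonneg mult_nonneg_nonneg divide_nonneg_pos) auto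
  have "\<bar>(\<Lambda> (m - 1) - \<mu>) * ip N w w - rayleigh (W \<omega>)\<bar> \<le> R + T * trace_power N (W \<omega>) (2 * p) / ((c * q)\<^sup>2) ^ p"
  proof (cases "trace_power N (W \<omega>) (2 * p) \<le> ((c * q)\<^sup>2) ^ p")
    case False
    have cp: "((c * q)\<^sup>2) ^ p > 0" using c pos by simp
    have "\<bar>(\<Lambda> (m - 1) - \<mu>) * ip N w w\<bar> \<le> (2 + (\<Theta> + g) / C) * real N * K\<^sup>2"
      unfolding abs_mult using crude w_norm ip_self_nonneg[of N w] \<Theta>0 g C by (intro mult_mono) auto
    also have "\<dots> \<le> (2 + (\<Theta> + g) / C) * real N ^ 4 * K\<^sup>2"
      using power_increasing[of 1 4 "real N"] N1 \<Theta>0 g C by (intro mult_right_mono mult_left_mono) auto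
    finally have "\<bar>(\<Lambda> (m - 1) - \<mu>) * ip N w w - rayleigh (W \<omega>)\<bar> \<le> (2 + (\<Theta> + g) / C) * real N ^ 4 * K\<^sup>2 + trivial_const * real N ^ 4"
      using rayleigh_trivial_bound[OF \<omega> bdd] by linarith
    also have "\<dots> = T * 1" by (simp add: T_def algebra_simps)
    also have "\<dots> \<le> T * (trace_power N (W \<omega>) (2 * p) / ((c * q)\<^sup>2) ^ p)"
      using False cp T0 by (intro mult_left_mono) auto
    finally show ?thesis using R0 by simp
  next
    case True
    have norm: "ip N (mv N (W \<omega>) z) (mv N (W \<omega>) z) \<le> (c * q)\<^sup>2 * ip N z z" for z
      by (rule mv_norm_le_of_trace[OF sym p _ True]) auto
    have close: "\<bar>ip N z (mv N A z) - q * (\<Sum>l=1..k. \<theta> l * (ip N (e l) z)\<^sup>2)\<bar> \<le> (c * q) * ip N z z" for z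
    proof -
      have "ip N z (mv N A z) = ip N z (\<lambda>a. (\<Sum>l=1..k. (q * \<theta> l * ip N (e l) z) * e l a) + mv N (W \<omega>) z a)"
        by (intro ip_cong mv_finite_rank[OF A]) auto
      also have "\<dots> = (\<Sum>l=1..k. (q * \<theta> l * ip N (e l) z) * ip N z (e l)) + ip N z (mv N (W \<omega>) z)"
        by (simp only: ip_add_right ip_sum_right)
      also have "(\<Sum>l=1..k. (q * \<theta> l * ip N (e l) z) * ip N z (e l)) = q * (\<Sum>l=1..k. \<theta> l * (ip N (e l) z)\<^sup>2)"
        unfolding sum_distrib_left
        by (intro sum.cong refl) (simp add: ip_commute[of N z "e _"] power2_eq_square)
      finally have eq: "ip N z (mv N A z) - q * (\<Sum>l=1..k. \<theta> l * (ip N (e l) z)\<^sup>2) = ip N z (mv N (W \<omega>) z)" by simp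
      have "(ip N z (mv N (W \<omega>) z))\<^sup>2 \<le> ip N z z * ((c * q)\<^sup>2 * ip N z z)"
        by (rule order_trans[OF ip_Cauchy_Schwarz]) (intro mult_left_mono norm ip_self_nonneg)
      also have "\<dots> = (c * q * ip N z z)\<^sup>2" by (simp add: power2_eq_square)
      finally have "\<bar>ip N z (mv N (W \<omega>) z)\<bar> \<le> \<bar>c * q * ip N z z\<bar>" by (simp only: abs_le_square_iff)
      also have "\<dots> = c * q * ip N z z"
        using c(1) pos(1) ip_self_nonneg[of N z] by (intro abs_of_nonneg mult_nonneg_nonneg) auto
      finally show ?thesis unfolding eq .
    qed
    note ev = finite_rank_eigenvalues[OF sp gram dec \<theta>pos less_imp_le[OF pos(1)] \<rho>(1,2) close]
    have \<kappa>: "q * x * (real k * \<rho>) \<le> q * (g / 16)" if "0 \<le> x" "x \<le> \<Theta>" for x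
    proof -
      have "x * (real k * \<rho>) \<le> \<Theta> * (real k * \<rho>)" using that \<rho> by (intro mult_right_mono) auto
      then have "x * (real k * \<rho>) \<le> g / 16" using \<rho>(3) by (simp add: mult_ac)
      then show ?thesis using pos by (simp add: mult.assoc mult_left_mono)
    qed
    have cq: "c * q \<le> q * (g / 16)" using c pos by (simp add: mult.commute mult_left_mono)
    have lo: "q * \<theta> j - q * (g / 16) - q * (g / 16) \<le> \<Lambda> (j - 1)" if "1 \<le> j" "j \<le> k" for j
    proof -
      have "q * \<theta> j * (1 - real k * \<rho>) - c * q \<le> \<Lambda> (j - 1)" using ev(1)[of j] that kN by simp
      moreover have "q * \<theta> j * (real k * \<rho>) \<le> q * (g / 16)"
        using \<theta>_bound[of j] that by (intro \<kappa>) auto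
      ultimately show ?thesis using cq unfolding right_diff_distrib by linarith
    qed
    have hi: "\<Lambda> j \<le> q * (if j < k then \<theta> (Suc j) else 0) + q * (g / 16) + q * (g / 16)" if "j \<le> k" for j
    proof -
      define x where "x = (if j < k then \<theta> (Suc j) else 0)"
      have "\<Lambda> j \<le> q * x * (1 + real k * \<rho>) + c * q" using ev(2)[of j] that kN by (simp add: x_def)
      moreover have "q * x * (real k * \<rho>) \<le> q * (g / 16)"
        using \<theta>_bound[of "Suc j"] \<Theta>0 that by (intro \<kappa>) (auto simp: x_def)
      ultimately show ?thesis using cq unfolding x_def[symmetric] distrib_left by linarith
    qed
    have hi_m: "\<Lambda> (m - 1) \<le> q * \<theta> m + q * (g / 16) + q * (g / 16)" 
    proof -
      have "Suc (m - 1) = m" "m - 1 < k" using m by auto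
      then show ?thesis using hi[of "m - 1"] by (simp only: if_True less_imp_le)
    qed
    have lo_m: "q * \<theta> m - q * (g / 16) - q * (g / 16) \<le> \<Lambda> (m - 1)" using lo[of m] m by simp
    \<comment> \<open>The gap at scale \<open>q\<close> is \<open>16 h\<close>. Gram error, noise
      and the distance from \<open>\<mu>\<close> to \<open>q * \<theta> m\<close> cost at most
      \<open>h\<close> each, so the wanted eigenvalue is within \<open>3 h\<close> of
      \<open>\<mu>\<close> and all others are at least \<open>13 h\<close> away; \<open>8 h\<close>
      separates them.\<close>
    define h where "h = q * (g / 16)"
    have h: "h > 0" using pos g by (simp add: h_def)
    have gh: "g / 2 * q = 8 * h" "q * g = 16 * h" by (simp_all add: h_def)
    have near: "\<bar>\<Lambda> (m - 1) - \<mu>\<bar> \<le> g / 2 * q"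
      using hi_m lo_m \<mu>_near h unfolding gh h_def[symmetric] by linarith
    have far: "g / 2 * q \<le> \<bar>\<Lambda> j - \<mu>\<bar>" if j: "j < N" "j \<noteq> m - 1" for j
    proof (cases "j < m - 1")
      case True
      then have m2: "m \<ge> 2" by auto
      have "\<Lambda> (m - 2) \<le> \<Lambda> j" using True kN m by (intro spectral_mono[OF sp]) auto
      moreover have "q * \<theta> (m - 1) - h - h \<le> \<Lambda> (m - 2)" using lo[of "m - 1"] m2 m by (simp add: h_def numeral_2_eq_2)
      moreover have "q * \<theta> m + 16 * h \<le> q * \<theta> (m - 1)"
        using mult_left_mono[OF g(2)[OF m2], of q] pos unfolding gh(2)[symmetric] by (simp add: distrib_left)
      ultimately show ?thesis using \<mu>_near h unfolding gh h_def[symmetric] by linarith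
    next
      case False
      then have mj: "m \<le> j" using j by auto
      have "\<Lambda> j \<le> \<Lambda> m" using mj j by (intro spectral_mono[OF sp]) auto
      moreover have "\<Lambda> m \<le> q * (if m < k then \<theta> (Suc m) else 0) + h + h" using hi[of m] m by (simp add: h_def)
      moreover have "q * (if m < k then \<theta> (Suc m) else 0) + 16 * h \<le> q * \<theta> m"
        using mult_left_mono[OF g(3), of q] pos unfolding gh(2)[symmetric] by (simp only: distrib_left)
      ultimately show ?thesis using \<mu>_near h unfolding gh h_def[symmetric] by linarith
    qed
    have small: "ip N (mv N (W \<omega>) w) (mv N (W \<omega>) w) \<le> \<mu>\<^sup>2 / 4 * ip N w w"
    proof -
      have "c * q \<le> c * (\<alpha> * \<mu>)" using \<mu> c by (intro mult_left_mono) auto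
      also have "\<dots> \<le> \<mu> / 2" using mult_right_mono[OF c(3), of \<mu>] pos by simp
      finally have "(c * q)\<^sup>2 \<le> (\<mu> / 2)\<^sup>2" using c pos by (intro power_mono) auto
      then have "(c * q)\<^sup>2 * ip N w w \<le> (\<mu> / 2)\<^sup>2 * ip N w w" by (intro mult_right_mono ip_self_nonneg)
      then show ?thesis using norm[of w] by (simp add: power_divide)
    qed
    have "\<bar>(\<Lambda> (m - 1) - \<mu>) * ip N w w - rayleigh (W \<omega>)\<bar> \<le> R"
      unfolding R_def using g(1) by (intro eigenvalue_error[OF sym A sp i _ near far small d]) auto
    moreover have "0 \<le> T * trace_power N (W \<omega>) (2 * p) / ((c * q)\<^sup>2) ^ p" using T0 tr0 by simp
    ultimately show ?thesis by linarith
  qed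
  then show "\<bar>(\<Lambda> (m - 1) - \<mu>) * ip N w w - rayleigh (W \<omega>)\<bar> \<le>
      error_bound (W \<omega>) (g / 2) d
       + T * trace_power N (W \<omega>) (2 * p) / ((c * q)\<^sup>2) ^ p"
    unfolding R_def .
qed

end

section \<open>Expectation of the eigenvalue error\<close>

context random_trial_vector
begin

definition error_const :: "real \<Rightarrow> real \<Rightarrow> real" where
  "error_const g d = rayleigh_const + (2 / (g / 2) + 2 / d) * residual_const + 8 * \<alpha>\<^sup>2 * K ^ 4 + 120 * \<alpha> ^ 4 * K ^ 4 * C\<^sup>2"

lemma expected_eigenvalue_error:
  assumes A: "\<And>\<omega>. \<omega> \<in> space M \<Longrightarrow> A \<omega> \<in> carrier_mat N N \<and> transpose_mat (A \<omega>) = A \<omega>"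
    and A_entry: "\<And>\<omega> a b. \<omega> \<in> space M \<Longrightarrow> a < N \<Longrightarrow> b < N \<Longrightarrow>
        A \<omega> $$ (a,b) = q * (\<Sum>l=1..k. \<theta> l * e l a * e l b) + W \<omega> a b"
    and P_bdd: "\<And>a b. a < N \<Longrightarrow> b < N \<Longrightarrow> \<bar>q * (\<Sum>l=1..k. \<theta> l * e l a * e l b)\<bar> \<le> 1"
    and m: "1 \<le> m" "m \<le> k" and kN: "k < N"
    and gram: "\<And>i j. i \<in> {1..k} \<Longrightarrow> j \<in> {1..k} \<Longrightarrow> \<bar>ip N (e i) (e j) - (if i = j then 1 else 0)\<bar> \<le> \<rho>"
    and dec: "\<And>i j. 1 \<le> i \<Longrightarrow> i \<le> j \<Longrightarrow> j \<le> k \<Longrightarrow> \<theta> j \<le> \<theta> i"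
    and \<theta>pos: "\<And>i. 1 \<le> i \<Longrightarrow> i \<le> k \<Longrightarrow> 0 < \<theta> i"
    and \<rho>: "0 \<le> \<rho>" "real k * \<rho> < 1" "real k * \<rho> * \<Theta> \<le> g / 16"
    and g: "g > 0" "m \<ge> 2 \<Longrightarrow> \<theta> m + g \<le> \<theta> (m - 1)" "(if m < k then \<theta> (Suc m) else 0) + g \<le> \<theta> m"
    and \<mu>_near: "\<bar>\<mu> - q * \<theta> m\<bar> \<le> q * (g / 16)"
    and c: "c > 0" "c \<le> g / 16" "c * \<alpha> \<le> 1 / 2"
    and d: "0 < d" "d \<le> ip N w w" and p: "p \<ge> 1"
  shows "\<bar>expectation (\<lambda>\<omega>. eigval_desc m (A \<omega>)) - \<mu>\<bar> * d \<le> error_const g d / q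
     + (trivial_const + K\<^sup>2 * (2 + (\<Theta> + g) / C)) * (real N ^ 5 * fact (Suc (2 * p)) * (C / c\<^sup>2 / q) ^ p)"
proof -
  define \<tau> where "\<tau> \<omega> = eigval_desc m (A \<omega>) - \<mu>" for \<omega>
  define T where "T = (trivial_const + K\<^sup>2 * (2 + (\<Theta> + g) / C)) * real N ^ 4"
  have mS: "Suc (m - 1) = m" using m by simp
  have \<Theta>0: "\<Theta> \<ge> 0" using m by (intro \<Theta>_nonneg[of m]) auto
  have pw: "\<bar>\<tau> \<omega> * ip N w w - rayleigh (W \<omega>)\<bar> \<le>
      error_bound (W \<omega>) (g / 2) d
       + T * trace_power N (W \<omega>) (2 * p) / ((c * q)\<^sup>2) ^ p \<and> \<bar>\<tau> \<omega>\<bar> \<le> (2 + (\<Theta> + g) / C) * real N"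
    if \<omega>: "\<omega> \<in> space M" and bdd: "\<forall>a\<in>{..<N}. \<forall>b\<in>{..<N}. \<bar>W \<omega> a b\<bar> \<le> 1" for \<omega>
  proof -
    obtain v where sp: "spectral N (\<lambda>a b. A \<omega> $$ (a,b)) (\<lambda>j. eigval_desc (Suc j) (A \<omega>)) v"
      using real_symmetric_spectral A[OF \<omega>] by blast
    have bdd': "\<bar>W \<omega> a b\<bar> \<le> 1" if "a < N" "b < N" for a b using bdd that by simp
    have A2: "\<bar>A \<omega> $$ (a,b)\<bar> \<le> 2" if "a < N" "b < N" for a b
      unfolding A_entry[OF \<omega> that] using P_bdd[OF that] bdd'[OF that] by linarith
    note er = eigenvalue_error_pointwise[OF \<omega> bdd' A_entry[OF \<omega>] A2 sp m kN gram dec \<theta>pos \<rho> g \<mu>_near c d p]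
    show ?thesis using er unfolding T_def[symmetric] mS \<tau>_def by blast
  qed
  have meas: "\<tau> \<in> borel_measurable M"
  proof -
    have "(\<lambda>\<omega>. A \<omega> $$ (a,b)) \<in> borel_measurable M" if "a < N" "b < N" for a b
    proof -
      have "(\<lambda>\<omega>. q * (\<Sum>l=1..k. \<theta> l * e l a * e l b) + W \<omega> a b) \<in> borel_measurable M"
        using W_measurable[OF that] by simp
      then show ?thesis using A_entry that by (simp cong: measurable_cong)
    qed
    then have "(\<lambda>\<omega>. eigval_desc (Suc (m - 1)) (A \<omega>)) \<in> borel_measurable M"
      using A m kN by (intro eigval_desc_measurable[where n = N]) auto
    then show ?thesis unfolding \<tau>_def[abs_def] mS by simp
  qed
  have AE1: "AE \<omega> in M. \<bar>\<tau> \<omega>\<bar> \<le> (2 + (\<Theta> + g) / C) * real N"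
    using W_bdd_all AE_space by eventually_elim (use pw in blast)
  have int: "integrable M \<tau>"
    by (rule integrable_const_bound[where B = "(2 + (\<Theta> + g) / C) * real N"]) (use AE1 meas in auto)
  have AE2: "AE \<omega> in M. \<bar>\<tau> \<omega> * ip N w w - rayleigh (W \<omega>)\<bar> \<le>
      error_bound (W \<omega>) (g / 2) d
       + T * trace_power N (W \<omega>) (2 * p) / ((c * q)\<^sup>2) ^ p"
    using W_bdd_all AE_space by eventually_elim (use pw in blast)
  have T0: "T \<ge> 0" unfolding T_def using trivial_const_nonneg \<Theta>0 g C
    by (intro mult_nonneg_nonneg add_nonneg_nonneg) auto
  have cq: "(c * q)\<^sup>2 > 0" "g / 2 > 0" using c pos g by auto
  have "expectation (\<lambda>\<omega>. eigval_desc m (A \<omega>)) - \<mu> = expectation \<tau>"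
  proof -
    have "integrable M (\<lambda>\<omega>. \<tau> \<omega> + \<mu>)" using int by simp
    then have "integrable M (\<lambda>\<omega>. eigval_desc m (A \<omega>))" by (simp add: \<tau>_def)
    then show ?thesis unfolding \<tau>_def[abs_def] by (simp add: Bochner_Integration.integral_diff prob_space)
  qed
  then have "\<bar>expectation (\<lambda>\<omega>. eigval_desc m (A \<omega>)) - \<mu>\<bar> * d \<le> \<bar>expectation \<tau>\<bar> * ip N w w"
    using d by (simp add: mult_left_mono)
  also have "\<dots> \<le> error_const g d / q + T * real N * fact (Suc (2 * p)) * (C * q / (c * q)\<^sup>2) ^ p"
    unfolding error_const_def by (rule expectation_eigenvalue[OF int cq(2) d(1) cq(1) AE2 T0])
  \<comment> \<open>The trace of order \<open>2 p\<close> has mean about \<open>(C q)^p\<close>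
    against the threshold \<open>(c q)^(2 p)\<close>, so each unit of \<open>p\<close> gains a
    factor \<open>q\<close>.\<close>
  also have "C * q / (c * q)\<^sup>2 = C / c\<^sup>2 / q" using pos c by (simp add: power2_eq_square)
  finally show ?thesis by (simp add: T_def mult_ac eval_nat_numeral)
qed

end

section \<open>The order of the trace, and Riemann sums\<close>

text \<open>For \<open>p\<close> of order \<open>ln N\<close> the factorial is at most about
  \<open>(19 ln N)^(2 p)\<close>, so a fourth power of \<open>ln N\<close> inside \<open>q\<close>
  makes the ratio per unit of \<open>p\<close> tend to 0. Once it is below \<open>exp (-1)\<close>,
  the \<open>p\<close>-th power beats any fixed power of \<open>N\<close>.\<close>

lemma eventually_walk_length:
  assumes q: "\<forall>\<^sub>F N in sequentially. (ln (real N)) ^ 4 \<le> q N" and "D > 0"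
  shows "\<forall>\<^sub>F N in sequentially. \<exists>p\<ge>1. real N ^ 5 * fact (Suc (2 * p)) * (D / q N) ^ p \<le> 1 / real N"
proof -
  have 1: "\<forall>\<^sub>F N in sequentially. ln (real N) \<ge> 1" by real_asymp
  have 2: "\<forall>\<^sub>F N in sequentially. D * (19 * ln (real N)) ^ 2 / ln (real N) ^ 4 \<le> exp (-1)"
  proof -
    have "(\<lambda>N. D * (19 * ln (real N)) ^ 2 / ln (real N) ^ 4) \<longlonglongrightarrow> 0" by real_asymp
    then have "\<forall>\<^sub>F N in sequentially. D * (19 * ln (real N)) ^ 2 / ln (real N) ^ 4 < exp (-1)"
      by (rule order_tendstoD) simp
    then show ?thesis by eventually_elim simp
  qed
  have 3: "\<forall>\<^sub>F N in sequentially. 19 * ln (real N) \<le> real N" by real_asymp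
  have 4: "\<forall>\<^sub>F N in sequentially. N \<ge> (1::nat)" by (rule eventually_ge_at_top)
  show ?thesis using q 1 2 3 4
  proof eventually_elim
    case (elim N)
    define L where "L = ln (real N)"
    have L: "L \<ge> 1" "L ^ 4 \<le> q N" "D * (19 * L) ^ 2 / L ^ 4 \<le> exp (-1)" "19 * L \<le> real N"
      using elim by (auto simp: L_def)
    \<comment> \<open>The 7 yields \<open>N^-7\<close>, against \<open>N^5\<close> from the
      prefactor and one more \<open>N\<close> that absorbs \<open>19 L\<close>. The 19 dominates
      \<open>2 p + 1 \<le> 14 L + 3\<close> for \<open>L \<ge> 1\<close>.\<close>
    define p where "p = nat \<lceil>7 * L\<rceil>"
    have p: "7 * L \<le> real p" "real p \<le> 7 * L + 1" using L(1) by (auto simp: p_def)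
    have p1: "p \<ge> 1" using p(1) L(1) by linarith
    have b: "real (Suc (2 * p)) \<le> 19 * L" using p L(1) by simp
    have q0: "q N > 0" using L(1,2) by (smt (verit) zero_less_power)
    have "(fact (Suc (2 * p)) :: real) \<le> of_nat (Suc (2 * p) ^ Suc (2 * p))" by (rule fact_le_power)
    also have "\<dots> = real (Suc (2 * p)) ^ Suc (2 * p)" by (rule of_nat_power)
    also have "\<dots> \<le> (19 * L) ^ Suc (2 * p)" using b by (intro power_mono) auto
    finally have f: "fact (Suc (2 * p)) \<le> (19 * L) ^ Suc (2 * p)" .
    have "real N ^ 5 * fact (Suc (2 * p)) * (D / q N) ^ p \<le> real N ^ 5 * (19 * L) ^ Suc (2 * p) * (D / L ^ 4) ^ p"
      using f L q0 \<open>D > 0\<close> by (intro mult_mono mult_left_mono power_mono divide_left_mono) auto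
    also have "\<dots> = real N ^ 5 * (19 * L) * (D * (19 * L) ^ 2 / L ^ 4) ^ p"
    proof -
      define X where "X = (19 * L) ^ 2"
      have pw: "(19 * L) ^ Suc (2 * p) = 19 * L * X ^ p" unfolding X_def by (simp only: power_Suc power_mult)
      show ?thesis unfolding pw X_def[symmetric] by (simp add: power_mult_distrib power_divide)
    qed
    also have "\<dots> \<le> real N ^ 5 * real N * exp (-1) ^ p"
      using L \<open>D > 0\<close> by (intro mult_mono power_mono) auto
    also have "exp (-1) ^ p = exp (- real p)" by (simp add: exp_of_nat_mult[symmetric])
    also have "real N ^ 5 * real N * exp (- real p) \<le> real N ^ 5 * real N * exp (- (7 * L))"
      using p by (intro mult_left_mono) auto
    also have "exp (- (7 * L)) = 1 / real N ^ 7"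
    proof -
      have "exp (7 * L) = real N ^ 7" unfolding L_def using elim(5) exp_of_nat_mult[of 7 "ln (real N)"] by simp
      then show ?thesis by (simp add: exp_minus inverse_eq_divide)
    qed
    also have "real N ^ 5 * real N * (1 / real N ^ 7) = 1 / real N" using elim(5) by (simp add: eval_nat_numeral)
    finally show ?case using p1 by blast
  qed
qed

text \<open>Right endpoint sums: on each interval of length \<open>1 / N\<close> the function
  deviates by at most \<open>L / N\<close>, which is an error \<open>L / N^2\<close> per
  interval.\<close>

lemma riemann_sum_lipschitz:
  fixes h :: "real \<Rightarrow> real"
  assumes h: "\<And>x y. x \<in> {0..1} \<Longrightarrow> y \<in> {0..1} \<Longrightarrow> \<bar>h x - h y\<bar> \<le> L * \<bar>x - y\<bar>" and "N \<ge> 1"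
  shows "\<bar>(\<Sum>m<N. h (grid N m)) / real N - (\<integral>x. h x \<partial>lebesgue_on {0..1})\<bar> \<le> L / real N"
proof -
  have N: "real N > 0" using \<open>N \<ge> 1\<close> by simp
  have L0: "L \<ge> 0" using h[of 0 1] by auto
  have cont: "continuous_on {0..1} h"
    using L0 h by (intro lipschitz_on_continuous_on[of L] lipschitz_onI) (auto simp: dist_real_def)
  have step: "\<bar>(\<Sum>m<n. h (grid N m)) / real N - integral {0..real n / real N} h\<bar> \<le> real n * (L / real N ^ 2)" if "n \<le> N" for n
    using that
  proof (induct n)
    case (Suc n)
    define a b where "a = real n / real N" and "b = real (Suc n) / real N"
    have ab: "0 \<le> a" "a \<le> b" "b \<le> 1" "b - a = 1 / real N"
      using Suc(2) N by (auto simp: a_def b_def field_simps)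
    have sub: "{a..b} \<subseteq> {0..1}" "{0..b} \<subseteq> {0..1}" using ab by auto
    have int: "h integrable_on {0..b}" "h integrable_on {a..b}"
      by (rule integrable_continuous_real, rule continuous_on_subset[OF cont], rule sub)+
    have "integral {0..b} h = integral {0..a} h + integral {a..b} h"
      by (rule Henstock_Kurzweil_Integration.integral_combine[OF ab(1,2) int(1), symmetric])
    moreover have "\<bar>h b / real N - integral {a..b} h\<bar> \<le> L / real N ^ 2"
    proof -
      have "integral {a..b} (\<lambda>x. h b - h x) = integral {a..b} (\<lambda>x. h b) - integral {a..b} h"
        using int by (intro Henstock_Kurzweil_Integration.integral_diff) auto
      moreover have "integral {a..b} (\<lambda>x. h b) = h b / real N" using ab by simp
      moreover have "norm (integral {a..b} (\<lambda>x. h b - h x)) \<le> (L / real N) * (b - a)"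
      proof (rule integral_bound)
        show "continuous_on {a..b} (\<lambda>x. h b - h x)"
          by (intro continuous_intros continuous_on_subset[OF cont] sub)
        fix x assume x: "x \<in> {a..b}"
        have "\<bar>h b - h x\<bar> \<le> L * \<bar>b - x\<bar>" using x ab by (intro h) auto
        also have "\<dots> \<le> L * (1 / real N)" using x ab L0 by (intro mult_left_mono) auto
        finally show "norm (h b - h x) \<le> L / real N" by simp
      qed (use ab in auto)
      ultimately show ?thesis using ab by (simp add: power2_eq_square)
    qed
    moreover have "(\<Sum>m<Suc n. h (grid N m)) / real N = (\<Sum>m<n. h (grid N m)) / real N + h b / real N"
      by (simp add: grid_def b_def add_divide_distrib)
    moreover have "real (Suc n) * (L / real N ^ 2) = real n * (L / real N ^ 2) + L / real N ^ 2"
      by (simp add: algebra_simps add_divide_distrib)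
    moreover have "\<bar>(\<Sum>m<n. h (grid N m)) / real N - integral {0..a} h\<bar> \<le> real n * (L / real N ^ 2)"
      using Suc by (simp add: a_def)
    ultimately show ?case unfolding b_def[symmetric] by linarith
  qed simp
  have "integrable (lebesgue_on {0..1}) h"
    using continuous_imp_integrable[of 0 1 h] cont by (simp add: cbox_interval)
  then have "(\<integral>x. h x \<partial>lebesgue_on {0..1}) = integral {0..1} h"
    by (intro lebesgue_integral_eq_integral) auto
  then show ?thesis using step[of N] N by (simp add: power2_eq_square)
qed

section \<open>Bernoulli matrices\<close>

text \<open>An entry is given only through its law, so integrals and almost sure statements are
  moved to the two-point distribution. The variance \<open>p - p^2\<close> is bounded by
  \<open>p\<close>.\<close>

lemma bernoulli_entry:
  assumes sb: "symmetric_bernoulli_matrix M N p A" and ij: "i \<le> j" "j < N" and p: "0 \<le> p i j" "p i j \<le> 1"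
  shows "(\<lambda>\<omega>. A \<omega> $$ (i,j)) \<in> borel_measurable M"
    and "AE \<omega> in M. A \<omega> $$ (i,j) = 0 \<or> A \<omega> $$ (i,j) = 1"
    and "(\<integral>\<omega>. A \<omega> $$ (i,j) \<partial>M) = p i j"
    and "(\<integral>\<omega>. (A \<omega> $$ (i,j) - p i j)\<^sup>2 \<partial>M) \<le> p i j"
proof -
  define X where "X \<omega> = A \<omega> $$ (i,j)" for \<omega>
  interpret prob_space M using sb by (simp add: symmetric_bernoulli_matrix_def)
  have "indep_vars (\<lambda>_. borel) (\<lambda>(i, j) \<omega>. A \<omega> $$ (i, j)) {(i, j). i \<le> j \<and> j < N}"
    using sb by (simp add: symmetric_bernoulli_matrix_def)
  then have X: "X \<in> borel_measurable M"
    using ij unfolding indep_vars_def X_def[abs_def] by auto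
  then show "(\<lambda>\<omega>. A \<omega> $$ (i,j)) \<in> borel_measurable M" by (simp add: X_def[abs_def])
  have D: "distr M borel X = distr (measure_pmf (bernoulli_pmf (p i j))) borel of_bool"
    using sb ij unfolding symmetric_bernoulli_matrix_def X_def[abs_def] by blast
  have "AE x in distr (measure_pmf (bernoulli_pmf (p i j))) borel of_bool. x = 0 \<or> x = (1::real)"
    by (subst AE_distr_iff) auto
  then have "AE x in distr M borel X. x = 0 \<or> x = 1" unfolding D .
  then show "AE \<omega> in M. A \<omega> $$ (i,j) = 0 \<or> A \<omega> $$ (i,j) = 1"
    using X by (subst (asm) AE_distr_iff) (auto simp: X_def)
  have E: "(\<integral>\<omega>. g (X \<omega>) \<partial>M) = g 1 * p i j + g 0 * (1 - p i j)" if "g \<in> borel_measurable borel" for g :: "real \<Rightarrow> real"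
  proof -
    have "(\<integral>\<omega>. g (X \<omega>) \<partial>M) = (\<integral>x. g x \<partial>distr M borel X)" by (rule integral_distr[symmetric, OF X that])
    also have "\<dots> = (\<integral>b. g (of_bool b) \<partial>measure_pmf (bernoulli_pmf (p i j)))"
      unfolding D by (rule integral_distr) (use that in auto)
    finally show ?thesis using p by simp
  qed
  have id: "(\<lambda>x. x) \<in> borel_measurable (borel :: real measure)" and sq: "(\<lambda>x. (x - p i j)\<^sup>2) \<in> borel_measurable borel"
    by measurable
  show "(\<integral>\<omega>. A \<omega> $$ (i,j) \<partial>M) = p i j" using E[OF id] by (simp add: X_def)
  have "(\<integral>\<omega>. (A \<omega> $$ (i,j) - p i j)\<^sup>2 \<partial>M) = (1 - p i j)\<^sup>2 * p i j + (p i j)\<^sup>2 * (1 - p i j)"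
    using E[OF sq] by (simp add: X_def)
  also have "\<dots> = p i j - (p i j)\<^sup>2" by (simp add: power2_eq_square algebra_simps)
  finally show "(\<integral>\<omega>. (A \<omega> $$ (i,j) - p i j)\<^sup>2 \<partial>M) \<le> p i j" by simp
qed

lemma bernoulli_symmetric_entry:
  assumes "symmetric_bernoulli_matrix M N p A" "\<omega> \<in> space M" "a < N" "b < N"
  shows "A \<omega> $$ (a,b) = A \<omega> $$ (b,a)"
proof -
  have t: "transpose_mat (A \<omega>) = A \<omega>" and c: "A \<omega> \<in> carrier_mat N N"
    using assms by (auto simp: symmetric_bernoulli_matrix_def)
  have "A \<omega> $$ (a,b) = transpose_mat (A \<omega>) $$ (a,b)" by (simp only: t)
  then show ?thesis using c assms(3,4) by simp
qed

lemma bernoulli_expectation: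
  assumes sb: "symmetric_bernoulli_matrix M N p A" and sym: "\<And>a b. p a b = p b a"
    and p: "\<And>a b. a < N \<Longrightarrow> b < N \<Longrightarrow> 0 \<le> p a b \<and> p a b \<le> 1" and ab: "a < N" "b < N"
  shows "(\<integral>\<omega>. A \<omega> $$ (a,b) \<partial>M) = p a b"
proof (cases "a \<le> b")
  case True
  then show ?thesis using bernoulli_entry(3)[OF sb] p ab by auto
next
  case False
  have "(\<integral>\<omega>. A \<omega> $$ (a,b) \<partial>M) = (\<integral>\<omega>. A \<omega> $$ (b,a) \<partial>M)"
    using bernoulli_symmetric_entry[OF sb _ ab] by (intro Bochner_Integration.integral_cong) auto
  then show ?thesis using False bernoulli_entry(3)[OF sb, of b a] p[of b a] ab sym[of a b] by auto
qed

lemma bernoulli_centred_symmetric: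
  assumes sb: "symmetric_bernoulli_matrix M N p A" and sym: "\<And>a b. p a b = p b a"
    and p: "\<And>a b. a < N \<Longrightarrow> b < N \<Longrightarrow> 0 \<le> p a b \<and> p a b \<le> s"
    and s: "s \<le> 1" "1 \<le> real N * s" "N \<ge> 1"
  shows "centred_symmetric M N (\<lambda>\<omega> a b. A \<omega> $$ (a,b) - p a b) s"
proof -
  interpret prob_space M using sb by (simp add: symmetric_bernoulli_matrix_def)
  note symA = bernoulli_symmetric_entry[OF sb]
  have p1: "0 \<le> p a b \<and> p a b \<le> 1" if "a < N" "b < N" for a b using p[OF that] s by auto
  \<comment> \<open>Laws are prescribed on and above the diagonal only. Transposed entries agree
    merely on \<open>space M\<close>, hence the demand that \<open>P\<close> ignores values outside
    it.\<close>
  have reduce: "P (\<lambda>\<omega>. A \<omega> $$ (a,b) - p a b)"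
    if "\<And>i j. i \<le> j \<Longrightarrow> j < N \<Longrightarrow> P (\<lambda>\<omega>. A \<omega> $$ (i,j) - p i j)"
      and "\<And>X Y. (\<And>\<omega>. \<omega> \<in> space M \<Longrightarrow> X \<omega> = Y \<omega>) \<Longrightarrow> P X \<Longrightarrow> P Y" and "a < N" "b < N"
    for P :: "('a \<Rightarrow> real) \<Rightarrow> bool" and a b
  proof (cases "a \<le> b")
    case False
    then have "P (\<lambda>\<omega>. A \<omega> $$ (b,a) - p b a)" using that by auto
    then show ?thesis using that(2) symA[OF _ that(3,4)] sym[of a b] by (smt (verit))
  qed (use that in auto)
  show ?thesis
  proof
    show "N \<ge> 1" "s \<le> 1" "1 \<le> real N * s" by fact+
    show "0 \<le> s" using p[of 0 0] s by auto
    show "indep_vars (\<lambda>_. borel) (\<lambda>(i,j) \<omega>. A \<omega> $$ (i,j) - p i j) {(i,j). i \<le> j \<and> j < N}"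
    proof -
      have ind: "indep_vars (\<lambda>_. borel) (\<lambda>(i, j) \<omega>. A \<omega> $$ (i, j)) {(i, j). i \<le> j \<and> j < N}"
        using sb by (simp add: symmetric_bernoulli_matrix_def)
      have "indep_vars (\<lambda>_. borel) (\<lambda>e \<omega>. (case e of (i,j) \<Rightarrow> \<lambda>\<omega>. A \<omega> $$ (i,j)) \<omega> - (case e of (i,j) \<Rightarrow> p i j)) {(i,j). i \<le> j \<and> j < N}"
        by (rule indep_vars_compose2[OF ind, of "\<lambda>e x. x - (case e of (i,j) \<Rightarrow> p i j)"]) auto
      then show ?thesis by (simp add: case_prod_unfold)
    qed
    fix a b assume ab: "a < N" "b < N"
    show "A \<omega> $$ (a,b) - p a b = A \<omega> $$ (b,a) - p b a" if "\<omega> \<in> space M" for \<omega>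
      using symA[OF that ab] sym[of a b] by simp
    show "AE \<omega> in M. \<bar>A \<omega> $$ (a,b) - p a b\<bar> \<le> 1"
    proof (rule reduce[OF _ _ ab])
      fix i j assume ij: "i \<le> j" "j < N"
      have "0 \<le> p i j \<and> p i j \<le> 1" using p1 ij by auto
      then show "AE \<omega> in M. \<bar>A \<omega> $$ (i,j) - p i j\<bar> \<le> 1"
        using bernoulli_entry(2)[OF sb ij] by (auto elim!: eventually_mono)
    next
      fix X Y :: "'a \<Rightarrow> real" assume "\<And>\<omega>. \<omega> \<in> space M \<Longrightarrow> X \<omega> = Y \<omega>" "AE \<omega> in M. \<bar>X \<omega>\<bar> \<le> 1"
      then show "AE \<omega> in M. \<bar>Y \<omega>\<bar> \<le> 1" by (simp cong: AE_cong_simp)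
    qed
    show "expectation (\<lambda>\<omega>. A \<omega> $$ (a,b) - p a b) = 0"
    proof (rule reduce[OF _ _ ab])
      fix i j assume ij: "i \<le> j" "j < N"
      have pij: "0 \<le> p i j \<and> p i j \<le> 1" using p1 ij by auto
      have "integrable M (\<lambda>\<omega>. A \<omega> $$ (i,j))"
        using bernoulli_entry(1,2)[OF sb ij] pij by (intro integrable_const_bound[where B = 1]) (auto elim!: eventually_mono)
      then show "expectation (\<lambda>\<omega>. A \<omega> $$ (i,j) - p i j) = 0"
        using bernoulli_entry(3)[OF sb ij] pij by (simp add: prob_space)
    qed (simp cong: Bochner_Integration.integral_cong)
    show "expectation (\<lambda>\<omega>. (A \<omega> $$ (a,b) - p a b)\<^sup>2) \<le> s"
    proof (rule reduce[OF _ _ ab])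
      fix i j assume ij: "i \<le> j" "j < N"
      have pij: "0 \<le> p i j \<and> p i j \<le> 1" "p i j \<le> s" using p1 p ij by auto
      then show "expectation (\<lambda>\<omega>. (A \<omega> $$ (i,j) - p i j)\<^sup>2) \<le> s"
        using bernoulli_entry(4)[OF sb ij] by linarith
    qed (simp cong: Bochner_Integration.integral_cong)
  qed
qed

lemma Bmat_entry:
  fixes r :: "nat \<Rightarrow> real \<Rightarrow> real"
  assumes sb: "symmetric_bernoulli_matrix M N p A" and sym: "\<And>a b. p a b = p b a"
    and p: "\<And>a b. a < N \<Longrightarrow> b < N \<Longrightarrow> 0 \<le> p a b \<and> p a b \<le> 1" and ab: "a < k" "b < k"
  defines "e \<equiv> \<lambda>l a. r l (grid N a) / sqrt N"
  shows "Bmat k \<theta> r M N \<epsilon> A i $$ (a,b) = sqrt (\<theta> (Suc a) * \<theta> (Suc b)) *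
    (real N * \<epsilon> * ip N (e (Suc a)) (e (Suc b))
     + (\<integral>\<omega>. ip N (e (Suc a)) ((mv N (\<lambda>a b. A \<omega> $$ (a,b) - p a b) ^^ 2) (e (Suc b))) \<partial>M) / ((\<theta> i)\<^sup>2 * (real N * \<epsilon>)))"
proof -
  have ev: "scalar_prod (evec r N j) x = ip N (e j) (\<lambda>a. x $ a)" if "x \<in> carrier_vec N" for j x
    using that by (simp add: scalar_prod_def evec_def ip_def e_def atLeast0LessThan)
  have ec: "evec r N l \<in> carrier_vec N" for l by (simp add: evec_def)
  have ee: "scalar_prod (evec r N j) (evec r N l) = ip N (e j) (e l)" for j l
    unfolding ev[OF ec] by (rule ip_cong) (auto simp: evec_def e_def)
  have quad: "scalar_prod (evec r N j) ((centred M N A \<omega> * centred M N A \<omega>) *\<^sub>v evec r N l)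
     = ip N (e j) ((mv N (\<lambda>a b. A \<omega> $$ (a,b) - p a b) ^^ 2) (e l))" if \<omega>: "\<omega> \<in> space M" for \<omega> j l
  proof -
    let ?C = "centred M N A \<omega>"
    have A: "A \<omega> \<in> carrier_mat N N" using sb \<omega> by (simp add: symmetric_bernoulli_matrix_def)
    have C: "?C \<in> carrier_mat N N" using A by (auto simp: centred_def expected_mat_def)
    have entry: "?C $$ (a,b) = A \<omega> $$ (a,b) - p a b" if "a < N" "b < N" for a b
      using that A bernoulli_expectation[OF sb sym p that] by (simp add: centred_def expected_mat_def)
    have mv: "(?C *\<^sub>v x) $ a = mv N (\<lambda>a b. A \<omega> $$ (a,b) - p a b) (\<lambda>a. x $ a) a" if "a < N" "x \<in> carrier_vec N" for a x
      using that C entry by (simp add: scalar_prod_def mv_def atLeast0LessThan)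
    have Ce: "?C *\<^sub>v evec r N l \<in> carrier_vec N" "?C *\<^sub>v (?C *\<^sub>v evec r N l) \<in> carrier_vec N"
      using C ec by auto
    have "(?C * ?C) *\<^sub>v evec r N l = ?C *\<^sub>v (?C *\<^sub>v evec r N l)"
      by (rule assoc_mult_mat_vec[OF C C ec])
    then have "scalar_prod (evec r N j) ((?C * ?C) *\<^sub>v evec r N l) = ip N (e j) (\<lambda>a. (?C *\<^sub>v (?C *\<^sub>v evec r N l)) $ a)"
      using ev[OF Ce(2)] by simp
    also have "\<dots> = ip N (e j) ((mv N (\<lambda>a b. A \<omega> $$ (a,b) - p a b) ^^ 2) (e l))"
    proof (rule ip_cong)
      fix a assume "a < N"
      have "(?C *\<^sub>v (?C *\<^sub>v evec r N l)) $ a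
        = mv N (\<lambda>a b. A \<omega> $$ (a,b) - p a b) (\<lambda>a. (?C *\<^sub>v evec r N l) $ a) a"
        by (rule mv[OF \<open>a < N\<close> Ce(1)])
      also have "\<dots> = mv N (\<lambda>a b. A \<omega> $$ (a,b) - p a b) (mv N (\<lambda>a b. A \<omega> $$ (a,b) - p a b) (\<lambda>a. evec r N l $ a)) a"
        by (rule mv_cong) (rule mv[OF _ ec])
      also have "\<dots> = mv N (\<lambda>a b. A \<omega> $$ (a,b) - p a b) (mv N (\<lambda>a b. A \<omega> $$ (a,b) - p a b) (e l)) a"
        by (intro mv_cong) (auto simp: evec_def e_def)
      finally show "(?C *\<^sub>v (?C *\<^sub>v evec r N l)) $ a = (mv N (\<lambda>a b. A \<omega> $$ (a,b) - p a b) ^^ 2) (e l) a"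
        by (simp add: eval_nat_numeral)
    qed simp
    finally show ?thesis .
  qed
  have "(\<integral>\<omega>. scalar_prod (evec r N (Suc a)) ((centred M N A \<omega> * centred M N A \<omega>) *\<^sub>v evec r N (Suc b)) \<partial>M)
    = (\<integral>\<omega>. ip N (e (Suc a)) ((mv N (\<lambda>a b. A \<omega> $$ (a,b) - p a b) ^^ 2) (e (Suc b))) \<partial>M)"
    by (intro Bochner_Integration.integral_cong refl quad)
  then show ?thesis using ab by (simp add: Bmat_def Let_def ee distrib_left mult.assoc)
qed

lemma sum_from_1: "(\<Sum>l=1..k. f l) = (\<Sum>a<k. f (Suc a))"
  using sum.atLeast1_atMost_eq[of f k] by simp

text \<open>Builds the trial vector from an eigenvector of \<open>B\<close> and instantiates the
  locale. \<open>K\<close> serves both \<open>e l\<close> and \<open>w\<close>, whose coefficients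
  are at most \<open>sqrt (\<theta> 1)\<close>; \<open>C1\<close> bounds
  \<open>|\<mu> - q \<theta> m|\<close>, because \<open>B\<close> differs from \<open>q\<close>
  times the diagonal of the \<open>\<theta>\<close> by bounded entries. Then
  \<open>\<mu> \<ge> q \<theta> m / 2\<close> gives \<open>\<alpha> = 2 / \<theta> m\<close>. The
  two locale constants in the conclusion do not depend on \<open>N\<close>.\<close>

lemma expected_eigenvalue_near_Bmat:
  fixes \<theta> :: "nat \<Rightarrow> real" and r :: "nat \<Rightarrow> real \<Rightarrow> real"
    and M :: "'w measure" and A :: "'w \<Rightarrow> real mat" and \<rho> :: real
  assumes sb: "symmetric_bernoulli_matrix M N (\<lambda>i j. \<epsilon> * edge_kernel k \<theta> r (grid N i) (grid N j)) A"
    and m: "1 \<le> m" "m \<le> k" and kN: "k < N"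
    and dec: "\<And>i j. 1 \<le> i \<Longrightarrow> i \<le> j \<Longrightarrow> j \<le> k \<Longrightarrow> \<theta> j \<le> \<theta> i"
    and \<theta>pos: "\<And>i. 1 \<le> i \<Longrightarrow> i \<le> k \<Longrightarrow> 0 < \<theta> i"
    and f_nonneg: "\<And>a b. a < N \<Longrightarrow> b < N \<Longrightarrow> 0 \<le> edge_kernel k \<theta> r (grid N a) (grid N b)"
    and f_le: "\<And>a b. a < N \<Longrightarrow> b < N \<Longrightarrow> edge_kernel k \<theta> r (grid N a) (grid N b) \<le> F"
    and F: "0 < F" and \<epsilon>: "0 < \<epsilon>" "\<epsilon> * F \<le> 1"
    and r_le: "\<And>l a. l \<in> {1..k} \<Longrightarrow> a < N \<Longrightarrow> \<bar>r l (grid N a)\<bar> \<le> R" and R: "R \<ge> 0"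
  defines "e \<equiv> \<lambda>l a. r l (grid N a) / sqrt N" and "q \<equiv> real N * \<epsilon>"
    and "K \<equiv> R * (1 + real k * sqrt (\<theta> 1))" and "\<Theta> \<equiv> \<theta> 1" and "t \<equiv> (\<theta> m)\<^sup>2"
  defines "C1 \<equiv> real k * (\<Theta> * (\<rho> / F + 6 * K\<^sup>2 * F / t))"
  assumes gram: "\<And>i j. i \<in> {1..k} \<Longrightarrow> j \<in> {1..k} \<Longrightarrow> \<bar>ip N (e i) (e j) - (if i = j then 1 else 0)\<bar> \<le> \<rho> / real N"
    and \<rho>: "0 \<le> \<rho>" "real k * (\<rho> / real N) \<le> 1 / 2" "real k * (\<rho> / real N) * \<Theta> \<le> g / 16"
    and g: "g > 0" "m \<ge> 2 \<Longrightarrow> \<theta> m + g \<le> \<theta> (m - 1)" "(if m < k then \<theta> (Suc m) else 0) + g \<le> \<theta> m"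
    and q: "1 \<le> q" "1 \<le> F * q" "C1 \<le> q * (g / 16)" "C1 \<le> q * (\<theta> m / 2)"
    and c: "c > 0" "c \<le> g / 16" "c \<le> \<theta> m / 4" and p: "p \<ge> 1"
  shows "\<bar>(\<integral>\<omega>. eigval_desc m (A \<omega>) \<partial>M) - eigval_desc m (Bmat k \<theta> r M N \<epsilon> A m)\<bar> * (\<theta> k / 2)
    \<le> random_trial_vector.error_const k t K \<Theta> (2 / \<theta> m) F (3 * C1 / t) g (\<theta> k / 2) / q
      + (random_trial_vector.trivial_const k t K \<Theta> (2 / \<theta> m) F + K\<^sup>2 * (2 + (\<Theta> + g) / F))
        * (real N ^ 5 * fact (Suc (2 * p)) * (F / c\<^sup>2 / q) ^ p)"
proof -
  define P where "P a b = \<epsilon> * edge_kernel k \<theta> r (grid N a) (grid N b)" for a b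
  define W where "W \<omega> a b = A \<omega> $$ (a,b) - P a b" for \<omega> a b
  have N0: "real N > 0" using kN by simp
  have q0: "q > 0" using q by simp
  have \<theta>m: "\<theta> m > 0" using \<theta>pos m by simp
  have t: "t > 0" using \<theta>m by (simp add: t_def)
  have \<theta>\<Theta>: "0 \<le> \<theta> l \<and> \<theta> l \<le> \<Theta>" if "l \<in> {1..k}" for l
    using \<theta>pos[of l] dec[of 1 l] that by (auto simp: \<Theta>_def)
  have \<Theta>: "\<Theta> \<ge> 0" using \<theta>\<Theta>[of m] m by auto
  have sqrt\<theta>: "0 \<le> sqrt (\<theta> l) \<and> sqrt (\<theta> l) \<le> sqrt \<Theta>" if "l \<in> {1..k}" for l using \<theta>\<Theta>[OF that] by simp
  have RK: "R \<le> K" "real k * sqrt \<Theta> * R \<le> K" "0 \<le> K"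
    using R \<Theta> by (auto simp: K_def \<Theta>_def algebra_simps)
  have Psym: "P a b = P b a" for a b by (simp add: P_def edge_kernel_def mult_ac)
  have Pb: "0 \<le> P a b \<and> P a b \<le> F * \<epsilon>" if "a < N" "b < N" for a b
    using f_nonneg[OF that] f_le[OF that] \<epsilon> by (simp add: P_def mult.commute mult_right_mono)
  have sb': "symmetric_bernoulli_matrix M N P A" using sb by (simp add: P_def[abs_def])
  interpret centred_symmetric M N W "F * \<epsilon>"
    unfolding W_def[abs_def]
    by (rule bernoulli_centred_symmetric[OF sb' Psym Pb]) (use \<epsilon> q(2) kN in \<open>auto simp: q_def mult_ac\<close>)
  have P1: "0 \<le> P a b \<and> P a b \<le> 1" if "a < N" "b < N" for a b
    using Pb[OF that] \<epsilon>(2) by (simp add: mult.commute)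
  have e_bound: "\<bar>e l a\<bar> \<le> R / sqrt N" if "l \<in> {1..k}" "a < N" for l a
    using r_le[OF that] by (simp add: e_def abs_divide divide_right_mono)
  have e_bound': "\<bar>e l a\<bar> \<le> K / sqrt N" if "l \<in> {1..k}" "a < N" for l a
    by (rule order_trans[OF e_bound[OF that]]) (use RK(1) in \<open>auto intro!: divide_right_mono\<close>)
  define E where "E j l = expectation (\<lambda>\<omega>. ip N (e j) ((mv N (W \<omega>) ^^ 2) (e l)))" for j l
  have E_bound: "\<bar>E j l\<bar> \<le> 6 * K\<^sup>2 * F * q" if "j \<in> {1..k}" "l \<in> {1..k}" for j l
  proof -
    have "\<bar>E j l\<bar> \<le> K\<^sup>2 * fact (Suc 2) * (real N * (F * \<epsilon>)) ^ (2 div 2)"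
      unfolding E_def by (rule expectation_ip_mv_power) (use e_bound' that in auto)
    then show ?thesis by (simp add: q_def eval_nat_numeral mult_ac)
  qed
  have E_sym: "E j l = E l j" for j l
    unfolding E_def
  proof (intro Bochner_Integration.integral_cong refl)
    fix \<omega> assume "\<omega> \<in> space M"
    then show "ip N (e j) ((mv N (W \<omega>) ^^ 2) (e l)) = ip N (e l) ((mv N (W \<omega>) ^^ 2) (e j))"
      using ip_mv_power_swap[of N "W \<omega>" 2 "e j" "e l"] W_sym by (simp add: ip_commute)
  qed
  define B where "B = Bmat k \<theta> r M N \<epsilon> A m"
  have B: "B \<in> carrier_mat k k" by (simp add: B_def Bmat_def)
  have B_entry: "B $$ (a,b) = sqrt (\<theta> (Suc a)) * sqrt (\<theta> (Suc b)) * (q * ip N (e (Suc a)) (e (Suc b)) + E (Suc a) (Suc b) / (t * q))"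
    if "a < k" "b < k" for a b
    using Bmat_entry[OF sb' Psym P1 that, of \<theta> r \<epsilon> m]
    by (simp add: B_def e_def E_def W_def[abs_def] q_def t_def real_sqrt_mult)
  have B_sym: "transpose_mat B = B"
    using B by (intro eq_matI) (auto simp: B_entry E_sym ip_commute mult.commute)
  obtain x where sp: "spectral k (\<lambda>a b. B $$ (a,b)) (\<lambda>j. eigval_desc (Suc j) B) x"
    using real_symmetric_spectral[OF B B_sym] by blast
  define \<mu> where "\<mu> = eigval_desc m B"
  have mS: "Suc (m - 1) = m" "m - 1 < k" using m by auto
  define b1 where "b1 = \<Theta> * (\<rho> / F + 6 * K\<^sup>2 * F / t)"
  have C1: "C1 = real k * b1" by (simp add: C1_def b1_def)
  have b1: "b1 \<ge> 0" unfolding b1_def using \<Theta> \<rho> F t by (intro mult_nonneg_nonneg add_nonneg_nonneg) auto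
  have B_near: "\<bar>B $$ (a,b) - (if a = b then q * \<theta> (Suc a) else 0)\<bar> \<le> b1" if ab: "a < k" "b < k" for a b
  proof -
    let ?d = "if Suc a = Suc b then 1 else (0::real)"
    have l: "Suc a \<in> {1..k}" "Suc b \<in> {1..k}" using ab by auto
    have "B $$ (a,b) - (if a = b then q * \<theta> (Suc a) else 0)
      = sqrt (\<theta> (Suc a)) * sqrt (\<theta> (Suc b)) * (q * (ip N (e (Suc a)) (e (Suc b)) - ?d) + E (Suc a) (Suc b) / (t * q))"
      using \<theta>\<Theta>[OF l(1)] by (auto simp: B_entry[OF ab] algebra_simps)
    also have "\<bar>\<dots>\<bar> \<le> sqrt \<Theta> * sqrt \<Theta> * (\<rho> / F + 6 * K\<^sup>2 * F / t)"
      unfolding abs_mult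
    proof (intro mult_mono)
      \<comment> \<open>Although \<open>q\<close> is large, \<open>q / N = \<epsilon>\<close> is at
        most \<open>1 / F\<close>, so the Gram error \<open>\<rho> / N\<close> stays bounded after
        scaling.\<close>
      have "\<bar>q * (ip N (e (Suc a)) (e (Suc b)) - ?d)\<bar> \<le> q * (\<rho> / real N)"
        unfolding abs_mult using gram[OF l] q0 by (intro mult_mono) auto
      also have "\<dots> = \<rho> * \<epsilon>" using N0 by (simp add: q_def)
      also have "\<dots> \<le> \<rho> * (1 / F)" using \<epsilon> F \<rho> by (intro mult_left_mono) (auto simp: field_simps)
      finally have 1: "\<bar>q * (ip N (e (Suc a)) (e (Suc b)) - ?d)\<bar> \<le> \<rho> / F" by simp
      have "\<bar>E (Suc a) (Suc b) / (t * q)\<bar> \<le> 6 * K\<^sup>2 * F * q / (t * q)"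
      proof -
        have "\<bar>E (Suc a) (Suc b) / (t * q)\<bar> = \<bar>E (Suc a) (Suc b)\<bar> / (t * q)" using t q0 by (simp add: abs_mult)
        also have "\<dots> \<le> 6 * K\<^sup>2 * F * q / (t * q)"
          using E_bound[OF l] t q0 by (intro divide_right_mono mult_nonneg_nonneg) auto
        finally show ?thesis .
      qed
      then have 2: "\<bar>E (Suc a) (Suc b) / (t * q)\<bar> \<le> 6 * K\<^sup>2 * F / t" using q0 by simp
      show "\<bar>q * (ip N (e (Suc a)) (e (Suc b)) - ?d) + E (Suc a) (Suc b) / (t * q)\<bar> \<le> \<rho> / F + 6 * K\<^sup>2 * F / t"
        using 1 2 by linarith
    qed (use sqrt\<theta> l \<Theta> in auto)
    also have "\<dots> = b1" using \<Theta> by (simp add: b1_def)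
    finally show ?thesis .
  qed
  have \<mu>_near: "\<bar>\<mu> - q * \<theta> m\<bar> \<le> C1"
  proof -
    \<comment> \<open>The standard basis has Gram error 0, so \<open>finite_rank_eigenvalues\<close>
      also applies in dimension \<open>k\<close>, with the deviation of \<open>B\<close> from its
      diagonal model as perturbation.\<close>
    define u where "u l = (\<lambda>a. of_bool (a = l - 1) :: real)" for l :: nat
    have ipu: "ip k (u l) z = z (l - 1)" if "l \<in> {1..k}" for l z
    proof -
      have "ip k (u l) z = (\<Sum>a<k. if a = l - 1 then z (l - 1) else 0)"
        unfolding ip_def u_def by (intro sum.cong) auto
      then show ?thesis using that by auto
    qed
    have close: "\<bar>ip k z (mv k (\<lambda>a b. B $$ (a,b)) z) - q * (\<Sum>l=1..k. \<theta> l * (ip k (u l) z)\<^sup>2)\<bar> \<le> C1 * ip k z z" for z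
    proof -
      have "q * (\<Sum>l=1..k. \<theta> l * (ip k (u l) z)\<^sup>2) = (\<Sum>a<k. q * \<theta> (Suc a) * (z a)\<^sup>2)"
        unfolding sum_from_1 sum_distrib_left by (intro sum.cong refl) (simp add: ipu)
      also have "\<dots> = (\<Sum>a<k. \<Sum>b<k. z a * ((if a = b then q * \<theta> (Suc a) else 0) * z b))"
      proof (intro sum.cong refl)
        fix a assume a: "a \<in> {..<k}"
        have "(\<Sum>b<k. z a * ((if a = b then q * \<theta> (Suc a) else 0) * z b)) = (\<Sum>b<k. if b = a then q * \<theta> (Suc a) * (z a)\<^sup>2 else 0)"
          by (intro sum.cong) (auto simp: power2_eq_square)
        then show "q * \<theta> (Suc a) * (z a)\<^sup>2 = (\<Sum>b<k. z a * ((if a = b then q * \<theta> (Suc a) else 0) * z b))" using a by simp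
      qed
      finally have "q * (\<Sum>l=1..k. \<theta> l * (ip k (u l) z)\<^sup>2) = ip k z (mv k (\<lambda>a b. if a = b then q * \<theta> (Suc a) else 0) z)"
        by (simp add: ip_def mv_def sum_distrib_left)
      then show ?thesis
        using ip_mv_abs_le[of k "\<lambda>a b. B $$ (a,b) - (if a = b then q * \<theta> (Suc a) else 0)" b1 z] B_near
        by (simp add: C1 ip_mv_diff mult.commute[of b1])
    qed
    have gu: "\<bar>ip k (u i) (u j) - (if i = j then 1 else 0)\<bar> \<le> 0" if "i \<in> {1..k}" "j \<in> {1..k}" for i j
      using that ipu[OF that(1), of "u j"] by (auto simp: u_def)
    note ev = finite_rank_eigenvalues[OF sp gu dec \<theta>pos less_imp_le[OF q0] order_refl _ close]
    have "q * \<theta> m - C1 \<le> \<mu>" using ev(1)[of m] m unfolding mS \<mu>_def by simp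
    moreover have "\<mu> \<le> q * \<theta> m + C1"
      using ev(2)[of "m - 1"] mS m unfolding \<mu>_def mS(1) by simp
    ultimately show ?thesis by linarith
  qed
  define y where "y = x (m - 1)"
  have yy: "ip k y y = 1" and yB: "\<And>a. a < k \<Longrightarrow> mv k (\<lambda>a b. B $$ (a,b)) y a = \<mu> * y a"
    using sp mS unfolding spectral_def y_def \<mu>_def by auto
  define cf where "cf l = y (l - 1) * sqrt (\<theta> l)" for l
  define w where "w = (\<lambda>a. \<Sum>l=1..k. cf l * e l a)"
  define \<sigma> where "\<sigma> l = expectation (\<lambda>\<omega>. ip N (e l) ((mv N (W \<omega>) ^^ 2) w))" for l
  have y1: "\<bar>y a\<bar> \<le> 1" if "a < k" for a
  proof -
    have "(y a)\<^sup>2 \<le> ip k y y" unfolding ip_def power2_eq_square using that by (intro member_le_sum) auto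
    then show ?thesis using yy by (simp add: abs_square_le_1)
  qed
  have w_bound: "\<bar>w a\<bar> \<le> K / sqrt N" if "a < N" for a
  proof -
    have "\<bar>w a\<bar> \<le> (\<Sum>l=1..k. \<bar>cf l * e l a\<bar>)" unfolding w_def by (rule sum_abs)
    also have "\<dots> \<le> (\<Sum>l=1..k. sqrt \<Theta> * (R / sqrt N))"
    proof (intro sum_mono)
      fix l assume l: "l \<in> {1..k}"
      have "\<bar>cf l\<bar> \<le> 1 * sqrt \<Theta>"
        unfolding cf_def abs_mult using y1[of "l - 1"] sqrt\<theta>[OF l] l by (intro mult_mono) auto
      then show "\<bar>cf l * e l a\<bar> \<le> sqrt \<Theta> * (R / sqrt N)"
        unfolding abs_mult using e_bound[OF l that] \<Theta> by (intro mult_mono) auto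
    qed
    also have "\<dots> = real k * sqrt \<Theta> * R / sqrt N" by simp
    also have "\<dots> \<le> K / sqrt N" using RK(2) by (intro divide_right_mono) auto
    finally show ?thesis .
  qed
  have norm_le: "ip N v v \<le> K\<^sup>2" if "\<And>a. a < N \<Longrightarrow> \<bar>v a\<bar> \<le> K / sqrt N" for v
  proof -
    have "ip N v v \<le> (\<Sum>a<N. (K / sqrt N)\<^sup>2)"
      unfolding ip_def power2_eq_square[symmetric] using that by (intro sum_mono) (metis abs_ge_zero lessThan_iff power2_abs power_mono)
    also have "\<dots> = K\<^sup>2" using N0 by (simp add: power_divide)
    finally show ?thesis .
  qed
  have \<mu>_ge: "q * \<theta> m / 2 \<le> \<mu>" using \<mu>_near q(4) by (simp add: abs_le_iff field_simps)
  have \<mu>0: "\<mu> > 0" using \<mu>_ge q0 \<theta>m by (smt (verit) divide_pos_pos mult_pos_pos)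
  have eigen: "\<mu> * w a = (\<Sum>l=1..k. q * \<theta> l * (ip N (e l) w + \<sigma> l / (t * q\<^sup>2)) * e l a)" for a
  proof -
    have \<sigma>: "\<sigma> j = (\<Sum>l=1..k. cf l * E j l)" for j
    proof -
      have "\<sigma> j = expectation (\<lambda>\<omega>. \<Sum>l=1..k. cf l * ip N (e j) ((mv N (W \<omega>) ^^ 2) (e l)))"
        unfolding \<sigma>_def w_def mv_power_sum ip_sum_right ..
      also have "\<dots> = (\<Sum>l=1..k. expectation (\<lambda>\<omega>. cf l * ip N (e j) ((mv N (W \<omega>) ^^ 2) (e l))))"
        by (intro Bochner_Integration.integral_sum integrable_mult_right ip_mv_power_integrable)
      finally show ?thesis by (simp add: E_def)
    qed
    \<comment> \<open>Row \<open>j\<close> of \<open>B y = \<mu> y\<close>, with the sums over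
      columns recognised as \<open>e_j' w\<close> and \<open>\<sigma> j\<close>. Multiplied by
      \<open>sqrt (\<theta> j)\<close> and \<open>e j\<close> and summed over \<open>j\<close>, it
      is the vector equation.\<close>
    have row: "\<mu> * y (j - 1) = sqrt (\<theta> j) * (q * ip N (e j) w + \<sigma> j / (t * q))" if j: "j \<in> {1..k}" for j
    proof -
      have jk: "j - 1 < k" "Suc (j - 1) = j" using j by auto
      have "\<mu> * y (j - 1) = (\<Sum>b<k. B $$ (j - 1,b) * y b)" using yB[OF jk(1)] by (simp add: mv_def)
      also have "\<dots> = (\<Sum>b<k. sqrt (\<theta> j) * (q * (cf (Suc b) * ip N (e j) (e (Suc b))) + cf (Suc b) * E j (Suc b) / (t * q)))"
      proof (intro sum.cong refl)
        fix b assume "b \<in> {..<k}"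
        then have b: "b < k" by simp
        show "B $$ (j - 1,b) * y b = sqrt (\<theta> j) * (q * (cf (Suc b) * ip N (e j) (e (Suc b))) + cf (Suc b) * E j (Suc b) / (t * q))"
          unfolding B_entry[OF jk(1) b] jk(2) by (simp add: cf_def algebra_simps)
      qed
      also have "\<dots> = sqrt (\<theta> j) * (q * ip N (e j) w + \<sigma> j / (t * q))"
        unfolding \<sigma> w_def ip_sum_right sum_from_1 sum_distrib_left sum_divide_distrib sum.distrib[symmetric] ..
      finally show ?thesis .
    qed
    have "\<mu> * w a = (\<Sum>l=1..k. (\<mu> * y (l - 1)) * sqrt (\<theta> l) * e l a)"
      by (simp add: w_def cf_def sum_distrib_left mult_ac)
    also have "\<dots> = (\<Sum>l=1..k. q * \<theta> l * (ip N (e l) w + \<sigma> l / (t * q\<^sup>2)) * e l a)"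
    proof (intro sum.cong refl)
      fix l assume l: "l \<in> {1..k}"
      have "(\<mu> * y (l - 1)) * sqrt (\<theta> l) = (sqrt (\<theta> l) * sqrt (\<theta> l)) * (q * ip N (e l) w + \<sigma> l / (t * q))"
        unfolding row[OF l] by (simp only: mult_ac)
      also have "sqrt (\<theta> l) * sqrt (\<theta> l) = \<theta> l" using \<theta>\<Theta>[OF l] by simp
      also have "\<theta> l * (q * ip N (e l) w + \<sigma> l / (t * q)) = q * \<theta> l * (ip N (e l) w + \<sigma> l / (t * q\<^sup>2))"
        using q0 by (simp add: power2_eq_square algebra_simps)
      finally show "(\<mu> * y (l - 1)) * sqrt (\<theta> l) * e l a = q * \<theta> l * (ip N (e l) w + \<sigma> l / (t * q\<^sup>2)) * e l a" by simp
    qed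
    finally show ?thesis .
  qed
  have \<beta>: "\<bar>1 / \<mu> - \<mu> / (t * q\<^sup>2)\<bar> \<le> 3 * C1 / t / q\<^sup>2"
  proof -
    \<comment> \<open>As \<open>t q^2 = (q \<theta> m)^2\<close>, a difference of squares factors
      out \<open>q \<theta> m - \<mu>\<close>, which is at most \<open>C1\<close>; and
      \<open>q \<theta> m + \<mu> \<le> 3 \<mu>\<close> since
      \<open>\<mu> \<ge> q \<theta> m / 2\<close>.\<close>
    have "1 / \<mu> - \<mu> / (t * q\<^sup>2) = (q * \<theta> m - \<mu>) * ((q * \<theta> m + \<mu>) / (\<mu> * (t * q\<^sup>2)))"
      using \<mu>0 q0 \<theta>m by (simp add: t_def field_simps power2_eq_square)
    moreover have "\<bar>(q * \<theta> m + \<mu>) / (\<mu> * (t * q\<^sup>2))\<bar> \<le> 3 / (t * q\<^sup>2)"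
    proof -
      have "(q * \<theta> m + \<mu>) / (\<mu> * (t * q\<^sup>2)) \<le> 3 * \<mu> / (\<mu> * (t * q\<^sup>2))"
        using \<mu>_ge \<mu>0 t q0 by (intro divide_right_mono) auto
      also have "\<dots> = 3 / (t * q\<^sup>2)" using \<mu>0 by simp
      finally show ?thesis using \<mu>0 t q0 \<theta>m by (simp add: abs_of_nonneg)
    qed
    ultimately have "\<bar>1 / \<mu> - \<mu> / (t * q\<^sup>2)\<bar> \<le> C1 * (3 / (t * q\<^sup>2))"
      unfolding abs_mult using \<mu>_near b1 C1 by (simp only: abs_mult) (intro mult_mono, auto simp: abs_minus_commute)
    then show ?thesis by (simp add: mult_ac)
  qed
  interpret random_trial_vector M N W "F * \<epsilon>" k \<theta> e q w \<mu> \<sigma> t K \<Theta> "2 / \<theta> m" F "3 * C1 / t"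
  proof
    show "q \<le> 2 / \<theta> m * \<mu>" using \<mu>_ge \<theta>m by (simp add: field_simps)
    show "ip N w w \<le> K\<^sup>2" by (rule norm_le) (rule w_bound)
    show "ip N (e l) (e l) \<le> K\<^sup>2" if "l \<in> {1..k}" for l by (rule norm_le) (rule e_bound'[OF that])
    show "real N * (F * \<epsilon>) = F * q" by (simp add: q_def)
  qed (use eigen q0 \<mu>0 t \<theta>\<Theta> \<sigma>_def e_bound' w_bound F q \<beta> in auto)
  have A_entry: "A \<omega> $$ (a,b) = q * (\<Sum>l=1..k. \<theta> l * e l a * e l b) + W \<omega> a b"
    if "\<omega> \<in> space M" "a < N" "b < N" for \<omega> a b
  proof -
    have "q * (\<Sum>l=1..k. \<theta> l * e l a * e l b) = P a b"
      unfolding P_def edge_kernel_def sum_distrib_left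
      using N0 by (intro sum.cong refl) (simp add: e_def q_def field_simps)
    then show ?thesis by (simp add: W_def)
  qed
  have P_bdd: "\<bar>q * (\<Sum>l=1..k. \<theta> l * e l a * e l b)\<bar> \<le> 1" if "a < N" "b < N" for a b
  proof -
    \<comment> \<open>Any sample point will do: it identifies the deterministic sum with the success
      probability \<open>P a b\<close>.\<close>
    obtain \<omega> where "\<omega> \<in> space M" using not_empty by blast
    then show ?thesis using A_entry[of \<omega> a b] P1[OF that] that by (simp add: W_def)
  qed
  have w_ge: "\<theta> k / 2 \<le> ip N w w"
  proof -
    \<comment> \<open>Near-orthonormality keeps half of \<open>\<Sum> (cf l)^2\<close>, which is a
      \<open>\<theta>\<close>-weighted average over the unit vector \<open>y\<close> and so at least
      \<open>\<theta> k\<close>.\<close>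
    have "\<bar>ip N w w - (\<Sum>l=1..k. (cf l)\<^sup>2)\<bar> \<le> real (card {1..k}) * (\<rho> / real N) * (\<Sum>l=1..k. (cf l)\<^sup>2)"
      by (rule near_orthonormal_norm[where e = e]) (use gram in \<open>auto simp: w_def\<close>)
    also have "\<dots> \<le> 1 / 2 * (\<Sum>l=1..k. (cf l)\<^sup>2)" using \<rho>(2) by (intro mult_right_mono sum_nonneg) auto
    finally have "1 / 2 * (\<Sum>l=1..k. (cf l)\<^sup>2) \<le> ip N w w" by linarith
    moreover have "\<theta> k \<le> (\<Sum>l=1..k. (cf l)\<^sup>2)"
    proof -
      have "\<theta> k = (\<Sum>a<k. \<theta> k * (y a * y a))" using yy by (simp add: ip_def sum_distrib_left[symmetric])
      also have "\<dots> \<le> (\<Sum>a<k. (cf (Suc a))\<^sup>2)"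
      proof (intro sum_mono)
        fix a assume a: "a \<in> {..<k}"
        have "\<theta> k * (y a * y a) \<le> \<theta> (Suc a) * (y a * y a)" using a by (intro mult_right_mono dec) auto
        also have "\<dots> = (cf (Suc a))\<^sup>2" using \<theta>\<Theta>[of "Suc a"] a by (auto simp: cf_def power_mult_distrib power2_eq_square)
        finally show "\<theta> k * (y a * y a) \<le> (cf (Suc a))\<^sup>2" .
      qed
      finally show ?thesis unfolding sum_from_1 .
    qed
    ultimately show ?thesis by linarith
  qed
  have Acar: "A \<omega> \<in> carrier_mat N N \<and> transpose_mat (A \<omega>) = A \<omega>" if "\<omega> \<in> space M" for \<omega>
    using sb' that by (simp add: symmetric_bernoulli_matrix_def)
  have \<theta>k: "\<theta> k / 2 > 0" using \<theta>pos[of k] m by auto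
  have \<rho>N: "0 \<le> \<rho> / real N" "real k * (\<rho> / real N) < 1" using \<rho>(1,2) by (simp, linarith)
  have \<mu>_close: "\<bar>\<mu> - q * \<theta> m\<bar> \<le> q * (g / 16)" using \<mu>_near q by linarith
  have c\<alpha>: "c * (2 / \<theta> m) \<le> 1 / 2" using c \<theta>m by (simp add: field_simps)
  have "\<bar>expectation (\<lambda>\<omega>. eigval_desc m (A \<omega>)) - \<mu>\<bar> * (\<theta> k / 2) \<le> error_const g (\<theta> k / 2) / q
     + (trivial_const + K\<^sup>2 * (2 + (\<Theta> + g) / F)) * (real N ^ 5 * fact (Suc (2 * p)) * (F / c\<^sup>2 / q) ^ p)"
    by (rule expected_eigenvalue_error[OF Acar A_entry P_bdd m kN gram dec \<theta>pos \<rho>N \<rho>(3) g \<mu>_close c(1,2) c\<alpha> \<theta>k w_ge p])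
  then show ?thesis by (simp only: \<mu>_def B_def)
qed

section \<open>The main theorem\<close>

theorem theorem2p4:
  fixes k :: nat and \<theta> :: "nat \<Rightarrow> real" and r :: "nat \<Rightarrow> real \<Rightarrow> real"
    and \<epsilon> :: "nat \<Rightarrow> real" and \<epsilon>_inf \<xi> :: real
    and M :: "nat \<Rightarrow> 'w measure" and A :: "nat \<Rightarrow> 'w \<Rightarrow> real mat"
  assumes "k \<ge> 1"
    and "\<And>i j. 1 \<le> i \<Longrightarrow> i \<le> j \<Longrightarrow> j \<le> k \<Longrightarrow> \<theta> i \<ge> \<theta> j"
    and "\<And>i. 1 \<le> i \<Longrightarrow> i \<le> k \<Longrightarrow> \<theta> i > 0"
    and "orthonormal_L2 k r"
    and "\<And>x y. x \<in> {0..1} \<Longrightarrow> y \<in> {0..1} \<Longrightarrow> edge_kernel k \<theta> r x y \<ge> 0"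
    and "\<And>N. N \<ge> 1 \<Longrightarrow> 0 < \<epsilon> N"
    and "\<And>N. N \<ge> 1 \<Longrightarrow> \<epsilon> N \<le> inverse (SUP (x, y)\<in>{0..1} \<times> {0..1}. edge_kernel k \<theta> r x y)"
    and "\<And>N. N \<ge> 1 \<Longrightarrow> symmetric_bernoulli_matrix (M N) N
           (\<lambda>i j. \<epsilon> N * edge_kernel k \<theta> r (grid N i) (grid N j)) (A N)"
    and "\<And>i. 1 \<le> i \<Longrightarrow> i \<le> k \<Longrightarrow> \<exists>L. L-lipschitz_on {0..1} (r i)"
    and "\<xi> > 8"
    and "(\<lambda>N. inverse (real N * \<epsilon> N) * ln (real N) powr \<xi>) \<longlonglongrightarrow> 0"
    and "\<epsilon> \<longlonglongrightarrow> \<epsilon>_inf"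
    and "\<epsilon>_inf \<ge> 0"
  shows "\<forall>i\<in>simple_indices k \<theta>.
    (\<lambda>N. (\<integral>\<omega>. eigval_desc i (A N \<omega>) \<partial>(M N)) - eigval_desc i (Bmat k \<theta> r (M N) N (\<epsilon> N) (A N) i))
      \<in> O(\<lambda>N. sqrt (\<epsilon> N) + inverse (real N * \<epsilon> N))"
proof (intro ballI)
  fix m assume "m \<in> simple_indices k \<theta>"
  then have m: "1 \<le> m" "m \<le> k"
    and ext: "theta_ext k \<theta> (m - 1) > theta_ext k \<theta> m" "theta_ext k \<theta> m > theta_ext k \<theta> (m + 1)"
    by (auto simp: simple_indices_def)
  note dec = assms(2) and \<theta>pos = assms(3)
  have gap1: "\<theta> m < \<theta> (m - 1)" if "m \<ge> 2" using ext(1) m that by (auto simp: theta_ext_def split: if_splits)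
  have gap2: "(if m < k then \<theta> (Suc m) else 0) < \<theta> m"
    using ext(2) m \<theta>pos[of m] by (auto simp: theta_ext_def)
  \<comment> \<open>For \<open>m = 1\<close> nothing lies above and 1 is an arbitrary choice. For
    \<open>m = k\<close> the sentinel of \<open>theta_ext\<close> gives no finite gap; the lower
    eigenvalues of \<open>A\<close> sit near 0 on the scale \<open>q\<close>, so the gap is measured
    against 0.\<close>
  define g where "g = min (if m \<ge> 2 then \<theta> (m - 1) - \<theta> m else 1) (\<theta> m - (if m < k then \<theta> (Suc m) else 0))"
  have g: "g > 0" "m \<ge> 2 \<Longrightarrow> \<theta> m + g \<le> \<theta> (m - 1)" "(if m < k then \<theta> (Suc m) else 0) + g \<le> \<theta> m"
    using gap1 gap2 by (auto simp: g_def)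
  have \<theta>m: "\<theta> m > 0" and \<theta>k: "\<theta> k > 0" and \<theta>1: "\<theta> 1 > 0" using \<theta>pos m by auto
  obtain Lf where Lf: "\<And>l. l \<in> {1..k} \<Longrightarrow> (Lf l)-lipschitz_on {0..1} (r l)"
    using assms(9) by (metis atLeastAtMost_iff)
  define L where "L = (\<Sum>l=1..k. Lf l)"
  define R where "R = (\<Sum>l=1..k. \<bar>r l 0\<bar>) + L"
  have Lf0: "Lf l \<ge> 0" if "l \<in> {1..k}" for l using Lf[OF that] by (rule lipschitz_on_nonneg)
  have L0: "L \<ge> 0" unfolding L_def by (intro sum_nonneg Lf0)
  have R0: "R \<ge> 0" unfolding R_def using L0 by (intro add_nonneg_nonneg sum_nonneg) auto
  have lip: "\<bar>r l x - r l y\<bar> \<le> L * \<bar>x - y\<bar>" if "l \<in> {1..k}" "x \<in> {0..1}" "y \<in> {0..1}" for l x y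
  proof -
    have "\<bar>r l x - r l y\<bar> \<le> Lf l * \<bar>x - y\<bar>" using lipschitz_onD[OF Lf[OF that(1)] that(2,3)] by (simp add: dist_real_def)
    also have "\<dots> \<le> L * \<bar>x - y\<bar>"
      unfolding L_def using that Lf0 by (intro mult_right_mono member_le_sum) auto
    finally show ?thesis .
  qed
  have rR: "\<bar>r l x\<bar> \<le> R" if "l \<in> {1..k}" "x \<in> {0..1}" for l x
  proof -
    have "\<bar>r l x - r l 0\<bar> \<le> L * \<bar>x - 0\<bar>" using that by (intro lip) auto
    also have "\<dots> \<le> L * 1" using that L0 by (intro mult_left_mono) auto
    finally have "\<bar>r l x\<bar> \<le> \<bar>r l 0\<bar> + L" by linarith
    also have "\<bar>r l 0\<bar> \<le> (\<Sum>l=1..k. \<bar>r l 0\<bar>)" using that by (intro member_le_sum) auto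
    finally show ?thesis by (simp add: R_def)
  qed
  define F where "F = (SUP (x, y)\<in>{0..1} \<times> {0..1}. edge_kernel k \<theta> r x y)"
  have grid01: "grid N a \<in> {0..1}" if "a < N" for N a using that by (auto simp: grid_def)
  \<comment> \<open>Without boundedness the real-valued \<open>SUP\<close> would not be known to
    dominate the kernel.\<close>
  have bdd: "bdd_above ((\<lambda>(x, y). edge_kernel k \<theta> r x y) ` ({0..1} \<times> {0..1}))"
  proof (rule bdd_aboveI2)
    fix z :: "real \<times> real" assume z: "z \<in> {0..1} \<times> {0..1}"
    have "edge_kernel k \<theta> r (fst z) (snd z) \<le> (\<Sum>i=1..k. \<theta> i * R * R)"
      unfolding edge_kernel_def
    proof (intro sum_mono)
      fix i assume i: "i \<in> {1..k}"
      have "\<bar>\<theta> i * r i (fst z) * r i (snd z)\<bar> \<le> \<theta> i * R * R"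
        unfolding abs_mult using z rR[OF i] \<theta>pos[of i] R0 i by (intro mult_mono mult_nonneg_nonneg) auto
      then show "\<theta> i * r i (fst z) * r i (snd z) \<le> \<theta> i * R * R" by linarith
    qed
    then show "(\<lambda>(x, y). edge_kernel k \<theta> r x y) z \<le> (\<Sum>i=1..k. \<theta> i * R * R)" by (simp add: case_prod_unfold)
  qed
  have f_le: "edge_kernel k \<theta> r x y \<le> F" if "x \<in> {0..1}" "y \<in> {0..1}" for x y
    using cSUP_upper[OF _ bdd, of "(x,y)"] that by (simp add: F_def)
  \<comment> \<open>Positivity of \<open>\<epsilon> 1\<close> forces it: \<open>inverse F\<close> is
    at least \<open>\<epsilon> 1\<close>, hence positive.\<close>
  have F: "F > 0" using assms(6)[of 1] assms(7)[of 1] unfolding F_def[symmetric]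
    by (metis inverse_positive_iff_positive le_numeral_extra(4) order_less_le_trans)
  have \<epsilon>F: "\<epsilon> N * F \<le> 1" if "N \<ge> 1" for N
    using assms(7)[OF that] F unfolding F_def[symmetric] by (simp add: field_simps)
  define q where "q N = real N * \<epsilon> N" for N
  \<comment> \<open>A Lipschitz constant of every product \<open>r i * r j\<close>, whose Riemann
    sums are the Gram entries.\<close>
  define \<rho> where "\<rho> = 2 * R * L"
  have \<rho>0: "\<rho> \<ge> 0" using R0 L0 by (simp add: \<rho>_def)
  have gram: "\<bar>ip N (\<lambda>a. r i (grid N a) / sqrt N) (\<lambda>a. r j (grid N a) / sqrt N) - (if i = j then 1 else 0)\<bar> \<le> \<rho> / real N"
    if "i \<in> {1..k}" "j \<in> {1..k}" "N \<ge> 1" for i j N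
  proof -
    have "\<bar>(\<Sum>a<N. r i (grid N a) * r j (grid N a)) / real N - (\<integral>x. r i x * r j x \<partial>lebesgue_on {0..1})\<bar> \<le> \<rho> / real N"
    proof (rule riemann_sum_lipschitz[OF _ that(3)])
      fix x y :: real assume xy: "x \<in> {0..1}" "y \<in> {0..1}"
      have "r i x * r j x - r i y * r j y = r i x * (r j x - r j y) + (r i x - r i y) * r j y" by (simp add: algebra_simps)
      then have "\<bar>r i x * r j x - r i y * r j y\<bar> \<le> \<bar>r i x\<bar> * \<bar>r j x - r j y\<bar> + \<bar>r i x - r i y\<bar> * \<bar>r j y\<bar>"
        by (simp only: abs_mult[symmetric] abs_triangle_ineq)
      also have "\<dots> \<le> R * (L * \<bar>x - y\<bar>) + (L * \<bar>x - y\<bar>) * R"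
        using rR lip that xy R0 L0 by (intro add_mono mult_mono) auto
      also have "\<dots> = \<rho> * \<bar>x - y\<bar>" by (simp add: \<rho>_def)
      finally show "\<bar>r i x * r j x - r i y * r j y\<bar> \<le> \<rho> * \<bar>x - y\<bar>" .
    qed
    moreover have "(\<integral>x. r i x * r j x \<partial>lebesgue_on {0..1}) = (if i = j then 1 else 0)"
      using assms(4) that unfolding orthonormal_L2_def by blast
    moreover have "ip N (\<lambda>a. r i (grid N a) / sqrt N) (\<lambda>a. r j (grid N a) / sqrt N)
      = (\<Sum>a<N. r i (grid N a) * r j (grid N a)) / real N"
      by (simp add: ip_def sum_divide_distrib)
    ultimately show ?thesis by (simp only:)
  qed
  define K \<Theta> t C1 c where "K = R * (1 + real k * sqrt (\<theta> 1))" and "\<Theta> = \<theta> 1" and "t = (\<theta> m)\<^sup>2"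
    and "C1 = real k * (\<Theta> * (\<rho> / F + 6 * K\<^sup>2 * F / t))" and "c = min (g / 16) (\<theta> m / 4)"
  have c: "c > 0" "c \<le> g / 16" "c \<le> \<theta> m / 4" using g(1) \<theta>m by (auto simp: c_def)
  define EC where "EC = random_trial_vector.error_const k t K \<Theta> (2 / \<theta> m) F (3 * C1 / t) g (\<theta> k / 2)"
  define TC where "TC = random_trial_vector.trivial_const k t K \<Theta> (2 / \<theta> m) F + K\<^sup>2 * (2 + (\<Theta> + g) / F)"
  have ln1: "\<forall>\<^sub>F N in sequentially. 1 \<le> ln (real N)" by real_asymp
  have lim1: "\<forall>\<^sub>F N in sequentially. inverse (real N * \<epsilon> N) * ln (real N) powr \<xi> < 1"
    using assms(11) by (rule order_tendstoD) simp
  have q_ln: "\<forall>\<^sub>F N in sequentially. ln (real N) ^ 4 \<le> q N"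
    using lim1 ln1 eventually_ge_at_top[of 1]
  proof eventually_elim
    case (elim N)
    have "q N > 0" using assms(6)[of N] elim(3) by (simp add: q_def)
    have "ln (real N) ^ 4 = ln (real N) powr 4" using elim(2) by (simp add: powr_realpow)
    also have "\<dots> \<le> ln (real N) powr \<xi>" using elim(2) assms(10) by (intro powr_mono) auto
    also have "\<dots> \<le> q N" using elim(1) \<open>q N > 0\<close> by (simp add: q_def[symmetric] field_simps)
    finally show ?case .
  qed
  have "filterlim (\<lambda>N. ln (real N) ^ 4) at_top sequentially" by real_asymp
  then have q_top: "filterlim q at_top sequentially" using q_ln by (rule filterlim_at_top_mono)
  have q_ge: "\<forall>\<^sub>F N in sequentially. b \<le> q N" for b
    using q_top by (simp add: filterlim_at_top)
  have rho_small: "\<forall>\<^sub>F N in sequentially. b / real N \<le> d" if "d > 0" for b d :: real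
  proof -
    have "(\<lambda>N. b / real N) \<longlonglongrightarrow> 0" by real_asymp
    then have "\<forall>\<^sub>F N in sequentially. b / real N < d" using that by (rule order_tendstoD)
    then show ?thesis by eventually_elim simp
  qed
  have small1: "\<forall>\<^sub>F N in sequentially. real k * \<rho> / real N \<le> 1 / 2"
    and small2: "\<forall>\<^sub>F N in sequentially. real k * \<rho> * \<Theta> / real N \<le> g / 16"
    using g(1) by (auto intro!: rho_small)
  have walk: "\<forall>\<^sub>F N in sequentially. \<exists>p\<ge>1. real N ^ 5 * fact (Suc (2 * p)) * (F / c\<^sup>2 / q N) ^ p \<le> 1 / real N"
    by (rule eventually_walk_length[OF q_ln]) (use F c in auto)
  have "\<forall>\<^sub>F N in sequentially.
      norm ((\<integral>\<omega>. eigval_desc m (A N \<omega>) \<partial>(M N)) - eigval_desc m (Bmat k \<theta> r (M N) N (\<epsilon> N) (A N) m))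
      \<le> 2 / \<theta> k * (\<bar>EC\<bar> + \<bar>TC\<bar> / F) * norm (sqrt (\<epsilon> N) + inverse (real N * \<epsilon> N))"
    using walk eventually_gt_at_top[of k] small1 small2
      q_ge[of 1] q_ge[of "1 / F"] q_ge[of "C1 / (g / 16)"] q_ge[of "C1 / (\<theta> m / 2)"]
  proof eventually_elim
    case (elim N)
    have N1: "N \<ge> 1" and N0: "real N > 0" using elim(2) by auto
    obtain p where p: "p \<ge> 1" "real N ^ 5 * fact (Suc (2 * p)) * (F / c\<^sup>2 / q N) ^ p \<le> 1 / real N" using elim(1) by blast
    have q0: "q N > 0" using elim(5) by simp
    define \<Delta> where "\<Delta> = \<bar>(\<integral>\<omega>. eigval_desc m (A N \<omega>) \<partial>(M N)) - eigval_desc m (Bmat k \<theta> r (M N) N (\<epsilon> N) (A N) m)\<bar>"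
    define Q where "Q = \<bar>EC\<bar> + \<bar>TC\<bar> / F"
    have sm: "real k * (\<rho> / real N) \<le> 1 / 2" "real k * (\<rho> / real N) * \<Theta> \<le> g / 16"
      using elim(3,4) by simp_all
    have qs: "1 \<le> F * q N" "C1 \<le> q N * (g / 16)" "C1 \<le> q N * (\<theta> m / 2)"
      using elim(6,7,8) F g(1) \<theta>m by (simp_all add: field_simps)
    have f_nonneg: "0 \<le> edge_kernel k \<theta> r (grid N a) (grid N b)" and f_le': "edge_kernel k \<theta> r (grid N a) (grid N b) \<le> F"
      if "a < N" "b < N" for a b using assms(5) f_le grid01 that by auto
    have rl: "\<bar>r l (grid N a)\<bar> \<le> R" if "l \<in> {1..k}" "a < N" for l a using rR grid01 that by auto
    note est = expected_eigenvalue_near_Bmat[OF assms(8)[OF N1] m elim(2) dec \<theta>pos f_nonneg f_le' F assms(6)[OF N1]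
      \<epsilon>F[OF N1] rl R0 gram[OF _ _ N1] \<rho>0 sm[unfolded \<Theta>_def] g elim(5)[unfolded q_def] qs[unfolded q_def C1_def K_def \<Theta>_def t_def] c p(1)]
    have "\<Delta> * (\<theta> k / 2) \<le> EC / q N + TC * (real N ^ 5 * fact (Suc (2 * p)) * (F / c\<^sup>2 / q N) ^ p)"
      unfolding \<Delta>_def EC_def TC_def q_def C1_def K_def \<Theta>_def t_def by (rule est) auto
    also have "\<dots> \<le> \<bar>EC\<bar> / q N + \<bar>TC\<bar> * (1 / real N)"
      using p(2) q0 F c by (intro add_mono divide_right_mono mult_mono mult_nonneg_nonneg) auto
    also have "\<dots> \<le> \<bar>EC\<bar> / q N + \<bar>TC\<bar> * (1 / (F * q N))"
    proof (intro add_left_mono mult_left_mono)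
      \<comment> \<open>Converts the remainder \<open>1 / N\<close> from the exceptional event into
        the scale \<open>1 / q\<close>.\<close>
      have "F * q N \<le> real N" using mult_left_mono[OF \<epsilon>F[OF N1], of "real N"] by (simp add: q_def mult_ac)
      then show "1 / real N \<le> 1 / (F * q N)" using F q0 N0 by (intro divide_left_mono) auto
    qed auto
    also have "\<dots> = (\<bar>EC\<bar> + \<bar>TC\<bar> / F) * inverse (q N)" using q0 F by (simp add: field_simps)
    finally have "2 / \<theta> k * (\<Delta> * (\<theta> k / 2)) \<le> 2 / \<theta> k * ((\<bar>EC\<bar> + \<bar>TC\<bar> / F) * inverse (q N))"
      using \<theta>k by (intro mult_left_mono) auto
    then have "\<Delta> \<le> 2 / \<theta> k * (\<bar>EC\<bar> + \<bar>TC\<bar> / F) * inverse (q N)"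
      using \<theta>k unfolding Q_def[symmetric] by (simp add: mult.assoc)
    also have "\<dots> \<le> 2 / \<theta> k * (\<bar>EC\<bar> + \<bar>TC\<bar> / F) * norm (sqrt (\<epsilon> N) + inverse (q N))"
      using \<theta>k F q0 assms(6)[OF N1] by (intro mult_left_mono mult_nonneg_nonneg add_nonneg_nonneg) auto
    finally show ?case by (simp add: \<Delta>_def q_def)
  qed
  then show "(\<lambda>N. (\<integral>\<omega>. eigval_desc m (A N \<omega>) \<partial>(M N)) - eigval_desc m (Bmat k \<theta> r (M N) N (\<epsilon> N) (A N) m))
      \<in> O(\<lambda>N. sqrt (\<epsilon> N) + inverse (real N * \<epsilon> N))"
    by (rule bigoI)
qed

end
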